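(* Let $r\in\{2,3,4,5,7\}$, let $m\ge 1$ be an integer and let $\ell\ge 5$ be a prime. Then for every integer $n$, $$e_{2r}\!\left(\frac{\ell^{2m}n+1}{24}\right)\equiv 0 \pmod{\ell^{2(r-1)m}}.$$
   Context: Let $q=e^{2\pi i\tau}$ with $\operatorname{Im}\tau>0$, $(q;q)_\infty=\prod_{n\ge1}(1-q^n)$, $\sigma_k(n)=\sum_{d\mid n}d^k$, and let $B_n$ be the Bernoulli numbers, $\frac{x}{e^x-1}=\sum_{n\ge0}B_nx^n/n!$. For $r\ge 1$ the Eisenstein series is $E_{2r}(\tau)=1-\frac{4r}{B_{2r}}\sum_{n\ge1}\sigma_{2r-1}(n)q^n$. The numbers $e_{2r}(n)$ are defined by $\sum_{n\ge0}e_{2r}(n)q^n=E_{2r}(\tau)/(q;q)_\infty$. Convention: $e_{2r}(x)=0$ whenever $x$ is not a nonnegative integer. *)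

theory Defs
  imports "HOL-Analysis.Analysis" "HOL-Computational_Algebra.Computational_Algebra"
begin

text \<open>
  All \<open>q\<close>-series are formal power series in \<open>q\<close> over the rationals, with \<open>q\<close> represented by
  \<^const>\<open>fps_X\<close>. This is the usual reading of \<open>q\<close>-expansions: the series below converge absolutely
  for \<open>\<bar>q\<bar> < 1\<close>, so comparing coefficients as formal series or as functions of \<open>\<tau>\<close> amounts to
  the same thing.
\<close>

definition bernoulli_num :: "nat \<Rightarrow> rat" where
  "bernoulli_num n = fact n * fps_nth (fps_X / (fps_exp 1 - 1)) n"

definition sigma :: "nat \<Rightarrow> nat \<Rightarrow> nat" where
  "sigma k n = (\<Sum>d | d dvd n. d ^ k)"

text \<open>The parameter is \<open>r\<close>, half the weight: \<open>eisenstein_fps r\<close> is the \<open>q\<close>-expansion of \<open>E\<^sub>2\<^sub>r\<close>.\<close>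

definition eisenstein_fps :: "nat \<Rightarrow> rat fps" where
  "eisenstein_fps r =
     1 - fps_const (4 * of_nat r / bernoulli_num (2 * r)) *
           Abs_fps (\<lambda>n. if n \<ge> 1 then of_nat (sigma (2 * r - 1) n) else 0)"

text \<open>\<open>(q; q)\<^sub>\<infinity>\<close>, an infinite product in the \<open>X\<close>-adic topology.\<close>

definition qpoch_inf :: "rat fps" where
  "qpoch_inf = (\<Prod>n. 1 - fps_X ^ Suc n)"

text \<open>
  The argument is rational, and the value is \<open>0\<close> outside the nonnegative integers. The values are
  rational numbers; integrality is not built in.
\<close>

definition e_coeff :: "nat \<Rightarrow> rat \<Rightarrow> rat" where
  "e_coeff r x =
     (if x \<in> \<nat> then fps_nth (eisenstein_fps r / qpoch_inf) (nat \<lfloor>x\<rfloor>) else 0)"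

text \<open>
  The division of series and the infinite product above are used only where they have
  their intended meaning.
\<close>

lemma bernoulli_num_egf:
  "Abs_fps (\<lambda>n. bernoulli_num n / fact n) * (fps_exp 1 - 1) = fps_X"
proof -
  have sd: "subdegree (fps_exp 1 - 1 :: rat fps) = 1"
    by (intro subdegreeI) auto
  have nz: "(fps_exp 1 - 1 :: rat fps) \<noteq> 0"
    using sd by force
  have "(fps_exp 1 - 1 :: rat fps) dvd fps_X"
    using nz sd by (simp add: fps_dvd_iff)
  moreover have "Abs_fps (\<lambda>n. bernoulli_num n / fact n) = fps_X / (fps_exp 1 - 1)"
    by (simp add: fps_eq_iff bernoulli_num_def)
  ultimately show ?thesis
    by simp
qed

lemma qpoch_inf_has_prod: "(\<lambda>n. 1 - fps_X ^ Suc n) has_prod qpoch_inf"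
  and qpoch_inf_nth_0 [simp]: "fps_nth qpoch_inf 0 = 1"
proof -
  define P :: "nat \<Rightarrow> rat fps" where "P = (\<lambda>n. \<Prod>i\<le>n. 1 - fps_X ^ Suc i)"
  define L where "L = Abs_fps (\<lambda>k. fps_nth (P k) k)"
  have step: "fps_nth (P (Suc n)) k = fps_nth (P n) k" if "k \<le> n" for n k
  proof -
    have "P (Suc n) = P n - P n * fps_X ^ Suc (Suc n)"
      by (simp add: P_def algebra_simps)
    moreover have "fps_nth (P n * fps_X ^ Suc (Suc n)) k = 0"
      using that by (subst fps_X_power_mult_right_nth) auto
    ultimately show ?thesis
      by simp
  qed
  have stable: "fps_nth (P n) k = fps_nth L k" if "k \<le> n" for n k
    using that by (induction n rule: dec_induct) (auto simp: L_def step)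
  have lim: "P \<longlonglongrightarrow> L"
    by (rule tendsto_fpsI) (use stable in \<open>auto simp: eventually_at_top_linorder\<close>)
  have L0: "fps_nth L 0 = 1"
    by (simp add: L_def P_def)
  then have "L \<noteq> 0"
    by auto
  with lim have hp: "(\<lambda>n. 1 - fps_X ^ Suc n) has_prod L"
    by (simp add: has_prod_def raw_has_prod_def P_def)
  then have "qpoch_inf = L"
    unfolding qpoch_inf_def by (rule has_prod_unique [symmetric])
  with hp L0 show "(\<lambda>n. 1 - fps_X ^ Suc n) has_prod qpoch_inf" "fps_nth qpoch_inf 0 = 1"
    by simp_all
qed

lemma e_coeff_gf: "Abs_fps (\<lambda>n. e_coeff r (of_nat n)) * qpoch_inf = eisenstein_fps r"
proof -
  have "qpoch_inf dvd eisenstein_fps r"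
    by (rule unit_imp_dvd) simp
  moreover have "Abs_fps (\<lambda>n. e_coeff r (of_nat n)) = eisenstein_fps r / qpoch_inf"
    by (simp add: fps_eq_iff e_coeff_def)
  ultimately show ?thesis
    by simp
qed

end

theory Submission
  imports Defs "HOL-Complex_Analysis.Complex_Analysis" "HOL-Probability.Probability" "HOL-Number_Theory.Cong"
begin

text \<open>
  The function \<open>f = E\<^sub>2\<^sub>r / \<eta>\<close> is weakly holomorphic of half-integral weight \<open>2 r - 1/2\<close>,
  and \<open>e\<^sub>2\<^sub>r((n + 1) / 24)\<close> is its coefficient at \<open>q\<close> to the power \<open>n / 24\<close>. The Hecke operator
  \<open>T(l\<^sup>2)\<close> preserves the space of series \<open>F\<close> such that \<open>F \<eta>\<close> is weakly holomorphic of weight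
  \<open>2 r\<close> for the full modular group. As there are no cusp forms of weight \<open>2 r\<close> for the five values
  of \<open>r\<close>, a member of this space is determined by its principal part, and it has integral
  coefficients as soon as the principal part has. Inverting \<open>T(l\<^sup>2)\<close> on principal parts gives members
  with a single pole of order \<open>l\<^sup>2\<^sup>j / 24\<close> that are linked by the three-term relation of \<open>T(l\<^sup>2)\<close>;
  reading that relation coefficientwise, every factor \<open>l\<^sup>2\<close> in the index contributes a factor
  \<open>l\<close> to the power \<open>2 (r - 1)\<close>.

  The multiplier system of \<open>\<eta>\<close> is avoided: the behaviour of \<open>T(l\<^sup>2) f\<close> under \<open>z \<mapsto> -1 / z\<close> is
  only needed on the imaginary axis, where it follows from Poisson summation for the pentagonal number
  series on vertical lines through rational points, with quadratic Gauss sums as multipliers. The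
  identity theorem then extends it to the half-plane.
\<close>

section \<open>Euler's pentagonal number theorem\<close>

text \<open>The obstacle is that E_2r / eta is not an eigenform: T(l^2) enlarges its pole, so a
  congruence for its coefficients alone does not reproduce itself under induction. What is proved
  instead concerns all forms with a single pole of order l^(2 j) / 24 at once, with the exponent 2
  (r - 1) (m - j); the theorem is the case j = 0. The induction works because the only contribution
  without a power of l comes from the form with index j - 1, whose exponent is larger by exactly the
  missing amount.

  The second obstacle is integrality of these forms. Inverting T(l^2) divides by l^(4 r - 3) at
  every step, and nothing in the recursion shows that the quotients are integral. The absence of
  cusp forms enters only here, for the weights 4, 6, 8, 10 and 14.

  The Gauss sums G(a) that occur have modulus l or l^2. Modulo l^2 the value is l, and modulo l only
  the product G(a) G(-a) = l enters, so their signs are never determined. The recurring constant 576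
  is 24^2: diagonal entries of the matrices are multiples of 24, since translation by 24 fixes all
  powers of q^(1/24).\<close>

definition qprod :: "'a::comm_ring_1 \<Rightarrow> nat \<Rightarrow> nat \<Rightarrow> 'a" where
  "qprod q s n = (\<Prod>i\<in>{s<..n}. 1 - q ^ i)"

lemma qprod_self [simp]: "qprod q n n = 1"
  by (simp add: qprod_def)

lemma qprod_Suc: "s \<le> n \<Longrightarrow> qprod q s (Suc n) = qprod q s n * (1 - q ^ Suc n)"
proof -
  assume "s \<le> n"
  then have "{s<..Suc n} = insert (Suc n) {s<..n}" by auto
  then show ?thesis by (simp add: qprod_def mult.commute)
qed

lemma qprod_rec: "s < n \<Longrightarrow> qprod q s n = (1 - q ^ Suc s) * qprod q (Suc s) n"
proof -
  assume "s < n"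
  then have "{s<..n} = insert (Suc s) {Suc s<..n}" by auto
  then show ?thesis by (simp add: qprod_def)
qed

text \<open>Shanks' finite form of the pentagonal number theorem; without denominators, it applies to formal
  power series and to complex numbers alike.\<close>

definition shanks :: "'a::comm_ring_1 \<Rightarrow> nat \<Rightarrow> 'a" where
  "shanks q n = (\<Sum>s\<le>n. (-1) ^ s * qprod q s n * q ^ (s * n + s * (s + 1) div 2))"

text \<open>The generalized pentagonal numbers 0, 2, 1, 7, 5, ... for j = 0, 1, -1, 2, -2. The
  product is even and nonnegative, so neither \<open>div\<close> nor \<open>nat\<close> loses
  anything.\<close>

definition gpent :: "int \<Rightarrow> nat" where
  "gpent j = nat (j * (3 * j + 1) div 2)"

lemma tri_Suc: "Suc s * (Suc s + 1) div 2 = s * (s + 1) div 2 + Suc s"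
  by simp

text \<open>Telescoping in s: expanding the last factor of \<open>qprod q s (Suc n)\<close> splits
  each term as \<open>B s - C s\<close>, and \<open>qprod_rec\<close> turns \<open>B (Suc s)\<close>
  into the corresponding term of \<open>shanks q n\<close> plus \<open>C s\<close>. What survives is
  \<open>C n\<close> and the new term with s = n + 1; these have the two new pentagonal
  exponents.\<close>

lemma shanks_Suc:
  fixes q :: "'a::comm_ring_1"
  shows "shanks q (Suc n) = shanks q n +
     (-1) ^ Suc n * (q ^ (Suc n * Suc n + Suc n * (Suc n + 1) div 2) + q ^ (Suc n * Suc n + n * (n + 1) div 2))"
proof -
  let ?t = "\<lambda>s::nat. s * (s + 1) div 2"
  define B where "B = (\<lambda>s. (-1) ^ s * qprod q s n * q ^ (s * n + s + ?t s) :: 'a)"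
  define C where "C = (\<lambda>s. (-1) ^ s * qprod q s n * q ^ (Suc s * Suc n + ?t s) :: 'a)"
  have A: "(-1) ^ s * qprod q s (Suc n) * q ^ (s * Suc n + ?t s) = B s - C s" if "s \<le> n" for s
  proof -
    have e: "s * n + s + ?t s + Suc n = Suc s * Suc n + ?t s" by simp
    show ?thesis
      using that unfolding B_def C_def e[symmetric] power_add
      by (simp add: qprod_Suc algebra_simps power_add)
  qed
  have B0: "B 0 = (-1) ^ 0 * qprod q 0 n * q ^ (0 * n + ?t 0)"
    by (simp add: B_def)
  have BS: "B (Suc s) = (-1) ^ Suc s * qprod q (Suc s) n * q ^ (Suc s * n + ?t (Suc s)) + C s"
    if "s < n" for s
  proof -
    have e1: "Suc s * n + Suc s + ?t (Suc s) = Suc s + (Suc s * n + ?t (Suc s))" by simp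
    have e2: "Suc s * Suc n + ?t s = Suc s * n + ?t (Suc s)"
      unfolding tri_Suc by simp
    show ?thesis
      unfolding B_def C_def e1 e2 qprod_rec[OF that] power_add[of q "Suc s"]
      by (simp add: algebra_simps)
  qed
  have "shanks q (Suc n) = (\<Sum>s\<le>n. B s - C s) + (-1) ^ Suc n * q ^ (Suc n * Suc n + ?t (Suc n))"
    unfolding shanks_def sum.atMost_Suc
    by (intro arg_cong2[of _ _ _ _ "(+)"] sum.cong) (use A in auto)
  also have "(\<Sum>s\<le>n. B s - C s) = (\<Sum>s\<le>n. B s) - (\<Sum>s<n. C s) - C n"
    by (simp add: sum_subtractf lessThan_Suc_atMost[symmetric])
  also have "(\<Sum>s\<le>n. B s) = B 0 + (\<Sum>s<n. B (Suc s))"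
    by (cases n) (simp_all only: sum.atMost_Suc_shift lessThan_Suc_atMost, simp_all)
  also have "(\<Sum>s<n. B (Suc s)) = (\<Sum>s<n. (-1) ^ Suc s * qprod q (Suc s) n * q ^ (Suc s * n + ?t (Suc s))) + (\<Sum>s<n. C s)"
    unfolding sum.distrib[symmetric] by (rule sum.cong[OF refl], rule BS) simp
  also have "B 0 + ((\<Sum>s<n. (-1) ^ Suc s * qprod q (Suc s) n * q ^ (Suc s * n + ?t (Suc s))) + (\<Sum>s<n. C s)) - (\<Sum>s<n. C s) - C n
     = shanks q n - C n"
    unfolding shanks_def B0
    by (cases n) (simp_all only: sum.atMost_Suc_shift lessThan_Suc_atMost algebra_simps, simp_all)
  also have "C n = (-1) ^ n * q ^ (Suc n * Suc n + ?t n)"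
    by (simp add: C_def)
  finally show ?thesis
    by (simp add: algebra_simps)
qed

lemma gpent_pos: "gpent (int n) = n * n + n * (n + 1) div 2"
proof -
  have "even (n * (n + 1))" by simp
  then obtain m where m: "n * (n + 1) = 2 * m" by blast
  have "int n * (3 * int n + 1) = 2 * (int n * int n) + int (n * (n + 1))"
    by (simp add: algebra_simps)
  also have "\<dots> = 2 * (int n * int n + int m)" unfolding m by simp
  finally have "gpent (int n) = nat (int n * int n + int m)" by (simp add: gpent_def)
  also have "\<dots> = n * n + m" by (simp add: nat_add_distrib nat_mult_distrib)
  also have "m = n * (n + 1) div 2" unfolding m by simp
  finally show ?thesis .
qed

lemma gpent_neg: "gpent (- int (Suc n)) = Suc n * Suc n + n * (n + 1) div 2"
proof -
  have "even (n * (n + 1))" by simp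
  then obtain m where m: "n * (n + 1) = 2 * m" by blast
  have "- int (Suc n) * (3 * (- int (Suc n)) + 1) = 2 * (int (Suc n) * int (Suc n)) + int (n * (n + 1))"
    by (simp add: algebra_simps)
  also have "\<dots> = 2 * (int (Suc n) * int (Suc n)) + int (2 * m)" unfolding m by (rule refl)
  also have "\<dots> = 2 * (int (Suc n * Suc n) + int m)" by (simp only: of_nat_mult of_nat_numeral distrib_left)
  finally have "gpent (- int (Suc n)) = nat (int (Suc n * Suc n) + int m)" by (simp add: gpent_def)
  also have "\<dots> = Suc n * Suc n + m" by (simp only: nat_int flip: of_nat_add)
  also have "m = n * (n + 1) div 2" unfolding m by simp
  finally show ?thesis .
qed

lemma shanks_eq:
  fixes q :: "'a::comm_ring_1"
  shows "shanks q n = (\<Sum>j=-int n..int n. (-1) ^ nat \<bar>j\<bar> * q ^ gpent j)"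
proof (induction n)
  case 0
  then show ?case by (simp add: shanks_def gpent_def)
next
  case (Suc n)
  have "{-int (Suc n)..int (Suc n)} = insert (int (Suc n)) (insert (- int (Suc n)) {-int n..int n})"
    by auto
  then have "(\<Sum>j=-int (Suc n)..int (Suc n). (-1) ^ nat \<bar>j\<bar> * q ^ gpent j) =
     (-1) ^ Suc n * q ^ gpent (int (Suc n)) + ((-1) ^ Suc n * q ^ gpent (-int (Suc n)) +
     (\<Sum>j=-int n..int n. (-1) ^ nat \<bar>j\<bar> * q ^ gpent j))"
    by (simp only:) (subst sum.insert, simp, simp, subst sum.insert, simp_all add: nat_add_distrib)
  then show ?case
    unfolding shanks_Suc Suc.IH gpent_pos gpent_neg by (simp only: distrib_left add_ac)
qed

text \<open>Completing the square. This is the source of the exponents n^2 / 24 with n = 6 j + 1 in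
  the theta series of eta, and it yields injectivity, as 6 i + 1 = -(6 j + 1) is impossible modulo
  3.\<close>

lemma gpent_24: "24 * int (gpent j) + 1 = (6 * j + 1) ^ 2"
proof -
  have "even (j * (3 * j + 1))" by simp
  then obtain m where m: "j * (3 * j + 1) = 2 * m" by blast
  have "0 \<le> j * (3 * j + 1)"
    by (cases "j \<ge> 0") (auto simp: mult_nonneg_nonneg mult_nonpos_nonpos)
  then have "int (gpent j) = m" using m by (simp add: gpent_def)
  then show ?thesis using m by (simp add: power2_eq_square algebra_simps)
qed

lemma inj_gpent: "inj gpent"
proof (rule injI)
  fix i j assume "gpent i = gpent j"
  then have "(6 * i + 1) ^ 2 = (6 * j + 1) ^ 2" by (simp flip: gpent_24)
  then have "6 * i + 1 = 6 * j + 1 \<or> 6 * i + 1 = - (6 * j + 1)" by (simp add: power2_eq_iff)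
  then show "i = j" by presburger
qed

lemma gpent_ge: "nat \<bar>j\<bar> \<le> gpent j"
proof -
  have "\<bar>j\<bar> \<le> \<bar>j\<bar> * \<bar>j\<bar>"
    using mult_right_mono[of 1 "\<bar>j\<bar>" "\<bar>j\<bar>"] by (cases "j = 0") auto
  then have "\<bar>j\<bar> \<le> j * j" by simp
  moreover have "24 * int (gpent j) = 36 * (j * j) + 12 * j"
    using gpent_24[of j] by (simp add: power2_eq_square algebra_simps)
  ultimately show ?thesis by linarith
qed

section \<open>The Euler product as a power series and as a function on the unit disc\<close>

lemma norm_qprod_le:
  fixes q :: complex
  assumes "norm q < 1"
  shows "norm (qprod q s n) \<le> exp (1 / (1 - norm q))"
proof -
  have "norm (qprod q s n) \<le> (\<Prod>i\<in>{s<..n}. exp (norm q ^ i))"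
    unfolding qprod_def prod_norm[symmetric]
  proof (intro prod_mono conjI)
    fix i
    have "norm (1 - q ^ i) \<le> 1 + norm q ^ i"
      using norm_triangle_ineq4[of 1 "q ^ i"] by (simp add: norm_power)
    also have "\<dots> \<le> exp (norm q ^ i)" by (rule exp_ge_add_one_self)
    finally show "norm (1 - q ^ i) \<le> exp (norm q ^ i)" .
  qed auto
  also have "\<dots> = exp (\<Sum>i\<in>{s<..n}. norm q ^ i)" by (simp add: exp_sum)
  also have "(\<Sum>i\<in>{s<..n}. norm q ^ i) \<le> (\<Sum>i. norm q ^ i)"
    using assms by (intro sum_le_suminf summable_geometric) auto
  also have "(\<Sum>i. norm q ^ i) = 1 / (1 - norm q)"
    using assms by (intro suminf_geometric) auto
  finally show ?thesis by simp
qed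

lemma qprod_conv_prod: "qprod q 0 (Suc n) = (\<Prod>i\<le>n. 1 - q ^ Suc i)"
  by (induction n) (simp_all add: qprod_Suc[of 0 "Suc n" for n] qprod_rec[of 0 "Suc 0"])

definition euler_fps :: "complex fps" where
  "euler_fps = Abs_fps (\<lambda>n. of_rat (fps_nth qpoch_inf n))"

text \<open>The coefficient of degree n is already that of a partial product with m > n factors, and
  there it agrees with the one of \<open>shanks fps_X m\<close>, because the terms with s >= 1 have
  order at least m.\<close>

lemma qpoch_inf_nth:
  "fps_nth qpoch_inf n = (if n \<in> range gpent then (-1) ^ nat \<bar>inv gpent n\<bar> else 0)"
proof -
  have "(\<lambda>n. \<Prod>i\<le>n. 1 - fps_X ^ Suc i) \<longlonglongrightarrow> qpoch_inf"
    using qpoch_inf_has_prod has_prod_imp_tendsto by blast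
  then have "eventually (\<lambda>m. fps_nth (\<Prod>i\<le>m. 1 - fps_X ^ Suc i) n = fps_nth qpoch_inf n) sequentially"
    by (simp add: tendsto_fps_iff)
  then obtain M where M: "\<And>m. m \<ge> M \<Longrightarrow> fps_nth (\<Prod>i\<le>m. 1 - fps_X ^ Suc i) n = fps_nth qpoch_inf n"
    by (auto simp: eventually_at_top_linorder)
  define m where "m = Suc (M + n)"
  have "fps_nth qpoch_inf n = fps_nth (qprod fps_X 0 m) n"
    unfolding m_def qprod_conv_prod by (rule M[symmetric]) simp
  also have "\<dots> = fps_nth (shanks fps_X m) n"
  proof -
    have "shanks fps_X m = qprod fps_X 0 m + (\<Sum>s=1..m. (-1) ^ s * qprod fps_X s m * fps_X ^ (s * m + s * (s + 1) div 2) :: rat fps)"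
      unfolding shanks_def atMost_atLeast0 by (subst sum.atLeast_Suc_atMost) simp_all
    moreover have "fps_nth ((-1) ^ s * qprod fps_X s m * fps_X ^ (s * m + s * (s + 1) div 2) :: rat fps) n = 0"
      if "s \<in> {1..m}" for s
    proof -
      have "n < m" by (simp add: m_def)
      also have "m \<le> s * m" using that by simp
      finally have "n < s * m + s * (s + 1) div 2" by simp
      then show ?thesis by (simp add: fps_X_power_mult_right_nth)
    qed
    ultimately show ?thesis by (simp add: fps_sum_nth)
  qed
  also have "\<dots> = (\<Sum>j=-int m..int m. if n = gpent j then (-1) ^ nat \<bar>j\<bar> else 0)"
    unfolding shanks_eq fps_sum_nth
  proof (rule sum.cong)
    fix j
    show "fps_nth ((-1) ^ nat \<bar>j\<bar> * fps_X ^ gpent j :: rat fps) n = (if n = gpent j then (-1) ^ nat \<bar>j\<bar> else 0)"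
      by (cases "even (nat \<bar>j\<bar>)") (simp_all add: fps_X_power_nth)
  qed simp
  also have "\<dots> = (if n \<in> range gpent then (-1) ^ nat \<bar>inv gpent n\<bar> else 0)"
  proof (cases "n \<in> range gpent")
    case True
    then obtain j where j: "n = gpent j" by auto
    then have "j \<in> {-int m..int m}" using gpent_ge[of j] by (auto simp: m_def)
    moreover have "(n = gpent i) = (i = j)" for i using j inj_gpent by (auto dest: injD)
    ultimately show ?thesis using j by (simp add: inv_f_f inj_gpent sum.delta)
  next
    case False
    then show ?thesis by (auto intro!: sum.neutral)
  qed
  finally show ?thesis .
qed

lemma euler_fps_nth:
  "fps_nth euler_fps n = (if n \<in> range gpent then (-1) ^ nat \<bar>inv gpent n\<bar> else 0)"
  by (simp add: euler_fps_def qpoch_inf_nth of_rat_power of_rat_minus)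

lemma fps_conv_radius_ge_1I:
  fixes A :: "complex fps"
  assumes "\<And>x::real. 0 < x \<Longrightarrow> x < 1 \<Longrightarrow> summable (\<lambda>n. norm (fps_nth A n) * x ^ n)"
  shows "fps_conv_radius A \<ge> 1"
  unfolding fps_conv_radius_def
proof (rule conv_radius_geI_ex)
  fix r :: real assume r: "0 < r" "ereal r < 1"
  then have "summable (\<lambda>n. norm (fps_nth A n * of_real r ^ n))"
    using assms[of r] by (simp add: norm_mult norm_power)
  then show "\<exists>z. norm z = r \<and> summable (\<lambda>n. fps_nth A n * z ^ n)"
    using r by (intro exI[of _ "of_real r"]) (auto intro: summable_norm_cancel)
qed

lemma euler_fps_conv_radius: "fps_conv_radius euler_fps \<ge> 1"
proof (rule fps_conv_radius_ge_1I)
  fix x :: real assume x: "0 < x" "x < 1"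
  show "summable (\<lambda>n. norm (fps_nth euler_fps n) * x ^ n)"
    by (rule summable_comparison_test'[OF summable_geometric[of x]])
       (use x in \<open>auto simp: euler_fps_nth norm_power\<close>)
qed

lemma euler_has_sum:
  assumes "norm q < 1"
  shows "((\<lambda>j. (-1) ^ nat \<bar>j\<bar> * q ^ gpent j) has_sum eval_fps euler_fps q) UNIV"
proof -
  have "ereal (norm q) < fps_conv_radius euler_fps"
    using assms euler_fps_conv_radius by (meson ereal_less(3) less_le_trans)
  then have "summable (\<lambda>n. norm (fps_nth euler_fps n * q ^ n))"
    and "(\<lambda>n. fps_nth euler_fps n * q ^ n) sums eval_fps euler_fps q"
    by (auto intro!: norm_summable_fps sums_eval_fps)
  then have "((\<lambda>n. fps_nth euler_fps n * q ^ n) has_sum eval_fps euler_fps q) UNIV"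
    by (intro norm_summable_imp_has_sum)
  then have "((\<lambda>n. fps_nth euler_fps n * q ^ n) has_sum eval_fps euler_fps q) (range gpent)"
    by (rule has_sum_cong_neutral[THEN iffD1, rotated -1]) (auto simp: euler_fps_nth)
  then have "((\<lambda>n. fps_nth euler_fps n * q ^ n) \<circ> gpent has_sum eval_fps euler_fps q) UNIV"
    by (subst (asm) has_sum_reindex) (simp_all add: inj_gpent)
  then show ?thesis
    by (simp add: o_def euler_fps_nth inv_f_f inj_gpent)
qed

text \<open>The formal identity does not give the value of the product at a complex q, so Shanks'
  identity is used a second time, now with complex q. Its terms with s >= 1 are bounded by a
  constant times |q|^n, so \<open>shanks q n\<close> and \<open>qprod q 0 n\<close> have the same
  limit. The product form is what shows that eta has no zeros.\<close>

lemma eval_euler_fps_has_prod: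
  assumes q: "norm q < 1"
  shows "(\<lambda>n. 1 - q ^ Suc n) has_prod eval_fps euler_fps q"
proof -
  have "abs_convergent_prod (\<lambda>n. 1 - q ^ Suc n)"
    unfolding abs_convergent_prod_conv_summable using q by (simp add: norm_mult norm_power summable_mult)
  then have conv: "convergent_prod (\<lambda>n. 1 - q ^ Suc n)"
    by (rule abs_convergent_prod_imp_convergent_prod)
  then have lim: "(\<lambda>n. qprod q 0 (Suc n)) \<longlonglongrightarrow> prodinf (\<lambda>n. 1 - q ^ Suc n)"
    unfolding qprod_conv_prod by (rule convergent_prod_LIMSEQ)
  have "((\<lambda>j. (-1) ^ nat \<bar>j\<bar> * q ^ gpent j) has_sum eval_fps euler_fps q) UNIV"
    by (rule euler_has_sum[OF q])
  moreover have "filterlim (\<lambda>n. {-int n..int n}) (finite_subsets_at_top UNIV) sequentially"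
    unfolding filterlim_finite_subsets_at_top
  proof (intro allI impI)
    fix X :: "int set" assume "finite X \<and> X \<subseteq> UNIV"
    then obtain B where B: "\<And>x. x \<in> X \<Longrightarrow> \<bar>x\<bar> \<le> B"
      by (metis finite_imageI Max_ge imageI)
    show "\<forall>\<^sub>F n in sequentially. finite {-int n..int n} \<and> X \<subseteq> {-int n..int n} \<and> {-int n..int n} \<subseteq> UNIV"
      using eventually_ge_at_top[of "nat B"] by eventually_elim (auto dest!: B)
  qed
  ultimately have "(\<lambda>n. shanks q n) \<longlonglongrightarrow> eval_fps euler_fps q"
    unfolding shanks_eq has_sum_def by (rule filterlim_compose)
  then have lim2: "(\<lambda>n. shanks q (Suc n)) \<longlonglongrightarrow> eval_fps euler_fps q"
    by (rule LIMSEQ_Suc)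
  have "(\<lambda>n. shanks q (Suc n) - qprod q 0 (Suc n)) \<longlonglongrightarrow> 0"
  proof (rule Lim_null_comparison)
    define C where "C = exp (1 / (1 - norm q))"
    have bound: "norm (shanks q n - qprod q 0 n) \<le> of_nat n * (C * norm q ^ n)" for n
    proof -
      have "shanks q n - qprod q 0 n = (\<Sum>s=1..n. (-1) ^ s * qprod q s n * q ^ (s * n + s * (s + 1) div 2))"
        unfolding shanks_def atMost_atLeast0 by (subst sum.atLeast_Suc_atMost) simp_all
      also have "norm \<dots> \<le> (\<Sum>s=1..n. C * norm q ^ n)"
      proof (rule sum_norm_le)
        fix s assume s: "s \<in> {1..n}"
        then have "n \<le> s * n" by simp
        then have "n \<le> s * n + s * (s + 1) div 2" by (rule trans_le_add1)
        then have "norm q ^ (s * n + s * (s + 1) div 2) \<le> norm q ^ n"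
          using q by (intro power_decreasing) auto
        moreover have "norm (qprod q s n) \<le> C" unfolding C_def by (rule norm_qprod_le[OF q])
        ultimately show "norm ((-1) ^ s * qprod q s n * q ^ (s * n + s * (s + 1) div 2)) \<le> C * norm q ^ n"
          unfolding norm_mult norm_power by (simp add: mult_mono C_def)
      qed
      also have "\<dots> = of_nat n * (C * norm q ^ n)" by simp
      finally show ?thesis .
    qed
    show "\<forall>\<^sub>F n in sequentially. norm (shanks q (Suc n) - qprod q 0 (Suc n)) \<le> of_nat (Suc n) * (C * norm q ^ Suc n)"
      by (intro always_eventually allI bound)
    have "(\<lambda>n. of_nat n * norm q ^ n) \<longlonglongrightarrow> (0::real)"
      using q by (intro powser_times_n_limit_0) simp
    then have "(\<lambda>n. C * (of_nat n * norm q ^ n)) \<longlonglongrightarrow> C * 0" by (intro tendsto_intros)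
    then have "(\<lambda>n. of_nat n * (C * norm q ^ n)) \<longlonglongrightarrow> 0" by (simp add: mult_ac)
    then show "(\<lambda>n. of_nat (Suc n) * (C * norm q ^ Suc n)) \<longlonglongrightarrow> 0" by (rule LIMSEQ_Suc)
  qed
  from tendsto_diff[OF lim2 this] have "(\<lambda>n. qprod q 0 (Suc n)) \<longlonglongrightarrow> eval_fps euler_fps q" by simp
  with lim have "prodinf (\<lambda>n. 1 - q ^ Suc n) = eval_fps euler_fps q" by (rule LIMSEQ_unique)
  with conv show ?thesis using convergent_prod_has_prod by metis
qed

lemma eval_euler_fps_nonzero:
  assumes q: "norm q < 1"
  shows "eval_fps euler_fps q \<noteq> 0"
proof -
  have "1 - q ^ Suc n \<noteq> 0" for n
  proof
    assume "1 - q ^ Suc n = 0"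
    then have "norm (q ^ Suc n) = 1" by simp
    moreover have "norm (q ^ Suc n) < 1" unfolding norm_power using q power_strict_decreasing[of 0 "Suc n" "norm q"]
      by (cases "q = 0") simp_all
    ultimately show False by simp
  qed
  then show ?thesis using eval_euler_fps_has_prod[OF q] by (metis has_prod_eq_0_iff rangeE)
qed

section \<open>Poisson summation for Gaussians\<close>

text \<open>Induction over p with g and m arbitrary: in a product the first factor is absorbed into
  g, and a linear function of cis(y) is a combination of cis(y) and cis(-y), which only shifts the
  frequency by one.\<close>

lemma fourier_real_polynomial:
  fixes p :: "complex \<Rightarrow> real" and g :: "real \<Rightarrow> complex"
  assumes "real_polynomial_function p"
    and "continuous_on {0..1} g"
    and "\<And>m::int. integral {0..1} (\<lambda>x. g x * cis (2 * pi * m * x)) = 0"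
  shows "integral {0..1} (\<lambda>x. g x * of_real (p (cis (2 * pi * x))) * cis (2 * pi * of_int m * x)) = 0"
  using assms
proof (induction p arbitrary: g m)
  case (linear h)
  have cont: "continuous_on {0..1} (\<lambda>x. g x * cis (2 * pi * m * x))" for m :: int
    using linear by (intro continuous_intros) auto
  have h: "of_real (h (cis y)) = (of_real (h 1) / 2 + of_real (h \<i>) / (2 * \<i>)) * cis y +
       (of_real (h 1) / 2 - of_real (h \<i>) / (2 * \<i>)) * cis (-y)" for y
  proof -
    have lh: "linear h" by (rule bounded_linear.linear) fact
    have "cis y = cos y *\<^sub>R 1 + sin y *\<^sub>R \<i>" by (simp add: complex_eq_iff)
    then have "h (cis y) = cos y * h 1 + sin y * h \<i>"
      by (simp add: linear_add[OF lh] linear_scale[OF lh])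
    then show ?thesis by (simp add: complex_eq_iff field_simps)
  qed
  let ?a = "of_real (h 1) / 2 + of_real (h \<i>) / (2 * \<i>)"
  let ?b = "of_real (h 1) / 2 - of_real (h \<i>) / (2 * \<i>)"
  have "(\<lambda>x. g x * of_real (h (cis (2 * pi * x))) * cis (2 * pi * of_int m * x)) =
     (\<lambda>x. ?a * (g x * cis (2 * pi * of_int (m + 1) * x)) + ?b * (g x * cis (2 * pi * of_int (m - 1) * x)))"
  proof
    fix x
    have 1: "cis (2 * pi * of_int (m + 1) * x) = cis (2 * pi * x) * cis (2 * pi * of_int m * x)"
      by (simp add: cis_mult ring_distribs add_ac)
    have 2: "cis (2 * pi * of_int (m - 1) * x) = cis (-(2 * pi * x)) * cis (2 * pi * of_int m * x)"
      by (simp add: cis_mult ring_distribs add_ac)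
    show "g x * of_real (h (cis (2 * pi * x))) * cis (2 * pi * of_int m * x) =
      ?a * (g x * cis (2 * pi * of_int (m + 1) * x)) + ?b * (g x * cis (2 * pi * of_int (m - 1) * x))"
      unfolding 1 2 h by (simp only: ring_distribs mult_ac)
  qed
  moreover have "((\<lambda>x. g x * cis (2 * pi * of_int m * x)) has_integral 0) {0..1}" for m
    using linear(3)[of m] integrable_continuous_real[OF cont[of m]] by (metis integrable_integral)
  then have "((\<lambda>x. ?a * (g x * cis (2 * pi * of_int (m + 1) * x)) + ?b * (g x * cis (2 * pi * of_int (m - 1) * x)))
     has_integral (?a * 0 + ?b * 0)) {0..1}"
    by (intro has_integral_add has_integral_mult_right)
  ultimately show ?case by (auto dest: integral_unique)
next
  case (const c)
  then show ?case
    by (simp only: mult.assoc mult.left_commute[of _ "of_real c"] integral_mult_right mult_zero_right)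
next
  case (add p1 p2)
  have c: "continuous_on {0..1} (\<lambda>x. g x * of_real (p (cis (2 * pi * x))) * cis (2 * pi * of_int m * x))"
    if "real_polynomial_function p" for p
  proof -
    have "continuous_on UNIV p" using continuous_on_polymonial_function[OF that[unfolded real_polynomial_function_eq]] .
    then show ?thesis
      by (intro continuous_intros add.prems) (auto intro!: continuous_on_compose2[of UNIV p] continuous_intros)
  qed
  have "integral {0..1} (\<lambda>x. g x * of_real (p1 (cis (2 * pi * x)) + p2 (cis (2 * pi * x))) * cis (2 * pi * of_int m * x)) =
     integral {0..1} (\<lambda>x. g x * of_real (p1 (cis (2 * pi * x))) * cis (2 * pi * of_int m * x) +
          g x * of_real (p2 (cis (2 * pi * x))) * cis (2 * pi * of_int m * x))"
    by (simp add: ring_distribs)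
  also have "\<dots> = 0"
    by (subst Henstock_Kurzweil_Integration.integral_add) (use add c in \<open>auto intro!: integrable_continuous_real\<close>)
  finally show ?case .
next
  case (mult p1 p2)
  have "continuous_on UNIV p1" using continuous_on_polymonial_function mult.hyps(1) real_polynomial_function_eq by blast
  then have c: "continuous_on {0..1} (\<lambda>x. g x * of_real (p1 (cis (2 * pi * x))))"
    by (intro continuous_intros mult.prems) (auto intro!: continuous_on_compose2[of UNIV p1] continuous_intros)
  have "integral {0..1} (\<lambda>x. g x * of_real (p1 (cis (2 * pi * x))) * cis (2 * pi * of_int m * x)) = 0" for m
    by (rule mult.IH(1)[OF mult.prems])
  from mult.IH(2)[OF c this] show ?case
    by (simp add: mult_ac)
qed

text \<open>D is transported to a continuous function h on the unit circle, where polynomials are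
  uniformly dense by Stone-Weierstrass. The integral of |D|^2 equals that of D (cnj D - p) for every
  polynomial p, hence is at most e times the integral of |D|, for every e > 0.\<close>

lemma fourier_unique:
  fixes D :: "real \<Rightarrow> complex"
  assumes cont: "continuous_on {-1..1} D"
    and per: "\<And>x. x \<in> {-1..0} \<Longrightarrow> D (x + 1) = D x"
    and zero: "\<And>m::int. integral {0..1} (\<lambda>x. D x * cis (2 * pi * m * x)) = 0"
  shows "x \<in> {0..1} \<Longrightarrow> D x = 0"
proof -
  define h where "h = (\<lambda>z. D (Arg z / (2 * pi)))"
  have perm: "D (x - 1) = D x" if "x \<in> {0..1}" for x using per[of "x - 1"] that by simp
  \<comment> \<open>A second formula for h, continuous across the negative real axis; together with
    the definition it covers the circle by two slit planes. Arguments take both signs, which is why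
    D is given on [-1, 1].\<close>
  have h2: "h z = D (Arg (-z) / (2 * pi) + 1 / 2)" if "z \<noteq> 0" for z
  proof -
    have "Arg (-z) / (2 * pi) + 1 / 2 = (if Arg z \<le> 0 then Arg z / (2 * pi) + 1 else Arg z / (2 * pi))"
      unfolding Arg_minus[OF that] by (auto simp: field_simps)
    moreover have "Arg z / (2 * pi) \<in> {-1..0}" if "Arg z \<le> 0"
      using that Arg_bounded[of z] pi_gt_zero by (simp add: field_simps)
    ultimately show ?thesis using per by (auto simp: h_def)
  qed
  have A: "- pi < Arg z" "Arg z \<le> pi" for z using Arg_bounded by auto
  have bound: "-1 \<le> Arg z / (2 * pi)" "Arg z / (2 * pi) \<le> 1 / 2" "-1/2 \<le> Arg z / (2 * pi)" for z
    using A[of z] pi_gt_zero by (auto simp: field_simps)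
  have "continuous_on ((-\<real>\<^sub>\<le>\<^sub>0) \<union> (-\<real>\<^sub>\<ge>\<^sub>0)) h"
  proof (rule continuous_on_open_Un)
    show "continuous_on (-\<real>\<^sub>\<le>\<^sub>0) h"
      unfolding h_def
    proof (rule continuous_on_compose2[OF cont])
      show "continuous_on (-\<real>\<^sub>\<le>\<^sub>0) (\<lambda>z. Arg z / (2 * pi))" by (intro continuous_intros) auto
      show "(\<lambda>z. Arg z / (2 * pi)) ` (-\<real>\<^sub>\<le>\<^sub>0) \<subseteq> {-1..1}"
        using bound(1) order_trans[OF bound(2), of 1] by (simp add: image_subset_iff del: divide_le_eq_1)
    qed
    have "continuous_on (-\<real>\<^sub>\<ge>\<^sub>0) (\<lambda>z. D (Arg (-z) / (2 * pi) + 1 / 2))"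
    proof (rule continuous_on_compose2[OF cont])
      show "continuous_on (-\<real>\<^sub>\<ge>\<^sub>0) (\<lambda>z. Arg (-z) / (2 * pi) + 1 / 2)"
        by (intro continuous_intros) (auto simp: complex_nonneg_Reals_iff complex_nonpos_Reals_iff)
      show "(\<lambda>z. Arg (- z) / (2 * pi) + 1 / 2) ` (- \<real>\<^sub>\<ge>\<^sub>0) \<subseteq> {- 1..1}"
      proof safe
        fix z show "Arg (- z) / (2 * pi) + 1 / 2 \<in> {- 1..1}"
          using bound(2,3)[of "-z"] unfolding atLeastAtMost_iff by linarith
      qed
    qed
    then show "continuous_on (-\<real>\<^sub>\<ge>\<^sub>0) h"
    proof (rule continuous_on_eq)
      fix z :: complex assume "z \<in> -\<real>\<^sub>\<ge>\<^sub>0"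
      then have "z \<noteq> 0" by auto
      then show "D (Arg (-z) / (2 * pi) + 1 / 2) = h z" by (rule h2[symmetric])
    qed
  qed auto
  then have conth: "continuous_on (sphere 0 1) h"
    by (rule continuous_on_subset) (auto simp: complex_nonneg_Reals_iff complex_nonpos_Reals_iff cmod_def)
  have hcis: "h (cis (2 * pi * x)) = D x" if "x \<in> {0..1}" for x
  proof (cases "x \<le> 1/2")
    case True
    then have "Arg (cis (2 * pi * x)) = 2 * pi * x"
      using that pi_gt_zero by (intro Arg_cis) (auto simp: field_simps intro: less_le_trans[of _ 0])
    then show ?thesis by (simp add: h_def)
  next
    case False
    have "Arg (cis (2 * pi * (x - 1))) = 2 * pi * (x - 1)"
      using that False pi_gt_zero by (intro Arg_cis) (auto simp: field_simps)
    moreover have "cis (2 * pi * x) = cis (2 * pi * (x - 1))"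
      by (simp add: ring_distribs flip: cis_divide)
    ultimately show ?thesis using that by (simp add: h_def perm)
  qed
  have contD: "continuous_on {0..1} D" by (rule continuous_on_subset[OF cont]) auto
  have int0: "integral {0..1} (\<lambda>x. D x * p (cis (2 * pi * x))) = 0" if "polynomial_function p" for p :: "complex \<Rightarrow> complex"
  proof -
    have re: "real_polynomial_function (Re \<circ> p)" "real_polynomial_function (Im \<circ> p)"
      using that bounded_linear_Re bounded_linear_Im unfolding polynomial_function_def by blast+
    have eq0: "integral {0..1} (\<lambda>x. D x * of_real ((Re \<circ> p) (cis (2 * pi * x)))) = 0"
       "integral {0..1} (\<lambda>x. D x * of_real ((Im \<circ> p) (cis (2 * pi * x)))) = 0"
      using fourier_real_polynomial[OF re(1) contD zero, of 0] fourier_real_polynomial[OF re(2) contD zero, of 0]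
      by simp_all
    have c: "continuous_on {0..1} (\<lambda>x. p (cis (2 * pi * x)))"
      by (rule continuous_on_compose2[OF continuous_on_polymonial_function[OF that, of UNIV]]) (auto intro!: continuous_intros)
    have "integral {0..1} (\<lambda>x. D x * p (cis (2 * pi * x))) =
       integral {0..1} (\<lambda>x. D x * of_real ((Re \<circ> p) (cis (2 * pi * x))) + \<i> * (D x * of_real ((Im \<circ> p) (cis (2 * pi * x)))))"
      by (rule integral_cong) (simp add: complex_eq_iff)
    also have "\<dots> = 0"
      by (subst Henstock_Kurzweil_Integration.integral_add) (use eq0 in \<open>auto intro!: integrable_continuous_real continuous_intros contD c simp: integral_mult_right\<close>)
    finally show ?thesis .
  qed
  define I where "I = integral {0..1} (\<lambda>x. (norm (D x))^2)"
  define J where "J = integral {0..1} (\<lambda>x. norm (D x))"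
  have nn: "J \<ge> 0" unfolding J_def by (intro integral_nonneg integrable_continuous_real continuous_intros contD) auto
  have small: "I \<le> e * J" if "e > 0" for e
  proof -
    have "continuous_on (sphere 0 1) (\<lambda>z. cnj (h z))" by (intro continuous_intros conth)
    from Stone_Weierstrass_polynomial_function[OF compact_sphere this that]
    obtain p where p: "polynomial_function p" "\<And>z. z \<in> sphere 0 1 \<Longrightarrow> norm (cnj (h z) - p z) < e"
      by blast
    have c: "continuous_on {0..1} (\<lambda>x. p (cis (2 * pi * x)))"
      by (rule continuous_on_compose2[OF continuous_on_polymonial_function[OF p(1), of UNIV]]) (auto intro!: continuous_intros)
    have "of_real I = integral {0..1} (\<lambda>x. of_real ((norm (D x))^2) :: complex)"
      unfolding I_def
      by (rule integral_unique[OF has_integral_of_real[OF integrable_integral], symmetric])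
         (intro integrable_continuous_real continuous_intros contD)
    also have "\<dots> = integral {0..1} (\<lambda>x. D x * cnj (D x)) - integral {0..1} (\<lambda>x. D x * p (cis (2 * pi * x)))"
      by (simp only: int0[OF p(1)] complex_norm_square diff_zero)
    also have "\<dots> = integral {0..1} (\<lambda>x. D x * (cnj (D x) - p (cis (2 * pi * x))))"
      unfolding right_diff_distrib
      by (rule Henstock_Kurzweil_Integration.integral_diff[symmetric]) (intro integrable_continuous_real continuous_intros contD c)+
    also have "norm \<dots> \<le> integral {0..1} (\<lambda>x. e * norm (D x))"
    proof (rule integral_norm_bound_integral)
      fix x :: real assume x: "x \<in> {0..1}"
      have "norm (cnj (D x) - p (cis (2 * pi * x))) \<le> e"
        using p(2)[of "cis (2 * pi * x)"] hcis[OF x] by simp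
      then show "norm (D x * (cnj (D x) - p (cis (2 * pi * x)))) \<le> e * norm (D x)"
        unfolding norm_mult mult.commute[of "norm (D x)"] by (rule mult_right_mono) simp
    qed (auto intro!: integrable_continuous_real continuous_intros contD c)
    finally show ?thesis by (simp add: J_def)
  qed
  have "I \<le> 0"
  proof (rule ccontr)
    assume "\<not> I \<le> 0"
    then have "I \<le> I / (2 * (J + 1)) * J" using nn by (intro small) auto
    then have "I * (2 * (J + 1)) \<le> I * J" using nn by (simp add: field_simps)
    then show False using \<open>\<not> I \<le> 0\<close> nn by (simp add: mult_le_cancel_left)
  qed
  moreover have "I \<ge> 0" unfolding I_def by (intro integral_nonneg integrable_continuous_real continuous_intros contD) auto
  ultimately have "I = 0" by simp
  then have "x \<in> {0..1} \<Longrightarrow> (norm (D x))^2 = 0" for x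
    unfolding I_def by (subst (asm) integral_eq_0_iff) (auto intro!: continuous_intros contD)
  then show "x \<in> {0..1} \<Longrightarrow> D x = 0" by simp
qed

section \<open>Gaussians, their Fourier transforms and bilateral sums\<close>

lemma has_sum_int_nat_pairs:
  fixes h :: "int \<Rightarrow> 'a :: banach"
  assumes "summable (\<lambda>n. norm (h (int n)))" "summable (\<lambda>n. norm (h (- int n - 1)))"
  shows "(h has_sum (\<Sum>n. h (int n) + h (- int n - 1))) UNIV"
proof -
  have sm: "summable (\<lambda>n. h (int n))" "summable (\<lambda>n. h (- int n - 1))" using assms by (auto intro: summable_norm_cancel)
  have 1: "(h has_sum (\<Sum>n. h (int n))) (range int)"
    using norm_summable_imp_has_sum[OF assms(1) summable_sums[OF sm(1)]]
    by (subst has_sum_reindex) (auto simp: o_def)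
  have 2: "(h has_sum (\<Sum>n. h (- int n - 1))) (range (\<lambda>n. - int n - 1))"
    using norm_summable_imp_has_sum[OF assms(2) summable_sums[OF sm(2)]]
    by (subst has_sum_reindex) (auto simp: o_def inj_def)
  have U: "range int \<union> range (\<lambda>n. - int n - 1) = UNIV"
  proof safe
    fix x :: int assume "x \<notin> range (\<lambda>n. - int n - 1)"
    then have "x \<noteq> - int (nat (- x - 1)) - 1" by blast
    then have "x \<ge> 0" by linarith
    then show "x \<in> range int" by (metis nat_0_le rangeI)
  qed auto
  have "range int \<inter> range (\<lambda>n. - int n - 1) = {}" by auto
  from has_sum_Un_disjoint[OF 1 2 this] show ?thesis
    unfolding U using sm by (simp add: suminf_add)
qed

text \<open>This is the characteristic function of the standard normal distribution, rescaled by a =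
  sqrt (2 pi T) so that the density becomes exp (- pi T x^2) up to a constant.\<close>

lemma gaussian_fourier:
  fixes T y :: real
  assumes T: "T > 0"
  shows "integrable lborel (\<lambda>x. of_real (exp (- pi * T * x\<^sup>2)) * cis (2 * pi * y * x))"
    and "(LBINT x. of_real (exp (- pi * T * x\<^sup>2)) * cis (2 * pi * y * x)) = of_real (exp (- pi * y\<^sup>2 / T) / sqrt T)"
proof -
  define a where "a = sqrt (2 * pi * T)"
  have a: "a > 0" "a\<^sup>2 = 2 * pi * T" using T by (simp_all add: a_def)
  define t where "t = 2 * pi * y / a"
  let ?F = "\<lambda>x. std_normal_density x *\<^sub>R iexp (t * x)"
  have int: "integrable lborel ?F"
    by (rule Bochner_Integration.integrable_bound[OF integrable_normal_moment[where \<mu> = 0 and \<sigma> = 1 and k = 0]])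
       (auto simp: normal_density_nonneg)
  have "(LBINT x. ?F x) = exp (- (t\<^sup>2) / 2)"
    using fun_cong[OF char_std_normal_distribution, of t]
    unfolding char_def by (subst (asm) integral_density) (auto simp: normal_density_nonneg)
  then have hb: "has_bochner_integral lborel ?F (of_real (exp (- (t\<^sup>2) / 2)))"
    using int by (simp add: has_bochner_integral_iff)
  have "has_bochner_integral lborel (\<lambda>x. ?F (0 + a * x)) (of_real (exp (- (t\<^sup>2) / 2)) /\<^sub>R \<bar>a\<bar>)"
    using lborel_has_bochner_integral_real_affine_iff[of a ?F _ 0] hb a by simp
  then have "has_bochner_integral lborel (\<lambda>x. sqrt (2 * pi) *\<^sub>R ?F (0 + a * x)) (sqrt (2 * pi) *\<^sub>R (of_real (exp (- (t\<^sup>2) / 2)) /\<^sub>R \<bar>a\<bar>))"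
    by (rule has_bochner_integral_scaleR_right)
  moreover have "sqrt (2 * pi) *\<^sub>R ?F (0 + a * x) = of_real (exp (- pi * T * x\<^sup>2)) * cis (2 * pi * y * x)" for x
  proof -
    have "(a * x)\<^sup>2 / 2 = pi * T * x\<^sup>2" using a by (simp add: power_mult_distrib)
    moreover have "t * (a * x) = 2 * pi * y * x" using a by (simp add: t_def)
    ultimately show ?thesis
      by (simp only: std_normal_density_def cis_conv_exp scaleR_conv_of_real add_0_left)
         (simp add: field_simps)
  qed
  moreover have "sqrt (2 * pi) *\<^sub>R (complex_of_real (exp (- (t\<^sup>2) / 2)) /\<^sub>R \<bar>a\<bar>) = of_real (exp (- pi * y\<^sup>2 / T) / sqrt T)"
  proof -
    have "t\<^sup>2 / 2 = pi * y\<^sup>2 / T" using T a by (simp add: t_def power_divide power_mult_distrib field_simps power2_eq_square)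
    moreover have "sqrt (2 * pi) / \<bar>a\<bar> = 1 / sqrt T" using T by (simp add: a_def real_sqrt_mult)
    moreover have "sqrt (2 * pi) *\<^sub>R (complex_of_real (exp (- (t\<^sup>2) / 2)) /\<^sub>R \<bar>a\<bar>) =
       of_real (exp (- (t\<^sup>2 / 2)) * (sqrt (2 * pi) / \<bar>a\<bar>))"
      by (simp add: scaleR_conv_of_real field_simps)
    ultimately show ?thesis by simp
  qed
  ultimately have "has_bochner_integral lborel (\<lambda>x. of_real (exp (- pi * T * x\<^sup>2)) * cis (2 * pi * y * x)) (of_real (exp (- pi * y\<^sup>2 / T) / sqrt T))"
    by simp
  then show "integrable lborel (\<lambda>x. of_real (exp (- pi * T * x\<^sup>2)) * cis (2 * pi * y * x))"
    and "(LBINT x. of_real (exp (- pi * T * x\<^sup>2)) * cis (2 * pi * y * x)) = of_real (exp (- pi * y\<^sup>2 / T) / sqrt T)"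
    by (auto simp: has_bochner_integral_iff)
qed

lemma gaussian_fourier_tendsto:
  fixes T y :: real
  assumes T: "T > 0"
  shows "(\<lambda>n. integral {- real n..real n} (\<lambda>x. of_real (exp (- pi * T * x\<^sup>2)) * cis (2 * pi * y * x)))
     \<longlonglongrightarrow> of_real (exp (- pi * y\<^sup>2 / T) / sqrt T)"
proof -
  let ?f = "\<lambda>x. of_real (exp (- pi * T * x\<^sup>2)) * cis (2 * pi * y * x)"
  have int: "integrable lborel ?f" by (rule gaussian_fourier[OF T])
  have "(\<lambda>n. LBINT x. indicator {- real n..real n} x *\<^sub>R ?f x) \<longlonglongrightarrow> (LBINT x. ?f x)"
  proof (rule integral_dominated_convergence[where w = "\<lambda>x. norm (?f x)"])
    show "AE x in lborel. (\<lambda>n. indicator {- real n..real n} x *\<^sub>R ?f x) \<longlonglongrightarrow> ?f x"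
    proof (intro AE_I2 tendsto_eventually)
      fix x :: real
      show "\<forall>\<^sub>F n in sequentially. indicator {- real n..real n} x *\<^sub>R ?f x = ?f x"
        using eventually_ge_at_top[of "nat \<lceil>\<bar>x\<bar>\<rceil>"] by eventually_elim (auto simp: indicator_def abs_le_iff nat_le_iff ceiling_le_iff)
    qed
  next
    show "integrable lborel (\<lambda>x. norm (?f x))" by (rule integrable_norm[OF int])
  next
    show "AE x in lborel. norm (indicator {- real n..real n} x *\<^sub>R ?f x) \<le> norm (?f x)" for n
      by (intro AE_I2) (auto simp: indicator_def)
  qed (use borel_measurable_integrable[OF int] in auto)
  moreover have "(LBINT x. indicator {- real n..real n} x *\<^sub>R ?f x) = integral {- real n..real n} ?f" for n
  proof -
    have "set_integrable lborel {- real n..real n} ?f"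
      unfolding set_integrable_def by (intro integrable_mult_indicator int) auto
    from set_borel_integral_eq_integral(2)[OF this] show ?thesis by (simp add: set_lebesgue_integral_def)
  qed
  ultimately show ?thesis using gaussian_fourier(2)[OF T, of y] by simp
qed

lemma integral_cis_int:
  fixes m :: int
  shows "integral {0..1} (\<lambda>x. cis (2 * pi * of_int m * x)) = (if m = 0 then 1 else 0)"
proof (cases "m = 0")
  case False
  define c where "c = 2 * pi * of_int m"
  have c: "c \<noteq> 0" using False by (simp add: c_def)
  have "((\<lambda>x. cis (c * x)) has_integral (cis (c * 1) / (\<i> * c) - cis (c * 0) / (\<i> * c))) {0..1}"
  proof (rule fundamental_theorem_of_calculus)
    fix x :: real
    show "((\<lambda>x. cis (c * x) / (\<i> * of_real c)) has_vector_derivative cis (c * x)) (at x within {0..1})"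
      unfolding cis_conv_exp using c
      by (auto intro!: derivative_eq_intros has_vector_derivative_real_field simp: scaleR_conv_of_real field_simps)
  qed simp
  moreover have "cis c = 1" unfolding c_def using cis_multiple_2pi[of "of_int m"] by simp
  ultimately have "((\<lambda>x. cis (c * x)) has_integral 0) {0..1}" by simp
  then show ?thesis using False by (simp add: c_def integral_unique)
qed simp

text \<open>The terms with indices \<open>n\<close> and \<open>-n - 1\<close> of both sides of the Poisson summation formula, so that
  uniform limits of sequences of partial sums suffice.\<close>

definition theta_pair :: "real \<Rightarrow> nat \<Rightarrow> real \<Rightarrow> real" where
  "theta_pair T n x = exp (- pi * T * (of_nat n + x)\<^sup>2) + exp (- pi * T * (- of_nat n - 1 + x)\<^sup>2)"

definition theta_dual :: "real \<Rightarrow> nat \<Rightarrow> real \<Rightarrow> complex" where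
  "theta_dual T n x = of_real (exp (- pi * (real n)\<^sup>2 / T) / sqrt T) * cis (2 * pi * of_int (int n) * x) +
     of_real (exp (- pi * (real n + 1)\<^sup>2 / T) / sqrt T) * cis (2 * pi * of_int (- int n - 1) * x)"

lemma exp_neg_le:
  assumes "S > 0" "u \<ge> v"
  shows "exp (- (S::real) * u) \<le> exp (- S * v)"
  using assms by simp

text \<open>Both squares are at least n - 2 when |x| <= 1. The resulting geometric majorant is
  uniform in x and feeds the Weierstrass test.\<close>

lemma gauss_bounds:
  fixes x :: real
  assumes "S > 0" "x \<in> {-1..1}"
  shows "exp (- S * (of_nat n + x)\<^sup>2) \<le> exp (2 * S) * exp (- S) ^ n"
    and "exp (- S * (- of_nat n - 1 + x)\<^sup>2) \<le> exp (2 * S) * exp (- S) ^ n"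
proof -
  have e: "exp (2 * S) * exp (- S) ^ n = exp (- S * (real n - 2))"
    by (simp add: exp_of_nat_mult[symmetric] exp_add[symmetric] algebra_simps)
  have 1: "(of_nat n + x)\<^sup>2 \<ge> real n - 2"
  proof (cases "n = 0")
    case False
    then have "(real n - 1)\<^sup>2 \<le> (of_nat n + x)\<^sup>2" using assms by (intro power_mono) auto
    moreover have "(real n - 1)\<^sup>2 - (real n - 2) = (real n - 3/2)\<^sup>2 + 3/4" by (simp add: power2_eq_square algebra_simps)
    moreover have "(real n - 3/2)\<^sup>2 \<ge> 0" by simp
    ultimately show ?thesis by linarith
  qed (simp add: order.trans[OF _ zero_le_power2])
  have 2: "(- of_nat n - 1 + x)\<^sup>2 \<ge> real n - 2"
  proof -
    have "(real n)\<^sup>2 \<le> (of_nat n + 1 - x)\<^sup>2" using assms by (intro power_mono) auto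
    moreover have "(of_nat n + 1 - x)\<^sup>2 = (- of_nat n - 1 + x)\<^sup>2" by (simp add: power2_eq_square algebra_simps)
    moreover have "(real n)\<^sup>2 \<ge> real n - 2" using zero_le_power2[of "real n - 1/2"] by (simp add: power2_eq_square algebra_simps)
    ultimately show ?thesis by linarith
  qed
  show "exp (- S * (of_nat n + x)\<^sup>2) \<le> exp (2 * S) * exp (- S) ^ n"
    and "exp (- S * (- of_nat n - 1 + x)\<^sup>2) \<le> exp (2 * S) * exp (- S) ^ n"
    unfolding e using exp_neg_le[OF assms(1)] 1 2 by blast+
qed

lemma summable_gauss_bound: "S > 0 \<Longrightarrow> summable (\<lambda>n. C * exp (- S :: real) ^ n)"
  by (intro summable_mult summable_geometric) simp

lemma theta_pair_uniform:
  assumes T: "T > 0"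
  shows "uniform_limit {-1..1} (\<lambda>n x. \<Sum>i<n. complex_of_real (theta_pair T i x)) (\<lambda>x. \<Sum>i. complex_of_real (theta_pair T i x)) sequentially"
proof (rule Weierstrass_m_test)
  fix n x assume x: "x \<in> {-1..1::real}"
  have S: "pi * T > 0" using T by simp
  show "norm (complex_of_real (theta_pair T n x)) \<le> 2 * exp (2 * (pi * T)) * exp (- (pi * T)) ^ n"
    using gauss_bounds[OF S x, of n] unfolding theta_pair_def norm_of_real by simp
next
  show "summable (\<lambda>n. 2 * exp (2 * (pi * T)) * exp (- (pi * T)) ^ n)" using T by (intro summable_gauss_bound) simp
qed

lemma theta_dual_uniform:
  assumes T: "T > 0"
  shows "uniform_limit UNIV (\<lambda>n x. \<Sum>i<n. theta_dual T i x) (\<lambda>x. \<Sum>i. theta_dual T i x) sequentially"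
proof (rule Weierstrass_m_test)
  fix n x
  have S: "pi / T > 0" using T by simp
  have "norm (theta_dual T n x) \<le> exp (- pi * (real n)\<^sup>2 / T) / sqrt T + exp (- pi * (real n + 1)\<^sup>2 / T) / sqrt T"
    unfolding theta_dual_def
    by (rule order.trans[OF norm_triangle_ineq]) (use T in \<open>simp add: norm_mult norm_divide\<close>)
  also have "\<dots> = (exp (- (pi / T) * (real n)\<^sup>2) + exp (- (pi / T) * (real n + 1)\<^sup>2)) / sqrt T"
    by (simp add: add_divide_distrib)
  also have "\<dots> \<le> (exp (2 * (pi / T)) * exp (- (pi / T)) ^ n + exp (2 * (pi / T)) * exp (- (pi / T)) ^ n) / sqrt T"
    using gauss_bounds(1)[OF S, of 0 n] gauss_bounds(1)[OF S, of 1 n] T by (intro divide_right_mono add_mono) auto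
  finally show "norm (theta_dual T n x) \<le> 2 * exp (2 * (pi / T)) / sqrt T * exp (- (pi / T)) ^ n" by (simp add: mult_ac)
next
  show "summable (\<lambda>n. 2 * exp (2 * (pi / T)) / sqrt T * exp (- (pi / T)) ^ n)" using T by (intro summable_gauss_bound) simp
qed

text \<open>Since cis (2 pi m x) has period 1, each new pair contributes the integrals over the two
  adjacent unit intervals [n, n + 1] and [-n - 1, -n].\<close>

lemma theta_pair_partial_integral:
  fixes m :: int
  shows "integral {0..1} (\<lambda>x. (\<Sum>i<n. complex_of_real (theta_pair T i x)) * cis (2 * pi * of_int m * x)) =
     integral {- real n..real n} (\<lambda>x. of_real (exp (- pi * T * x\<^sup>2)) * cis (2 * pi * of_int m * x))"
proof (induction n)
  case (Suc n)
  let ?f = "\<lambda>x. of_real (exp (- pi * T * x\<^sup>2)) * cis (2 * pi * of_int m * x)"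
  have i: "?f integrable_on {a..b}" for a b by (intro integrable_continuous_real continuous_intros)
  have per: "cis (2 * pi * of_int m * (x + of_int k)) = cis (2 * pi * of_int m * x)" for x k
    using cis_multiple_2pi[of "of_int (m * k)"] by (simp add: ring_distribs cis_mult[symmetric] mult.assoc)
  have 1: "integral {0..1} (\<lambda>x. of_real (exp (- pi * T * (of_nat n + x)\<^sup>2)) * cis (2 * pi * of_int m * x)) = integral {real n..real (Suc n)} ?f"
    using integral_shift_real_ivl[of "real n" "real n" "real (Suc n)" ?f] per[of _ "int n"] by (simp add: add.commute)
  have 2: "integral {0..1} (\<lambda>x. of_real (exp (- pi * T * (- of_nat n - 1 + x)\<^sup>2)) * cis (2 * pi * of_int m * x)) = integral {- real (Suc n)..- real n} ?f"
    using integral_shift_real_ivl[of "- real (Suc n)" "- real (Suc n)" "- real n" ?f] per[of _ "- int n - 1"]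
    by (simp add: algebra_simps)
  have "integral {0..1} (\<lambda>x. (\<Sum>i<Suc n. complex_of_real (theta_pair T i x)) * cis (2 * pi * of_int m * x)) =
    integral {0..1} (\<lambda>x. (\<Sum>i<n. complex_of_real (theta_pair T i x)) * cis (2 * pi * of_int m * x) +
       (of_real (exp (- pi * T * (of_nat n + x)\<^sup>2)) * cis (2 * pi * of_int m * x) + of_real (exp (- pi * T * (- of_nat n - 1 + x)\<^sup>2)) * cis (2 * pi * of_int m * x)))"
    by (simp add: theta_pair_def ring_distribs)
  also have "\<dots> = integral {0..1} (\<lambda>x. (\<Sum>i<n. complex_of_real (theta_pair T i x)) * cis (2 * pi * of_int m * x)) +
    (integral {0..1} (\<lambda>x. of_real (exp (- pi * T * (of_nat n + x)\<^sup>2)) * cis (2 * pi * of_int m * x)) +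
     integral {0..1} (\<lambda>x. of_real (exp (- pi * T * (- of_nat n - 1 + x)\<^sup>2)) * cis (2 * pi * of_int m * x)))"
  proof -
    have i1: "(\<lambda>x. (\<Sum>i<n. complex_of_real (theta_pair T i x)) * cis (2 * pi * of_int m * x)) integrable_on {0..1}"
      unfolding theta_pair_def by (intro integrable_continuous_real continuous_intros)
    have i2: "(\<lambda>x. of_real (exp (- pi * T * (y + x)\<^sup>2)) * cis (2 * pi * of_int m * x)) integrable_on {0..1}" for y
      by (intro integrable_continuous_real continuous_intros)
    note add = Henstock_Kurzweil_Integration.integral_add
    show ?thesis
      by (simp only: add[OF i1 integrable_add[OF i2 i2]] add[OF i2 i2])
  qed
  also have "\<dots> = integral {- real n..real n} ?f + (integral {real n..real (Suc n)} ?f + integral {- real (Suc n)..- real n} ?f)"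
    by (simp only: Suc.IH 1 2)
  also have "\<dots> = (integral {- real (Suc n)..- real n} ?f + integral {- real n..real n} ?f) + integral {real n..real (Suc n)} ?f"
    by simp
  also have "integral {- real (Suc n)..- real n} ?f + integral {- real n..real n} ?f = integral {- real (Suc n)..real n} ?f"
    by (rule Henstock_Kurzweil_Integration.integral_combine) (simp, simp, rule i)
  also have "\<dots> + integral {real n..real (Suc n)} ?f = integral {- real (Suc n)..real (Suc n)} ?f"
    by (rule Henstock_Kurzweil_Integration.integral_combine) (simp, simp, rule i)
  finally show ?case .
qed simp

text \<open>Orthogonality leaves the frequency -m, which occurs among the first n pairs because |m|
  < n; its coefficient is even in m.\<close>

lemma theta_dual_partial_integral:
  fixes m :: int
  assumes "nat \<bar>m\<bar> < n"
  shows "integral {0..1} (\<lambda>x. (\<Sum>i<n. theta_dual T i x) * cis (2 * pi * of_int m * x)) = of_real (exp (- pi * (of_int m)\<^sup>2 / T) / sqrt T)"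
proof -
  let ?c = "\<lambda>k::int. complex_of_real (exp (- pi * (of_int k)\<^sup>2 / T) / sqrt T)"
  have hi: "((\<lambda>x. cis (2 * pi * of_int k * x)) has_integral (if k = 0 then 1 else 0)) {0..1}" for k :: int
  proof -
    have "(\<lambda>x. cis (2 * pi * of_int k * x)) integrable_on {0..1}" by (intro integrable_continuous_real continuous_intros)
    then show ?thesis using integral_cis_int[of k] by (metis integrable_integral)
  qed
  have "((\<lambda>x. (\<Sum>i<n. ?c (int i) * cis (2 * pi * of_int (int i + m) * x) + ?c (- int i - 1) * cis (2 * pi * of_int (- int i - 1 + m) * x)))
      has_integral (\<Sum>i<n. ?c (int i) * (if int i + m = 0 then 1 else 0) + ?c (- int i - 1) * (if - int i - 1 + m = 0 then 1 else 0))) {0..1}"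
    by (intro has_integral_sum has_integral_add has_integral_mult_right hi) auto
  moreover have "(\<Sum>i<n. theta_dual T i x) * cis (2 * pi * of_int m * x) =
    (\<Sum>i<n. ?c (int i) * cis (2 * pi * of_int (int i + m) * x) + ?c (- int i - 1) * cis (2 * pi * of_int (- int i - 1 + m) * x))" for x
    unfolding sum_distrib_right theta_dual_def
  proof (rule sum.cong)
    fix i
    have "(- real i - 1)\<^sup>2 = (real i + 1)\<^sup>2" by (simp add: power2_eq_square algebra_simps)
    then show "(of_real (exp (- pi * (real i)\<^sup>2 / T) / sqrt T) * cis (2 * pi * of_int (int i) * x) +
     of_real (exp (- pi * (real i + 1)\<^sup>2 / T) / sqrt T) * cis (2 * pi * of_int (- int i - 1) * x)) * cis (2 * pi * of_int m * x) =
      ?c (int i) * cis (2 * pi * of_int (int i + m) * x) + ?c (- int i - 1) * cis (2 * pi * of_int (- int i - 1 + m) * x)"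
      by (simp only: ring_distribs mult.assoc cis_mult) (simp add: algebra_simps)
  qed simp
  moreover have "(\<Sum>i<n. ?c (int i) * (if int i + m = 0 then 1 else 0) + ?c (- int i - 1) * (if - int i - 1 + m = 0 then 1 else 0)) = ?c m"
  proof (cases "m \<le> 0")
    case True
    have "(\<Sum>i<n. ?c (int i) * (if int i + m = 0 then 1 else 0) + ?c (- int i - 1) * (if - int i - 1 + m = 0 then 1 else 0)) =
        (\<Sum>i<n. if i = nat (-m) then ?c m else 0)"
      using True by (intro sum.cong) auto
    then show ?thesis using True assms by simp
  next
    case False
    have "(\<Sum>i<n. ?c (int i) * (if int i + m = 0 then 1 else 0) + ?c (- int i - 1) * (if - int i - 1 + m = 0 then 1 else 0)) =
        (\<Sum>i<n. if i = nat (m - 1) then ?c m else 0)"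
      using False by (intro sum.cong) (auto simp: power2_eq_square algebra_simps)
    then show ?thesis using False assms by simp
  qed
  ultimately show ?thesis by (simp add: integral_unique)
qed

lemma theta_pair_has_sum:
  assumes T: "T > 0" and x: "x \<in> {-1..1}"
  shows "((\<lambda>t::int. complex_of_real (exp (- pi * T * (of_int t + x)\<^sup>2))) has_sum (\<Sum>i. complex_of_real (theta_pair T i x))) UNIV"
proof -
  let ?h = "\<lambda>t::int. complex_of_real (exp (- pi * T * (of_int t + x)\<^sup>2))"
  have S: "pi * T > 0" using T by simp
  have "(?h has_sum (\<Sum>n. ?h (int n) + ?h (- int n - 1))) UNIV"
  proof (rule has_sum_int_nat_pairs)
    show "summable (\<lambda>n. norm (?h (int n)))" "summable (\<lambda>n. norm (?h (- int n - 1)))"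
      by (rule summable_comparison_test'[OF summable_gauss_bound[OF S, of "exp (2 * (pi * T))"]],
          use gauss_bounds[OF S x] in simp)+
  qed
  then show ?thesis by (simp add: theta_pair_def)
qed

lemma theta_dual_has_sum:
  assumes T: "T > 0"
  shows "((\<lambda>m::int. complex_of_real (exp (- pi * (of_int m)\<^sup>2 / T) / sqrt T) * cis (2 * pi * of_int m * x)) has_sum (\<Sum>i. theta_dual T i x)) UNIV"
proof -
  let ?h = "\<lambda>m::int. complex_of_real (exp (- pi * (of_int m)\<^sup>2 / T) / sqrt T) * cis (2 * pi * of_int m * x)"
  have S: "pi / T > 0" using T by simp
  have sq: "(- real i - 1)\<^sup>2 = (real i + 1)\<^sup>2" for i by (simp add: power2_eq_square algebra_simps)
  have "(?h has_sum (\<Sum>n. ?h (int n) + ?h (- int n - 1))) UNIV"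
  proof (rule has_sum_int_nat_pairs)
    have sm: "summable (\<lambda>n. exp (2 * (pi / T)) * exp (- (pi / T)) ^ n / sqrt T)"
      by (intro summable_divide summable_gauss_bound S)
    show "summable (\<lambda>n. norm (?h (int n)))"
      by (rule summable_comparison_test'[OF sm])
         (use gauss_bounds(1)[OF S, of 0] T in \<open>simp add: norm_mult norm_divide divide_right_mono\<close>)
    show "summable (\<lambda>n. norm (?h (- int n - 1)))"
      by (rule summable_comparison_test'[OF sm])
         (use gauss_bounds(1)[OF S, of 1] T in \<open>simp add: norm_mult norm_divide divide_right_mono sq\<close>)
  qed
  moreover have "?h (int i) + ?h (- int i - 1) = theta_dual T i x" for i
    unfolding theta_dual_def by (simp add: sq)
  ultimately show ?thesis by simp
qed

text \<open>Both sides are continuous with period 1, so \<open>fourier_unique\<close> reduces the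
  claim to equality of Fourier coefficients. On the left the unit intervals fit together to a
  Gaussian integral over the line; on the right the coefficients can be read off.\<close>

lemma theta_poisson:
  assumes T: "T > 0" and x: "x \<in> {0..1}"
  shows "(\<Sum>i. complex_of_real (theta_pair T i x)) = (\<Sum>i. theta_dual T i x)"
proof -
  define P where "P = (\<lambda>x. \<Sum>i. complex_of_real (theta_pair T i x))"
  define Q where "Q = (\<lambda>x. \<Sum>i. theta_dual T i x)"
  have ctp: "continuous_on A (\<lambda>x. \<Sum>i<n. complex_of_real (theta_pair T i x))" for n A
    unfolding theta_pair_def by (intro continuous_intros)
  have ctd: "continuous_on A (\<lambda>x. \<Sum>i<n. theta_dual T i x)" for n A
    unfolding theta_dual_def by (intro continuous_intros)
  have uP: "uniform_limit {-1..1} (\<lambda>n x. \<Sum>i<n. complex_of_real (theta_pair T i x)) P sequentially"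
    unfolding P_def by (rule theta_pair_uniform[OF T])
  have uQ: "uniform_limit {-1..1} (\<lambda>n x. \<Sum>i<n. theta_dual T i x) Q sequentially"
    unfolding Q_def by (rule uniform_limit_on_subset[OF theta_dual_uniform[OF T]]) simp
  have cP: "continuous_on {-1..1} P"
    by (rule uniform_limit_theorem[OF _ uP]) (auto intro!: always_eventually ctp)
  have cQ: "continuous_on {-1..1} Q"
    by (rule uniform_limit_theorem[OF _ uQ]) (auto intro!: always_eventually ctd)
  have lim: "(\<lambda>n. integral {0..1} (\<lambda>x. f n x * cis (2 * pi * of_int m * x))) \<longlonglongrightarrow> integral {0..1} (\<lambda>x. F x * cis (2 * pi * of_int m * x))"
    if u: "uniform_limit {-1..1} f F sequentially" and c: "\<And>n. continuous_on {0..1} (f n)" and cF: "continuous_on {-1..1} F" for f :: "nat \<Rightarrow> real \<Rightarrow> complex" and F and m :: int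
  proof -
    have u1: "uniform_limit {0..1} f F sequentially" by (rule uniform_limit_on_subset[OF u]) auto
    have bF: "bounded (F ` {0..1})"
      by (intro compact_imp_bounded compact_continuous_image continuous_on_subset[OF cF]) auto
    have bc: "bounded ((\<lambda>x. cis (2 * pi * of_int m * x)) ` {0..1})"
      by (intro compact_imp_bounded compact_continuous_image continuous_intros) auto
    have u2: "uniform_limit {0..1} (\<lambda>n x. f n x * cis (2 * pi * of_int m * x)) (\<lambda>x. F x * cis (2 * pi * of_int m * x)) sequentially"
      by (rule bounded_bilinear.bounded_uniform_limit[OF bounded_bilinear_mult u1 uniform_limit_const bc bF])
    have c2: "continuous_on {0..1} (\<lambda>x. f n x * cis (2 * pi * of_int m * x))" for n by (intro continuous_intros c)
    obtain I J where IJ: "\<And>n. ((\<lambda>x. f n x * cis (2 * pi * of_int m * x)) has_integral I n) {0..1}"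
      "((\<lambda>x. F x * cis (2 * pi * of_int m * x)) has_integral J) {0..1}" "I \<longlonglongrightarrow> J"
      using uniform_limit_integral[OF u2 c2 trivial_limit_sequentially] by blast
    have "(\<lambda>n. integral {0..1} (\<lambda>x. f n x * cis (2 * pi * of_int m * x))) = I"
      by (intro ext integral_unique IJ(1))
    then show ?thesis using IJ(3) integral_unique[OF IJ(2)] by (simp only:)
  qed
  have "P x - Q x = 0"
  proof (rule fourier_unique[where D = "\<lambda>x. P x - Q x"])
    show "continuous_on {-1..1} (\<lambda>x. P x - Q x)" by (intro continuous_intros cP cQ)
    show "P (x + 1) - Q (x + 1) = P x - Q x" if x: "x \<in> {-1..0}" for x
    proof -
      have "((\<lambda>t::int. complex_of_real (exp (- pi * T * (of_int t + (x + 1))\<^sup>2))) has_sum P (x + 1)) UNIV"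
        unfolding P_def by (rule theta_pair_has_sum[OF T]) (use x in auto)
      then have "(((\<lambda>t::int. complex_of_real (exp (- pi * T * (of_int t + x)\<^sup>2))) \<circ> (\<lambda>t. t + 1)) has_sum P (x + 1)) UNIV"
        by (simp add: o_def algebra_simps)
      then have "((\<lambda>t::int. complex_of_real (exp (- pi * T * (of_int t + x)\<^sup>2))) has_sum P (x + 1)) (range (\<lambda>t. t + 1))"
        by (subst has_sum_reindex) (auto simp: inj_def)
      also have "range (\<lambda>t::int. t + 1) = UNIV" by (metis surj_def diff_add_cancel)
      finally have "P (x + 1) = P x"
        using theta_pair_has_sum[OF T, of x] x unfolding P_def by (auto intro: has_sum_unique)
      moreover have "cis (2 * pi * of_int m * (x + 1)) = cis (2 * pi * of_int m * x)" for m :: int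
        using cis_multiple_2pi[of "of_int m"] by (simp add: ring_distribs cis_mult[symmetric])
      then have "Q (x + 1) = Q x" unfolding Q_def theta_dual_def by (simp only:)
      ultimately show ?thesis by simp
    qed
    show "integral {0..1} (\<lambda>x. (P x - Q x) * cis (2 * pi * of_int m * x)) = 0" for m :: int
    proof -
      have "(\<lambda>n. integral {0..1} (\<lambda>x. (\<Sum>i<n. complex_of_real (theta_pair T i x)) * cis (2 * pi * of_int m * x))) \<longlonglongrightarrow>
         of_real (exp (- pi * (of_int m)\<^sup>2 / T) / sqrt T)"
        unfolding theta_pair_partial_integral by (rule gaussian_fourier_tendsto[OF T])
      from LIMSEQ_unique[OF lim[OF uP ctp cP] this]
      have 1: "integral {0..1} (\<lambda>x. P x * cis (2 * pi * of_int m * x)) = of_real (exp (- pi * (of_int m)\<^sup>2 / T) / sqrt T)" .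
      have "(\<lambda>n. integral {0..1} (\<lambda>x. (\<Sum>i<n. theta_dual T i x) * cis (2 * pi * of_int m * x))) \<longlonglongrightarrow>
         of_real (exp (- pi * (of_int m)\<^sup>2 / T) / sqrt T)"
        by (rule tendsto_eventually, rule eventually_mono[OF eventually_gt_at_top[of "nat \<bar>m\<bar>"]], rule theta_dual_partial_integral)
      from LIMSEQ_unique[OF lim[OF uQ ctd cQ] this]
      have 2: "integral {0..1} (\<lambda>x. Q x * cis (2 * pi * of_int m * x)) = of_real (exp (- pi * (of_int m)\<^sup>2 / T) / sqrt T)" .
      have "integral {0..1} (\<lambda>x. (P x - Q x) * cis (2 * pi * of_int m * x)) =
         integral {0..1} (\<lambda>x. P x * cis (2 * pi * of_int m * x)) - integral {0..1} (\<lambda>x. Q x * cis (2 * pi * of_int m * x))"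
        unfolding left_diff_distrib
        by (rule Henstock_Kurzweil_Integration.integral_diff; intro integrable_continuous_real continuous_intros continuous_on_subset[OF cP] continuous_on_subset[OF cQ]) auto
      then show ?thesis using 1 2 by simp
    qed
  qed fact
  then show ?thesis by (simp add: P_def Q_def)
qed

section \<open>Quadratic Gauss sums and the eta function\<close>

definition eexp :: "complex \<Rightarrow> complex" where
  "eexp z = exp (2 * of_real pi * \<i> * z)"

lemma eexp_add: "eexp (a + b) = eexp a * eexp b"
  by (simp add: eexp_def ring_distribs exp_add)

lemma eexp_0 [simp]: "eexp 0 = 1"
  by (simp add: eexp_def)

lemma eexp_neq_0 [simp]: "eexp z \<noteq> 0"
  by (simp add: eexp_def)

lemma eexp_power: "eexp a ^ n = eexp (of_nat n * a)"
  by (simp add: eexp_def exp_of_nat_mult[symmetric] mult_ac)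

lemma eexp_int [simp]: "eexp (of_int n) = 1"
  using exp_integer_2pi[of "of_int n"] by (simp add: eexp_def mult_ac)

lemma norm_eexp: "norm (eexp z) = exp (- 2 * pi * Im z)"
  by (simp add: eexp_def)

lemma norm_eexp_less_1: "Im z > 0 \<Longrightarrow> norm (eexp z) < 1"
  by (simp add: norm_eexp)

lemma eexp_of_real: "eexp (of_real x) = cis (2 * pi * x)"
  by (simp add: eexp_def cis_conv_exp mult_ac)

lemma eexp_cong_int:
  assumes "a - b = of_int k"
  shows "eexp a = eexp b"
proof -
  have "a = b + of_int k" using assms by (simp add: algebra_simps)
  then show ?thesis by (simp add: eexp_add)
qed

lemma eexp_dvd_cong:
  assumes "int c dvd a - b" "c > 0"
  shows "eexp (of_int a / of_nat c) = eexp (of_int b / of_nat c)"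
proof -
  obtain k where "a - b = int c * k" using assms by blast
  then have "of_int a - of_int b = of_nat c * (of_int k :: complex)" by (metis of_int_diff of_int_mult of_int_of_nat_eq)
  then show ?thesis using assms(2) by (intro eexp_cong_int[of _ _ k]) (simp add: field_simps)
qed

lemma eexp_eq_1_iff:
  assumes "c > 0"
  shows "eexp (of_int a / of_nat c) = 1 \<longleftrightarrow> int c dvd a"
proof
  assume "eexp (of_int a / of_nat c) = 1"
  then have "exp (2 * of_real pi * \<i> * (of_int a / of_nat c)) = 1" by (simp only: eexp_def)
  then obtain n :: int where n: "Im (2 * of_real pi * \<i> * (of_int a / of_nat c)) = of_int (2 * n) * pi"
    unfolding exp_eq_1 by blast
  have "2 * of_real pi * \<i> * (of_int a / of_nat c) = \<i> * of_real (2 * pi * (of_int a / of_nat c))" by simp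
  then have "2 * pi * (of_int a / of_nat c) = of_int (2 * n) * pi" using n by (simp only:) simp
  moreover have "x = of_int n" if "2 * pi * x = of_int (2 * n) * pi" for x :: real using that by simp
  ultimately have "of_int a / real c = of_int n" by blast
  then have "of_int a / of_nat c = (of_int n :: complex)" by (metis of_real_divide of_real_of_int_eq of_real_of_nat_eq)
  then have "(of_int a :: complex) = of_int (int c * n)" using assms by (simp add: field_simps)
  then have "a = int c * n" by (simp only: of_int_eq_iff)
  then show "int c dvd a" by simp
next
  assume "int c dvd a"
  then show "eexp (of_int a / of_nat c) = 1" using eexp_dvd_cong[of c a 0] assms by simp
qed

section \<open>Finite sums over residue classes and the character modulo 12\<close>

lemma periodic_mod:
  fixes F :: "int \<Rightarrow> 'a"
  assumes "\<And>n. F (n + M) = F n"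
  shows "F (n mod M) = F n"
proof -
  have *: "F (x + M * int k) = F x" for x k
  proof (induction k)
    case (Suc k)
    have "F (x + M * int (Suc k)) = F ((x + M * int k) + M)" by (simp add: algebra_simps)
    then show ?case using assms Suc by simp
  qed simp
  have "F (x + M * k) = F x" for x k
  proof (cases "k \<ge> 0")
    case True then show ?thesis using *[of x "nat k"] by simp
  next
    case False then show ?thesis using *[of "x + M * k" "nat (-k)"] by simp
  qed
  from this[of "n mod M" "n div M"] show ?thesis by simp
qed

lemma sum_residues_affine:
  fixes F :: "int \<Rightarrow> 'a::comm_monoid_add"
  assumes per: "\<And>n. F (n + int c) = F n" and c: "c > 0" and u: "coprime u (int c)"
  shows "(\<Sum>y<c. F (u * int y + k)) = (\<Sum>y<c. F (int y))"
proof -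
  define g where "g = (\<lambda>y. nat ((u * int y + k) mod int c))"
  have "inj_on g {..<c}"
  proof (rule inj_onI)
    fix x y assume xy: "x \<in> {..<c}" "y \<in> {..<c}" "g x = g y"
    then have "(u * int x + k) mod int c = (u * int y + k) mod int c"
      using c by (simp add: g_def nat_eq_iff)
    then have "int c dvd u * (int x - int y)" by (simp add: mod_eq_dvd_iff algebra_simps)
    then have "int c dvd int x - int y" using u by (metis coprime_commute coprime_dvd_mult_right_iff)
    then have "int x mod int c = int y mod int c" by (simp add: mod_eq_dvd_iff)
    then show "x = y" using xy by simp
  qed
  moreover have "g ` {..<c} \<subseteq> {..<c}" using c by (auto simp: g_def nat_less_iff)
  ultimately have "bij_betw g {..<c} {..<c}" by (simp add: bij_betw_def endo_inj_surj)
  then have "(\<Sum>y<c. F (int y)) = (\<Sum>y<c. F (int (g y)))" by (rule sum.reindex_bij_betw[symmetric])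
  also have "\<dots> = (\<Sum>y<c. F (u * int y + k))"
    using periodic_mod[of F "int c", OF per] c by (intro sum.cong) (simp_all add: g_def)
  finally show ?thesis by (rule sym)
qed

lemma sum_residues_CRT:
  fixes F :: "int \<Rightarrow> 'a::comm_monoid_add"
  assumes per: "\<And>n. F (n + int (A * B)) = F n" and c: "A > 0" "B > 0" and cop: "coprime A B"
  shows "(\<Sum>n<A * B. F (int n)) = (\<Sum>x<A. \<Sum>y<B. F (int B * int x + int A * int y))"
proof -
  define g where "g = (\<lambda>(x, y). (B * x + A * y) mod (A * B))"
  have cop': "coprime (int A) (int B)" using cop by simp
  have inj: "inj_on g ({..<A} \<times> {..<B})"
  proof (rule inj_onI, clarify)
    fix x y x' y' assume xy: "x < A" "y < B" "x' < A" "y' < B" "g (x, y) = g (x', y')"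
    then have "int (B * x + A * y) mod int (A * B) = int (B * x' + A * y') mod int (A * B)"
      unfolding of_nat_mod[symmetric] by (simp add: g_def)
    then have d: "int A * int B dvd int B * (int x - int x') + int A * (int y - int y')"
      by (simp add: mod_eq_dvd_iff algebra_simps)
    then have "int A dvd int B * (int x - int x') + int A * (int y - int y')" by (rule dvd_mult_left)
    then have "int A dvd int B * (int x - int x')" by (simp add: dvd_add_left_iff)
    then have "int A dvd int x - int x'" using cop' by (simp add: coprime_dvd_mult_right_iff)
    then have "int x mod int A = int x' mod int A" by (simp add: mod_eq_dvd_iff)
    then have 1: "x = x'" using xy by simp
    from d have "int B dvd int B * (int x - int x') + int A * (int y - int y')" by (rule dvd_mult_right)
    then have "int B dvd int A * (int y - int y')" by (simp add: dvd_add_right_iff)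
    then have "int B dvd int y - int y'" using cop' by (simp add: coprime_dvd_mult_right_iff coprime_commute)
    then have "int y mod int B = int y' mod int B" by (simp add: mod_eq_dvd_iff)
    then show "x = x' \<and> y = y'" using 1 xy by simp
  qed
  moreover have "g ` ({..<A} \<times> {..<B}) = {..<A * B}"
  proof (rule card_subset_eq)
    show "g ` ({..<A} \<times> {..<B}) \<subseteq> {..<A * B}" using c by (auto simp: g_def)
    show "card (g ` ({..<A} \<times> {..<B})) = card {..<A * B}" using card_image[OF inj] by simp
  qed simp
  ultimately have "bij_betw g ({..<A} \<times> {..<B}) {..<A * B}" by (simp add: bij_betw_def)
  then have "(\<Sum>n<A * B. F (int n)) = (\<Sum>p\<in>{..<A} \<times> {..<B}. F (int (g p)))" by (rule sum.reindex_bij_betw[symmetric])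
  also have "\<dots> = (\<Sum>(x,y)\<in>{..<A} \<times> {..<B}. F (int B * int x + int A * int y))"
    by (intro sum.cong) (use periodic_mod[of F "int (A * B)", OF per] in \<open>auto simp: g_def of_nat_mod\<close>)
  also have "\<dots> = (\<Sum>x<A. \<Sum>y<B. F (int B * int x + int A * int y))" by (rule sum.cartesian_product[symmetric])
  finally show ?thesis .
qed

text \<open>The Kronecker symbol (12/n), the even primitive quadratic character modulo 12, whose
  theta series is 2 eta.\<close>

definition chi12 :: "int \<Rightarrow> int" where
  "chi12 n = (if n mod 12 \<in> {1, 11} then 1 else if n mod 12 \<in> {5, 7} then -1 else 0)"

lemma chi12_mod: "chi12 (n mod 12) = chi12 n"
  by (simp add: chi12_def)

lemma chi12_per: "chi12 (n + 12 * k) = chi12 n"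
  by (simp add: chi12_def)

lemma chi12_mult: "chi12 (m * n) = chi12 m * chi12 n"
proof -
  have "\<forall>x\<in>set [0..11]. \<forall>y\<in>set [0..11]. chi12 (x * y) = chi12 x * chi12 y" by code_simp
  moreover have "k mod 12 \<in> set [0..11]" for k :: int
    using pos_mod_bound[of 12 k] pos_mod_sign[of 12 k] by simp
  ultimately have "chi12 ((m mod 12) * (n mod 12)) = chi12 (m mod 12) * chi12 (n mod 12)" by blast
  moreover have "chi12 ((m mod 12) * (n mod 12)) = chi12 (m * n)"
    by (metis chi12_mod mod_mult_eq)
  ultimately show ?thesis by (simp add: chi12_mod)
qed

lemma chi12_minus: "chi12 (- n) = chi12 n"
  using chi12_mult[of "-1" n] by (simp add: chi12_def)

lemma chi12_sq: "coprime n 6 \<Longrightarrow> chi12 n * chi12 n = 1"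
proof -
  assume a: "coprime n 6"
  have "\<not> 2 dvd n" "\<not> 3 dvd n"
    using coprime_common_divisor[OF a, of 2] coprime_common_divisor[OF a, of 3] by auto
  then have "n mod 12 \<in> {1, 5, 7, 11}" by (simp; presburger)
  then show ?thesis by (auto simp: chi12_def)
qed

lemma eexp_12th_powers:
  defines "z \<equiv> eexp (1 / 12)"
  shows "z ^ 2 = Complex (1/2) (sqrt 3 / 2)" "z ^ 3 = \<i>" "z ^ 4 = Complex (-1/2) (sqrt 3 / 2)"
     "z ^ 5 = Complex (- sqrt 3 / 2) (1/2)" "z ^ 6 = -1" "z ^ 7 = Complex (- sqrt 3 / 2) (-1/2)"
     "z ^ 8 = Complex (-1/2) (- sqrt 3 / 2)" "z ^ 9 = -\<i>" "z ^ 10 = Complex (1/2) (- sqrt 3 / 2)"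
     "z ^ 11 = Complex (sqrt 3 / 2) (-1/2)" "z ^ 12 = 1" "z ^ 1 = Complex (sqrt 3 / 2) (1/2)" "z ^ 0 = 1"
proof -
  have z: "z = Complex (sqrt 3 / 2) (1/2)"
    using eexp_of_real[of "1/12"] by (simp add: z_def complex_eq_iff cos_30 sin_30)
  have s: "sqrt 3 * sqrt 3 = 3" by simp
  show 2: "z ^ 2 = Complex (1/2) (sqrt 3 / 2)"
    by (simp add: z power2_eq_square complex_eq_iff s)
  show 3: "z ^ 3 = \<i>"
    unfolding power3_eq_cube mult.assoc by (simp add: power2_eq_square[symmetric] 2) (simp add: z complex_eq_iff)
  show "z ^ 4 = Complex (-1/2) (sqrt 3 / 2)"
  proof -
    have "z ^ 4 = z ^ 3 * z" using power_add[of z 3 1] by simp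
    then show ?thesis by (simp only: 3 ) (simp add: z complex_eq_iff s)
  qed
  show "z ^ 5 = Complex (- sqrt 3 / 2) (1/2)"
  proof -
    have "z ^ 5 = z ^ 3 * z ^ 2" using power_add[of z 3 2] by simp
    then show ?thesis by (simp only: 3 2) (simp add: z complex_eq_iff s)
  qed
  show 6: "z ^ 6 = -1"
  proof -
    have "z ^ 6 = z ^ 3 * z ^ 3" using power_add[of z 3 3] by simp
    then show ?thesis by (simp only: 3 ) (simp add: z complex_eq_iff s)
  qed
  show "z ^ 7 = Complex (- sqrt 3 / 2) (-1/2)"
  proof -
    have "z ^ 7 = z ^ 6 * z" using power_add[of z 6 1] by simp
    then show ?thesis by (simp only: 6 ) (simp add: z complex_eq_iff s)
  qed
  show "z ^ 8 = Complex (-1/2) (- sqrt 3 / 2)"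
  proof -
    have "z ^ 8 = z ^ 6 * z ^ 2" using power_add[of z 6 2] by simp
    then show ?thesis by (simp only: 6 2) (simp add: z complex_eq_iff s)
  qed
  show 9: "z ^ 9 = -\<i>"
  proof -
    have "z ^ 9 = z ^ 6 * z ^ 3" using power_add[of z 6 3] by simp
    then show ?thesis by (simp only: 6 3) (simp add: z complex_eq_iff s)
  qed
  show "z ^ 10 = Complex (1/2) (- sqrt 3 / 2)"
  proof -
    have "z ^ 10 = z ^ 9 * z" using power_add[of z 9 1] by simp
    then show ?thesis by (simp only: 9 ) (simp add: z complex_eq_iff s)
  qed
  show "z ^ 11 = Complex (sqrt 3 / 2) (-1/2)"
  proof -
    have "z ^ 11 = z ^ 9 * z ^ 2" using power_add[of z 9 2] by simp
    then show ?thesis by (simp only: 9 2) (simp add: z complex_eq_iff s)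
  qed
  show "z ^ 12 = 1"
  proof -
    have "z ^ 12 = z ^ 6 * z ^ 6" using power_add[of z 6 6] by simp
    then show ?thesis by (simp only: 6 ) (simp add: z complex_eq_iff s)
  qed
  show "z ^ 1 = Complex (sqrt 3 / 2) (1/2)" by (simp add: z)
qed simp

text \<open>A primitive even quadratic character has a Gauss sum that separates for every m, also
  for m not coprime to 12. For modulus 12 this is a finite check over the residues of m.\<close>

lemma gauss_sum_12:
  "(\<Sum>x<12::nat. of_int (chi12 (int x)) * eexp (of_int (m * int x) / 12)) = of_int (chi12 m) * complex_of_real (sqrt 12)"
proof -
  let ?z = "eexp (1 / 12)"
  have s12: "sqrt 12 = 2 * sqrt 3" using real_sqrt_mult[of 4 3] by simp
  have pow: "eexp (of_int (m * int x) / 12) = ?z ^ (nat (m mod 12) * x mod 12)" for x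
  proof -
    have "?z ^ (nat (m mod 12) * x mod 12) = eexp (of_int (int (nat (m mod 12) * x mod 12)) / of_nat 12)"
      by (simp add: eexp_power)
    also have "\<dots> = eexp (of_int (m * int x) / of_nat 12)"
    proof (rule eexp_dvd_cong)
      have "int (nat (m mod 12) * x mod 12) mod 12 = (m * int x) mod 12"
        by (simp add: of_nat_mod mod_mult_left_eq)
      then have "12 dvd int (nat (m mod 12) * x mod 12) - m * int x" by (simp only: mod_eq_dvd_iff)
      then show "int 12 dvd int (nat (m mod 12) * x mod 12) - m * int x" by simp
    qed simp
    finally show ?thesis by simp
  qed
  have "(\<Sum>x<12::nat. of_int (chi12 (int x)) * eexp (of_int (m * int x) / 12)) =
      (\<Sum>x<12::nat. of_int (chi12 (int x)) * ?z ^ (nat (m mod 12) * x mod 12))"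
    by (simp only: pow)
  also have "\<dots> = ?z ^ (nat (m mod 12) * 1 mod 12) - ?z ^ (nat (m mod 12) * 5 mod 12) - ?z ^ (nat (m mod 12) * 7 mod 12) + ?z ^ (nat (m mod 12) * 11 mod 12)"
  proof -
    have "{..<12::nat} = {0,1,2,3,4,5,6,7,8,9,10,11}"
      by (auto simp: lessThan_nat_numeral lessThan_Suc)
    then show ?thesis by (simp add: chi12_def)
  qed
  also have "\<dots> = of_int (chi12 (int (nat (m mod 12)))) * complex_of_real (sqrt 12)"
  proof -
    define w where "w = (\<lambda>j::nat. ?z ^ j)"
    have w: "w 0 = 1" "w (Suc 0) = Complex (sqrt 3 / 2) (1/2)" "w 2 = Complex (1/2) (sqrt 3 / 2)" "w 3 = \<i>"
      "w 4 = Complex (-1/2) (sqrt 3 / 2)" "w 5 = Complex (- sqrt 3 / 2) (1/2)" "w 6 = -1" "w 7 = Complex (- sqrt 3 / 2) (-1/2)"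
      "w 8 = Complex (-1/2) (- sqrt 3 / 2)" "w 9 = -\<i>" "w 10 = Complex (1/2) (- sqrt 3 / 2)" "w 11 = Complex (sqrt 3 / 2) (-1/2)"
      unfolding w_def One_nat_def[symmetric] by (rule eexp_12th_powers)+
    have "w (k * 1 mod 12) - w (k * 5 mod 12) - w (k * 7 mod 12) + w (k * 11 mod 12) = of_int (chi12 (int k)) * complex_of_real (sqrt 12)"
      if "k < 12" for k
    proof -
      have "k \<in> {0,1,2,3,4,5,6,7,8,9,10,11}" using that by (simp; presburger)
      then show ?thesis
        by (elim insertE emptyE; simp only:) (simp_all add: w chi12_def s12 complex_eq_iff)
    qed
    from this[of "nat (m mod 12)"] show ?thesis by (simp add: w_def)
  qed
  finally show ?thesis by (simp add: chi12_mod)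
qed

text \<open>By the Chinese remainder theorem \<open>n = c x + 12 y\<close> modulo \<open>12 c\<close>, and \<open>a n\<^sup>2 = 144 a y\<^sup>2\<close> modulo \<open>c\<close>.\<close>

definition gauss_sum :: "nat \<Rightarrow> int \<Rightarrow> complex" where
  "gauss_sum c a = (\<Sum>y<c. eexp (of_int (144 * a * (int y)\<^sup>2) / of_nat c))"

text \<open>By hypothesis a' is the negative inverse of 576 a modulo c, and 576 = 4 * 144. Hence 144
  a (y - 2 a' m)^2 is congruent to 144 a y^2 + m y - a' m^2, and shifting y does not change the
  sum.\<close>

lemma gauss_sum_complete_square:
  assumes c: "c > 0" and a: "int c dvd 576 * a * a' + 1"
  shows "(\<Sum>y<c. eexp (of_int (144 * a * (int y)\<^sup>2 + m * int y) / of_nat c)) = eexp (of_int (a' * m\<^sup>2) / of_nat c) * gauss_sum c a"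
proof -
  have "(\<Sum>y<c. eexp (of_int (144 * a * (int y)\<^sup>2 + m * int y) / of_nat c)) =
     (\<Sum>y<c. eexp (of_int (a' * m\<^sup>2) / of_nat c) * eexp (of_int (144 * a * (1 * int y + (- 2 * a' * m))\<^sup>2) / of_nat c))"
  proof (rule sum.cong)
    fix y
    have "144 * a * (int y)\<^sup>2 + m * int y - (a' * m\<^sup>2 + 144 * a * (1 * int y + (- 2 * a' * m))\<^sup>2) = (576 * a * a' + 1) * (m * int y - a' * m\<^sup>2)"
      by (simp add: power2_eq_square algebra_simps)
    then have "eexp (of_int (144 * a * (int y)\<^sup>2 + m * int y) / of_nat c) = eexp (of_int (a' * m\<^sup>2 + 144 * a * (1 * int y + (- 2 * a' * m))\<^sup>2) / of_nat c)"
      using a c by (intro eexp_dvd_cong) auto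
    also have "\<dots> = eexp (of_int (a' * m\<^sup>2) / of_nat c) * eexp (of_int (144 * a * (1 * int y + (- 2 * a' * m))\<^sup>2) / of_nat c)"
      unfolding of_int_add[of "a' * m\<^sup>2"] by (simp only: add_divide_distrib eexp_add)
    finally show "eexp (of_int (144 * a * (int y)\<^sup>2 + m * int y) / of_nat c) = eexp (of_int (a' * m\<^sup>2) / of_nat c) * eexp (of_int (144 * a * (1 * int y + (- 2 * a' * m))\<^sup>2) / of_nat c)" .
  qed simp
  also have "\<dots> = eexp (of_int (a' * m\<^sup>2) / of_nat c) * (\<Sum>y<c. eexp (of_int (144 * a * (int y)\<^sup>2) / of_nat c))"
    unfolding sum_distrib_left[symmetric]
  proof (rule arg_cong[of _ _ "\<lambda>x. _ * x"], rule sum_residues_affine[where F = "\<lambda>y. eexp (of_int (144 * a * y\<^sup>2) / of_nat c)"])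
    fix n :: int
    have "144 * a * (n + int c)\<^sup>2 - 144 * a * n\<^sup>2 = int c * (144 * a * (2 * n + int c))"
      by (simp add: power2_eq_square algebra_simps)
    then show "eexp (of_int (144 * a * (n + int c)\<^sup>2) / of_nat c) = eexp (of_int (144 * a * n\<^sup>2) / of_nat c)"
      using c by (intro eexp_dvd_cong) auto
  qed (use c in auto)
  finally show ?thesis by (simp add: gauss_sum_def)
qed

text \<open>The Chinese remainder theorem separates the modulus 12, where
  \<open>gauss_sum_12\<close> reproduces the character, from the modulus c, where the square is
  completed. So the finite Fourier transform of \<open>chi12 n\<close> times e(a n^2 / c) has the
  same shape with a' for a; this is why eta transforms into itself.\<close>

lemma twisted_gauss_sum:
  assumes c: "c > 0" and cop: "coprime c 12" and a: "int c dvd 576 * a * a' + 1"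
  shows "(\<Sum>n<12 * c. of_int (chi12 (int n)) * eexp (of_int (a * (int n)\<^sup>2) / of_nat c) * eexp (of_int (m * int n) / of_nat (12 * c)))
     = of_int (chi12 (int c)) * of_int (chi12 m) * complex_of_real (sqrt 12) * eexp (of_int (a' * m\<^sup>2) / of_nat c) * gauss_sum c a"
proof -
  define F where "F = (\<lambda>n::int. of_int (chi12 n) * eexp (of_int (a * n\<^sup>2) / of_nat c) * eexp (of_int (m * n) / of_nat (12 * c)))"
  have per: "F (n + int (12 * c)) = F n" for n
  proof -
    have "a * (n + int (12 * c))\<^sup>2 - a * n\<^sup>2 = int c * (a * 12 * (2 * n + int (12 * c)))"
      by (simp add: power2_eq_square algebra_simps)
    then have "eexp (of_int (a * (n + int (12 * c))\<^sup>2) / of_nat c) = eexp (of_int (a * n\<^sup>2) / of_nat c)"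
      using c by (intro eexp_dvd_cong) auto
    moreover have "eexp (of_int (m * (n + int (12 * c))) / of_nat (12 * c)) = eexp (of_int (m * n) / of_nat (12 * c))"
      using c by (intro eexp_dvd_cong) (auto simp: algebra_simps)
    moreover have "chi12 (n + int (12 * c)) = chi12 n" using chi12_per[of n "int c"] by simp
    ultimately show ?thesis by (simp only: F_def)
  qed
  have "(\<Sum>n<12 * c. F (int n)) = (\<Sum>x<12. \<Sum>y<c. F (int c * int x + int 12 * int y))"
    by (rule sum_residues_CRT[where F = F and A = 12 and B = c, OF per]) (use c cop in \<open>auto simp: coprime_commute\<close>)
  also have "\<dots> = (\<Sum>x<12. \<Sum>y<c. of_int (chi12 (int c)) * (of_int (chi12 (int x)) * eexp (of_int (m * int x) / 12)) * eexp (of_int (144 * a * (int y)\<^sup>2 + m * int y) / of_nat c))"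
  proof (intro sum.cong refl)
    fix x y
    have 1: "chi12 (int c * int x + int 12 * int y) = chi12 (int c) * chi12 (int x)"
      using chi12_per[of "int c * int x" "int y"] by (simp add: chi12_mult)
    have "a * (int c * int x + int 12 * int y)\<^sup>2 - 144 * a * (int y)\<^sup>2 = int c * (a * (int c * (int x)\<^sup>2 + 24 * int x * int y))"
      by (simp add: power2_eq_square algebra_simps)
    then have 2: "eexp (of_int (a * (int c * int x + int 12 * int y)\<^sup>2) / of_nat c) = eexp (of_int (144 * a * (int y)\<^sup>2) / of_nat c)"
      using c by (intro eexp_dvd_cong) auto
    have "of_int (m * (int c * int x + int 12 * int y)) / of_nat (12 * c) = of_int (m * int x) / 12 + of_int (m * int y) / (of_nat c :: complex)"
      using c by (simp add: field_simps)
    then have 3: "eexp (of_int (m * (int c * int x + int 12 * int y)) / of_nat (12 * c)) = eexp (of_int (m * int x) / 12) * eexp (of_int (m * int y) / of_nat c)"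
      by (simp only: eexp_add)
    show "F (int c * int x + int 12 * int y) = of_int (chi12 (int c)) * (of_int (chi12 (int x)) * eexp (of_int (m * int x) / 12)) * eexp (of_int (144 * a * (int y)\<^sup>2 + m * int y) / of_nat c)"
      unfolding F_def 1 2 3 of_int_add[of "144 * a * (int y)\<^sup>2"] add_divide_distrib eexp_add of_int_mult[of "chi12 (int c)"]
      by (simp only: mult_ac)
  qed
  also have "\<dots> = of_int (chi12 (int c)) * (\<Sum>x<12. of_int (chi12 (int x)) * eexp (of_int (m * int x) / 12)) * (\<Sum>y<c. eexp (of_int (144 * a * (int y)\<^sup>2 + m * int y) / of_nat c))"
    by (simp only: sum_distrib_left[of "of_int (chi12 (int c))"] sum_product)
  also have "\<dots> = of_int (chi12 (int c)) * of_int (chi12 m) * complex_of_real (sqrt 12) * eexp (of_int (a' * m\<^sup>2) / of_nat c) * gauss_sum c a"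
    unfolding gauss_sum_12 gauss_sum_complete_square[OF c a] by (simp only: mult_ac)
  finally show ?thesis by (simp only: F_def)
qed

lemma sum_eexp_residues:
  assumes c: "c > 0"
  shows "(\<Sum>y<c. eexp (of_int (k * int y) / of_nat c)) = (if int c dvd k then of_nat c else 0)"
proof -
  let ?z = "eexp (of_int k / of_nat c)"
  have p: "eexp (of_int (k * int y) / of_nat c) = ?z ^ y" for y by (simp add: eexp_power mult_ac)
  have "?z ^ c = 1" unfolding eexp_power using c eexp_int[of k] by simp
  then show ?thesis
    unfolding p using eexp_eq_1_iff[OF c, of k] geometric_sum[of ?z c] by auto
qed

lemma prime_ge_5_coprime:
  fixes l :: nat
  assumes l: "prime l" "l \<ge> 5"
  shows "coprime l 12" "coprime (int l) 288"
proof -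
  have 2: "coprime l 2" "coprime l 3"
    using l primes_coprime[of l 2] primes_coprime[of l 3] by auto
  have "coprime l (2 ^ 2 * 3)" using 2 by (simp only: coprime_mult_right_iff coprime_power_right_iff) simp
  then show "coprime l 12" by simp
  have "coprime l (2 ^ 5 * 3 ^ 2)" using 2 by (simp only: coprime_mult_right_iff coprime_power_right_iff) simp
  then have "coprime (int l) (int 288)" by (simp only: coprime_int_iff) simp
  then show "coprime (int l) 288" by simp
qed

text \<open>With n = u + t l the exponent becomes linear in t, and the sum over t annihilates every
  u except 0.\<close>

lemma gauss_sum_prime_square:
  fixes l :: nat
  assumes l: "prime l" "l \<ge> 5" and a: "\<not> int l dvd a"
  shows "gauss_sum (l\<^sup>2) a = of_nat l"
proof -
  have l0: "l > 0" using l by simp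
  have nd: "\<not> int l dvd 288 * a * int u" if "0 < u" "u < l" for u
  proof
    assume "int l dvd 288 * a * int u"
    then have "int l dvd 288 * (a * int u)" by (simp add: mult.assoc)
    then have "int l dvd a * int u" using prime_ge_5_coprime(2)[OF l] by (simp add: coprime_dvd_mult_right_iff)
    then have "int l dvd int u" using a l(1) by (simp add: prime_dvd_mult_iff)
    then show False using that by (simp add: nat_dvd_not_less)
  qed
  have "gauss_sum (l\<^sup>2) a = (\<Sum>n<l * l. eexp (of_int (144 * a * (int n)\<^sup>2) / of_nat (l\<^sup>2)))"
    by (simp add: gauss_sum_def power2_eq_square)
  also have "\<dots> = (\<Sum>t<l. \<Sum>u<l. eexp (of_int (144 * a * (int (u + t * l))\<^sup>2) / of_nat (l\<^sup>2)))"
  proof -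
    have "(\<Sum>n<l * l. f n) = (\<Sum>t<l. \<Sum>u<l. f (u + t * l))" for f :: "nat \<Rightarrow> complex"
    proof -
      have "sum f {t * l..<t * l + l} = (\<Sum>u<l. f (u + t * l))" for t
        using sum.shift_bounds_nat_ivl[of f 0 "t * l" l] by (simp only: add_0_left atLeast0LessThan add.commute)
      then show ?thesis by (simp only: sum.nat_group[symmetric])
    qed
    then show ?thesis .
  qed
  also have "\<dots> = (\<Sum>t<l. \<Sum>u<l. eexp (of_int (144 * a * (int u)\<^sup>2) / of_nat (l\<^sup>2)) * eexp (of_int (288 * a * int u * int t) / of_nat l))"
  proof (intro sum.cong refl)
    fix t u
    have "144 * a * (int (u + t * l))\<^sup>2 - (144 * a * (int u)\<^sup>2 + int l * (288 * a * int u * int t)) = int (l\<^sup>2) * (144 * a * (int t)\<^sup>2)"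
      by (simp add: power2_eq_square algebra_simps)
    then have "eexp (of_int (144 * a * (int (u + t * l))\<^sup>2) / of_nat (l\<^sup>2)) = eexp (of_int (144 * a * (int u)\<^sup>2 + int l * (288 * a * int u * int t)) / of_nat (l\<^sup>2))"
      using l0 by (intro eexp_dvd_cong) auto
    also have "of_int (144 * a * (int u)\<^sup>2 + int l * (288 * a * int u * int t)) / of_nat (l\<^sup>2) =
       of_int (144 * a * (int u)\<^sup>2) / of_nat (l\<^sup>2) + of_int (288 * a * int u * int t) / (of_nat l :: complex)"
      using l0 by (simp add: power2_eq_square field_simps)
    finally show "eexp (of_int (144 * a * (int (u + t * l))\<^sup>2) / of_nat (l\<^sup>2)) = eexp (of_int (144 * a * (int u)\<^sup>2) / of_nat (l\<^sup>2)) * eexp (of_int (288 * a * int u * int t) / of_nat l)"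
      by (simp only: eexp_add)
  qed
  also have "\<dots> = (\<Sum>u<l. eexp (of_int (144 * a * (int u)\<^sup>2) / of_nat (l\<^sup>2)) * (\<Sum>t<l. eexp (of_int (288 * a * int u * int t) / of_nat l)))"
    by (subst sum.swap) (simp only: sum_distrib_left)
  also have "\<dots> = (\<Sum>u<l. if u = 0 then of_nat l else 0)"
  proof (intro sum.cong refl)
    fix u assume "u \<in> {..<l}"
    then show "eexp (of_int (144 * a * (int u)\<^sup>2) / of_nat (l\<^sup>2)) * (\<Sum>t<l. eexp (of_int (288 * a * int u * int t) / of_nat l)) = (if u = 0 then of_nat l else 0)"
      unfolding sum_eexp_residues[OF l0] using nd[of u] by auto
  qed
  also have "\<dots> = of_nat l" using l0 by simp
  finally show ?thesis .
qed

text \<open>Replacing z by z + y cancels the squares of y; the sum over y is then linear in y and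
  leaves only z = 0.\<close>

lemma gauss_sum_prime_mult_minus:
  fixes l :: nat
  assumes l: "prime l" "l \<ge> 5" and a: "\<not> int l dvd a"
  shows "gauss_sum l a * gauss_sum l (- a) = of_nat l"
proof -
  have l0: "l > 0" using l by simp
  have nd: "\<not> int l dvd - 288 * a * int u" if "0 < u" "u < l" for u
  proof
    assume "int l dvd - 288 * a * int u"
    then have "int l dvd 288 * (a * int u)" by (simp add: mult.assoc)
    then have "int l dvd a * int u" using prime_ge_5_coprime(2)[OF l] by (simp add: coprime_dvd_mult_right_iff)
    then have "int l dvd int u" using a l(1) by (simp add: prime_dvd_mult_iff)
    then show False using that by (simp add: nat_dvd_not_less)
  qed
  let ?e = "\<lambda>k. eexp (of_int k / of_nat l)"
  have "gauss_sum l a * gauss_sum l (- a) = (\<Sum>y<l. ?e (144 * a * (int y)\<^sup>2) * (\<Sum>z<l. ?e (144 * (- a) * (int z)\<^sup>2)))"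
    by (simp add: gauss_sum_def sum_distrib_right)
  also have "\<dots> = (\<Sum>y<l. ?e (144 * a * (int y)\<^sup>2) * (\<Sum>z<l. ?e (144 * (- a) * (1 * int z + int y)\<^sup>2)))"
  proof -
    have "?e (144 * (- a) * (n + int l)\<^sup>2) = ?e (144 * (- a) * n\<^sup>2)" for n :: int
    proof -
      have "144 * (- a) * (n + int l)\<^sup>2 - 144 * (- a) * n\<^sup>2 = int l * (144 * (- a) * (2 * n + int l))"
        by (simp add: power2_eq_square algebra_simps)
      then show ?thesis using l0 by (intro eexp_dvd_cong) auto
    qed
    from sum_residues_affine[where F = "\<lambda>z. ?e (144 * (- a) * z\<^sup>2)" and u = 1, OF this l0]
    show ?thesis by (simp only: coprime_1_left)
  qed
  also have "\<dots> = (\<Sum>y<l. \<Sum>z<l. ?e (144 * (- a) * (int z)\<^sup>2) * ?e (- 288 * a * int z * int y))"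
    unfolding sum_distrib_left
  proof (intro sum.cong refl)
    fix y z
    have "144 * a * (int y)\<^sup>2 + 144 * (- a) * (1 * int z + int y)\<^sup>2 = 144 * (- a) * (int z)\<^sup>2 + (- 288 * a * int z * int y)"
      by (simp add: power2_eq_square algebra_simps)
    then show "?e (144 * a * (int y)\<^sup>2) * ?e (144 * (- a) * (1 * int z + int y)\<^sup>2) = ?e (144 * (- a) * (int z)\<^sup>2) * ?e (- 288 * a * int z * int y)"
      unfolding eexp_add[symmetric] add_divide_distrib[symmetric] of_int_add[symmetric] by (simp only:)
  qed
  also have "\<dots> = (\<Sum>z<l. ?e (144 * (- a) * (int z)\<^sup>2) * (\<Sum>y<l. ?e (- 288 * a * int z * int y)))"
    by (subst sum.swap) (simp only: sum_distrib_left)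
  also have "\<dots> = (\<Sum>u<l. if u = 0 then of_nat l else 0)"
  proof (intro sum.cong refl)
    fix u assume "u \<in> {..<l}"
    then show "?e (144 * (- a) * (int u)\<^sup>2) * (\<Sum>y<l. ?e (- 288 * a * int u * int y)) = (if u = 0 then of_nat l else 0)"
      unfolding sum_eexp_residues[OF l0] using nd[of u] by auto
  qed
  also have "\<dots> = of_nat l" using l0 by simp
  finally show ?thesis .
qed

section \<open>The eta function as a theta series\<close>

definition eta :: "complex \<Rightarrow> complex" where
  "eta \<tau> = eexp (\<tau> / 24) * eval_fps euler_fps (eexp \<tau>)"

lemma eta_neq_0: "Im \<tau> > 0 \<Longrightarrow> eta \<tau> \<noteq> 0"
  by (simp add: eta_def eval_euler_fps_nonzero norm_eexp_less_1)

text \<open>By \<open>gpent_24\<close> the pentagonal series runs over n = 6 j + 1, where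
  \<open>chi12 n\<close> is (-1)^j. The terms are even in n, and the integers coprime to 6 are
  exactly the 6 j + 1 and their negatives, hence the factor 2.\<close>

lemma eta_has_sum:
  assumes "Im \<tau> > 0"
  shows "((\<lambda>n::int. of_int (chi12 n) * eexp (of_int (n\<^sup>2) * \<tau> / 24)) has_sum (2 * eta \<tau>)) UNIV"
proof -
  let ?f = "\<lambda>n::int. of_int (chi12 n) * eexp (of_int (n\<^sup>2) * \<tau> / 24)"
  have "((\<lambda>j. eexp (\<tau> / 24) * ((-1) ^ nat \<bar>j\<bar> * eexp \<tau> ^ gpent j)) has_sum (eexp (\<tau> / 24) * eval_fps euler_fps (eexp \<tau>))) UNIV"
    by (intro has_sum_cmult_right euler_has_sum norm_eexp_less_1 assms)
  moreover have "eexp (\<tau> / 24) * ((-1) ^ nat \<bar>j\<bar> * eexp \<tau> ^ gpent j) = ?f (6 * j + 1)" for j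
  proof -
    have "(of_int ((6 * j + 1)\<^sup>2) :: complex) = 24 * of_nat (gpent j) + 1"
      unfolding gpent_24[symmetric] by simp
    then have "eexp (of_int ((6 * j + 1)\<^sup>2) * \<tau> / 24) = eexp (\<tau> / 24) * eexp \<tau> ^ gpent j"
      unfolding eexp_power eexp_add[symmetric] by (simp add: field_simps)
    moreover have "chi12 (6 * j + 1) = (-1) ^ nat \<bar>j\<bar>"
    proof (cases "even j")
      case True
      then obtain k where "j = 2 * k" by blast
      then show ?thesis using chi12_per[of 1 k] by (simp add: chi12_def[of 1] even_nat_iff algebra_simps)
    next
      case False
      then obtain k where "j = 2 * k + 1" by (auto elim: oddE)
      moreover have "odd (nat \<bar>j\<bar>)" using False by (simp add: even_nat_iff)
      ultimately show ?thesis using chi12_per[of 7 k] by (simp add: chi12_def[of 7] algebra_simps)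
    qed
    ultimately show ?thesis by simp
  qed
  ultimately have 1: "((\<lambda>j. ?f (6 * j + 1)) has_sum eta \<tau>) UNIV" by (simp add: eta_def)
  then have A: "(?f has_sum eta \<tau>) (range (\<lambda>j. 6 * j + 1))"
    by (subst has_sum_reindex) (auto simp: inj_def o_def)
  have even: "?f \<circ> uminus = ?f" by (simp add: fun_eq_iff chi12_minus)
  have "(?f has_sum eta \<tau>) (uminus ` range (\<lambda>j. 6 * j + 1))"
    unfolding has_sum_reindex[OF inj_on_subset[OF inj_uminus subset_UNIV]] even by (rule A)
  then have B: "(?f has_sum eta \<tau>) (range (\<lambda>j. - (6 * j + 1)))" by (simp only: image_image)
  have "range (\<lambda>j::int. 6 * j + 1) \<inter> range (\<lambda>j. - (6 * j + 1)) = {}"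
    by (auto; presburger)
  from has_sum_Un_disjoint[OF A B this] have *: "(?f has_sum (2 * eta \<tau>)) (range (\<lambda>j. 6 * j + 1) \<union> range (\<lambda>j. - (6 * j + 1)))"
    by simp
  have "chi12 n = 0" if "n \<notin> range (\<lambda>j. 6 * j + 1) \<union> range (\<lambda>j. - (6 * j + 1))" for n
  proof -
    have "n \<noteq> 6 * (n div 6) + 1" "n \<noteq> - (6 * ((- n) div 6) + 1)" using that by blast+
    then have "n mod 12 \<notin> {1, 5, 7, 11}" by (simp; presburger)
    then show ?thesis by (auto simp: chi12_def)
  qed
  then have 0: "?f n = 0" if "n \<notin> range (\<lambda>j. 6 * j + 1) \<union> range (\<lambda>j. - (6 * j + 1))" for n using that by simp
  have "(?f has_sum s) (range (\<lambda>j. 6 * j + 1) \<union> range (\<lambda>j. - (6 * j + 1))) \<longleftrightarrow> (?f has_sum s) UNIV" for s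
    by (rule has_sum_cong_neutral) (use 0 in auto)
  with * show ?thesis by blast
qed

lemma has_sum_residues:
  fixes f :: "int \<Rightarrow> 'a :: {topological_comm_monoid_add}"
  assumes M: "M > 0" and "\<And>r. r < M \<Longrightarrow> ((\<lambda>t::int. f (int r + int M * t)) has_sum S r) UNIV"
  shows "(f has_sum (\<Sum>r<M. S r)) UNIV"
proof -
  have "(f has_sum (\<Sum>r<M'. S r)) (\<Union>r<M'. range (\<lambda>t. int r + int M * t))" if "M' \<le> M" for M'
    using that
  proof (induction M')
    case (Suc N)
    have "(f has_sum S N) (range (\<lambda>t. int N + int M * t))"
      using assms(2)[of N] Suc.prems M by (subst has_sum_reindex) (auto simp: inj_def o_def)
    moreover have "(\<Union>r<N. range (\<lambda>t. int r + int M * t)) \<inter> range (\<lambda>t. int N + int M * t) = {}"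
    proof (rule equals0I)
      fix x assume "x \<in> (\<Union>r<N. range (\<lambda>t. int r + int M * t)) \<inter> range (\<lambda>t. int N + int M * t)"
      then obtain r t t' where r: "r < N" "x = int r + int M * t" "x = int N + int M * t'" by blast
      have "x mod int M = int r" unfolding r(2) using r(1) Suc.prems by simp
      moreover have "x mod int M = int N" unfolding r(3) using Suc.prems by simp
      ultimately have "int r = int N" by (simp only:)
      then show False using r(1) by simp
    qed
    ultimately have "(f has_sum ((\<Sum>r<N. S r) + S N)) ((\<Union>r<N. range (\<lambda>t. int r + int M * t)) \<union> range (\<lambda>t. int N + int M * t))"
      using Suc by (intro has_sum_Un_disjoint) auto
    then show ?case by (simp add: lessThan_Suc Un_commute add.commute)
  qed simp
  from this[of M] have "(f has_sum (\<Sum>r<M. S r)) (\<Union>r<M. range (\<lambda>t. int r + int M * t))" by simp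
  moreover have "(\<Union>r<M. range (\<lambda>t. int r + int M * t)) = UNIV"
  proof safe
    fix x :: int
    have "x = int (nat (x mod int M)) + int M * (x div int M)" using M by simp
    moreover have "nat (x mod int M) < M" using M by (simp add: nat_less_iff)
    ultimately show "x \<in> (\<Union>r<M. range (\<lambda>t. int r + int M * t))" by blast
  qed auto
  ultimately show ?thesis by simp
qed

lemma has_sum_sum_finite:
  fixes f :: "'a \<Rightarrow> 'b \<Rightarrow> 'c :: {topological_comm_monoid_add}"
  assumes "finite A" "\<And>a. a \<in> A \<Longrightarrow> (f a has_sum S a) B"
  shows "((\<lambda>b. \<Sum>a\<in>A. f a b) has_sum (\<Sum>a\<in>A. S a)) B"
  using assms by (induction A rule: finite_induct) (auto intro!: has_sum_add)

text \<open>The matrix taking the right-hand argument to the left-hand one has the entry \<open>c\<close> at the lower left;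
  on this vertical line \<open>c \<tau> + d\<close> is \<open>\<i> c v\<close>, so no branch of its square root has to be chosen.\<close>

lemma eta_inversion:
  fixes c :: nat and a a' :: int and v :: real
  assumes c: "c > 0" and cop: "coprime c 12" and a: "int c dvd 576 * a * a' + 1" and v: "v > 0"
  shows "eta (of_int (24 * a) / of_nat c + \<i> * of_real (1 / (real c ^ 2 * v))) =
     of_real (sqrt v) * of_int (chi12 (int c)) * gauss_sum c a * eta (of_int (24 * a') / of_nat c + \<i> * of_real v)"
proof -
  \<comment> \<open>\<open>M\<close> is the period of \<open>chi12 n\<close> times e(a n^2 / c). For
    n = r + M t the remaining Gaussian factor of the term of eta is exp (- pi T (t + r / M)^2),
    which forces T = 12 / v.\<close>
  define T where "T = 12 / v"
  have T: "T > 0" using v by (simp add: T_def)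
  define M where "M = 12 * c"
  have M: "M > 0" using c by (simp add: M_def)
  define \<sigma> where "\<sigma> = of_int (24 * a) / of_nat c + \<i> * of_real (1 / (real c ^ 2 * v))"
  define \<tau> where "\<tau> = of_int (24 * a') / of_nat c + \<i> * of_real v"
  have Re_frac: "Im (of_int k / of_nat c) = 0" for k by (metis Im_complex_of_real of_real_divide of_real_of_int_eq of_real_of_nat_eq)
  have im: "Im \<sigma> > 0" "Im \<tau> > 0" unfolding \<sigma>_def \<tau>_def using c v Re_frac[of "24 * a"] Re_frac[of "24 * a'"] by auto
  let ?g = "\<lambda>n::int. of_int (chi12 n) * eexp (of_int (a * n\<^sup>2) / of_nat c)"
  let ?f = "\<lambda>n::int. of_int (chi12 n) * eexp (of_int (n\<^sup>2) * \<sigma> / 24)"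
  let ?w = "\<lambda>m::int. complex_of_real (exp (- pi * (of_int m)\<^sup>2 / T) / sqrt T)"
  have split: "eexp (of_int (n\<^sup>2) * (of_int (24 * b) / of_nat c + \<i> * of_real s) / 24) = eexp (of_int (b * n\<^sup>2) / of_nat c) * of_real (exp (- pi * (of_int n)\<^sup>2 * s / 12))" for n b :: int and s
  proof -
    have "of_int (n\<^sup>2) * (of_int (24 * b) / of_nat c + \<i> * of_real s) / 24 = of_int (b * n\<^sup>2) / of_nat c + \<i> * of_real ((of_int n)\<^sup>2 * s / 24)"
      by (simp add: field_simps)
    moreover have "eexp (\<i> * of_real ((of_int n)\<^sup>2 * s / 24)) = of_real (exp (- pi * (of_int n)\<^sup>2 * s / 12))"
      unfolding eexp_def exp_of_real[symmetric] by (rule arg_cong[of _ _ exp]) (simp add: field_simps)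
    ultimately show ?thesis by (simp only: eexp_add)
  qed
  have g_per: "?g (int r + int M * t) = ?g (int r)" for r t
  proof -
    have "a * (int r + int M * t)\<^sup>2 - a * (int r)\<^sup>2 = int c * (a * 12 * t * (2 * int r + int M * t))"
      by (simp add: M_def power2_eq_square algebra_simps)
    then have "eexp (of_int (a * (int r + int M * t)\<^sup>2) / of_nat c) = eexp (of_int (a * (int r)\<^sup>2) / of_nat c)"
      using c by (intro eexp_dvd_cong) auto
    moreover have "chi12 (int r + int M * t) = chi12 (int r)" using chi12_per[of "int r" "int c * t"] by (simp add: M_def mult_ac)
    ultimately show ?thesis by (simp only:)
  qed
  have "(?f has_sum (\<Sum>r<M. ?g (int r) * (\<Sum>i. theta_dual T i (real r / real M)))) UNIV"
  proof (rule has_sum_residues[OF M])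
    fix r assume r: "r < M"
    have "0 \<le> real r / real M" by simp
    then have r': "-1 \<le> real r / real M" by linarith
    have "((\<lambda>t::int. ?g (int r) * complex_of_real (exp (- pi * T * (of_int t + real r / real M)\<^sup>2))) has_sum
        (?g (int r) * (\<Sum>i. complex_of_real (theta_pair T i (real r / real M))))) UNIV"
      by (intro has_sum_cmult_right theta_pair_has_sum[OF T]) (use r r' in auto)
    moreover have "?g (int r) * complex_of_real (exp (- pi * T * (of_int t + real r / real M)\<^sup>2)) = ?f (int r + int M * t)" for t
    proof -
      have "T * (of_int t + real r / real M)\<^sup>2 = (of_int (int r + int M * t))\<^sup>2 * (1 / (real c ^ 2 * v)) / 12"
        using c v by (simp add: T_def M_def power2_eq_square field_simps)
      then have e: "- pi * T * (of_int t + real r / real M)\<^sup>2 = - pi * (of_int (int r + int M * t))\<^sup>2 * (1 / (real c ^ 2 * v)) / 12"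
        by (simp add: mult.assoc)
      show ?thesis unfolding g_per[of r t, symmetric] e \<sigma>_def split by (simp only: mult.assoc)
    qed
    ultimately show "((\<lambda>t. ?f (int r + int M * t)) has_sum (?g (int r) * (\<Sum>i. theta_dual T i (real r / real M)))) UNIV"
      using theta_poisson[OF T, of "real r / real M"] r by simp
  qed
  then have L: "2 * eta \<sigma> = (\<Sum>r<M. ?g (int r) * (\<Sum>i. theta_dual T i (real r / real M)))"
    using eta_has_sum[OF im(1)] by (rule has_sum_unique[rotated])
  have "((\<lambda>m::int. \<Sum>r<M. ?g (int r) * (?w m * cis (2 * pi * of_int m * (real r / real M)))) has_sum
     (\<Sum>r<M. ?g (int r) * (\<Sum>i. theta_dual T i (real r / real M)))) UNIV"
    by (intro has_sum_sum_finite has_sum_cmult_right theta_dual_has_sum[OF T]) auto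
  \<comment> \<open>For fixed m the sum over the residues is the twisted Gauss sum; its factor sqrt
    12 cancels the one in 1 / sqrt T = sqrt v / sqrt 12.\<close>
  moreover have "(\<Sum>r<M. ?g (int r) * (?w m * cis (2 * pi * of_int m * (real r / real M)))) =
     (of_real (sqrt v) * of_int (chi12 (int c)) * gauss_sum c a) * (of_int (chi12 m) * eexp (of_int (m\<^sup>2) * \<tau> / 24))" for m
  proof -
    have "cis (2 * pi * of_int m * (real r / real M)) = eexp (of_int (m * int r) / of_nat (12 * c))" for r
      using eexp_of_real[of "of_int m * real r / real M"] by (simp add: M_def)
    then have "(\<Sum>r<M. ?g (int r) * (?w m * cis (2 * pi * of_int m * (real r / real M)))) = ?w m * (\<Sum>r<12 * c. ?g (int r) * eexp (of_int (m * int r) / of_nat (12 * c)))"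
      unfolding M_def sum_distrib_left by (simp only: mult_ac)
    also have "\<dots> = ?w m * (of_int (chi12 (int c)) * of_int (chi12 m) * complex_of_real (sqrt 12) * eexp (of_int (a' * m\<^sup>2) / of_nat c) * gauss_sum c a)"
      by (simp only: twisted_gauss_sum[OF c cop a])
    finally have "(\<Sum>r<M. ?g (int r) * (?w m * cis (2 * pi * of_int m * (real r / real M)))) = \<dots>" .
    moreover have w: "?w m = of_real (exp (- pi * (of_int m)\<^sup>2 * v / 12)) * (of_real (sqrt v) / of_real (sqrt 12))"
      using v by (simp add: T_def real_sqrt_divide)
    moreover have "?w m * (of_int (chi12 (int c)) * of_int (chi12 m) * complex_of_real (sqrt 12) * eexp (of_int (a' * m\<^sup>2) / of_nat c) * gauss_sum c a)
      = (of_real (sqrt v) * of_int (chi12 (int c)) * gauss_sum c a) * (of_int (chi12 m) * (eexp (of_int (a' * m\<^sup>2) / of_nat c) * of_real (exp (- pi * (of_int m)\<^sup>2 * v / 12))))"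
      unfolding w by (simp add: field_simps)
    ultimately show ?thesis unfolding \<tau>_def split by (simp only:)
  qed
  ultimately have "((\<lambda>m. (of_real (sqrt v) * of_int (chi12 (int c)) * gauss_sum c a) * (of_int (chi12 m) * eexp (of_int (m\<^sup>2) * \<tau> / 24))) has_sum (2 * eta \<sigma>)) UNIV"
    unfolding L by simp
  moreover have "((\<lambda>m. (of_real (sqrt v) * of_int (chi12 (int c)) * gauss_sum c a) * (of_int (chi12 m) * eexp (of_int (m\<^sup>2) * \<tau> / 24))) has_sum
     ((of_real (sqrt v) * of_int (chi12 (int c)) * gauss_sum c a) * (2 * eta \<tau>))) UNIV"
    by (intro has_sum_cmult_right eta_has_sum im)
  ultimately have "2 * eta \<sigma> = (of_real (sqrt v) * of_int (chi12 (int c)) * gauss_sum c a) * (2 * eta \<tau>)" by (rule has_sum_unique)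
  then show ?thesis unfolding \<sigma>_def \<tau>_def by simp
qed

section \<open>Eisenstein series\<close>

text \<open>The polylogarithm of order -m, that is q d/dq applied m times to q / (1 - q). The case
  distinction matters for m = 0, where 0 ^ 0 = 1.\<close>

definition npow_fps :: "nat \<Rightarrow> complex fps" where
  "npow_fps m = Abs_fps (\<lambda>n. if n = 0 then 0 else of_nat n ^ m)"

lemma less_conv_radius: "fps_conv_radius A \<ge> 1 \<Longrightarrow> norm z < 1 \<Longrightarrow> ereal (norm z) < fps_conv_radius A"
  by (meson ereal_less(3) less_le_trans)

lemma summable_pow_times_geom:
  assumes "0 \<le> x" "x < (1::real)"
  shows "summable (\<lambda>n. real n ^ m * x ^ n)"
proof (rule summable_norm_cancel)
  have "conv_radius (\<lambda>n. real n ^ m) = 1"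
  proof (rule conv_radius_ratio_limit_ereal_nonzero[where c = 1])
    have "(\<lambda>n. (real n / real (Suc n)) ^ m) \<longlonglongrightarrow> 1 ^ m"
      by (intro tendsto_power LIMSEQ_n_over_Suc_n)
    then show "(\<lambda>n. ereal (norm (of_nat n ^ m :: real) / norm (of_nat (Suc n) ^ m :: real))) \<longlonglongrightarrow> 1"
      unfolding one_ereal_def by (simp add: power_divide)
  qed auto
  then show "summable (\<lambda>n. norm (real n ^ m * x ^ n))"
    using assms by (intro abs_summable_in_conv_radius) (auto simp: one_ereal_def)
qed

lemma npow_fps_conv_radius: "fps_conv_radius (npow_fps m) \<ge> 1"
proof (rule fps_conv_radius_ge_1I)
  fix x :: real assume x: "0 < x" "x < 1"
  show "summable (\<lambda>n. norm (fps_nth (npow_fps m) n) * x ^ n)"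
    by (rule summable_comparison_test'[OF summable_pow_times_geom[of x m]])
       (use x in \<open>auto simp: npow_fps_def norm_power\<close>)
qed

lemma eexp_has_field_derivative: "(eexp has_field_derivative (2 * of_real pi * \<i> * eexp z)) (at z)"
  unfolding eexp_def by (auto intro!: derivative_eq_intros)

lemma eval_npow_deriv:
  assumes "Im z > 0"
  shows "((\<lambda>z. eval_fps (npow_fps m) (eexp z)) has_field_derivative (2 * of_real pi * \<i> * eval_fps (npow_fps (Suc m)) (eexp z))) (at z)"
proof -
  have n: "ereal (norm (eexp z)) < fps_conv_radius (npow_fps m)"
    by (intro less_conv_radius npow_fps_conv_radius norm_eexp_less_1 assms)
  have eq: "npow_fps (Suc m) = fps_X * fps_deriv (npow_fps m)"
    by (rule fps_ext) (auto simp: npow_fps_def)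
  have r: "fps_conv_radius (fps_deriv (npow_fps m)) \<ge> 1"
    using fps_conv_radius_deriv[of "npow_fps m"] npow_fps_conv_radius by (rule order.trans[rotated])
  have "eval_fps (npow_fps (Suc m)) (eexp z) = eexp z * eval_fps (fps_deriv (npow_fps m)) (eexp z)"
    unfolding eq by (subst eval_fps_mult) (auto intro!: less_conv_radius r norm_eexp_less_1 assms)
  moreover have "((\<lambda>z. eval_fps (npow_fps m) (eexp z)) has_field_derivative (eval_fps (fps_deriv (npow_fps m)) (eexp z) * (2 * of_real pi * \<i> * eexp z))) (at z)"
    by (rule DERIV_chain2[OF has_field_derivative_eval_fps[OF n] eexp_has_field_derivative])
  ultimately show ?thesis by (simp add: mult_ac)
qed

text \<open>The logarithmic derivative of Gamma z Gamma (1 - z) = pi / sin (pi z), with Digamma z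
  rewritten through 1 + z so that both Digamma terms are regular at 0;
  \<open>zeta_int_bernoulli\<close> expands them there.\<close>

lemma Digamma_reflection:
  fixes z :: complex
  assumes z: "z \<notin> \<int>"
  shows "1 / z + Digamma (1 - z) - Digamma (1 + z) = of_real pi * cos (of_real pi * z) / sin (of_real pi * z)"
proof -
  have nz: "z \<noteq> 0" "z \<notin> \<int>\<^sub>\<le>\<^sub>0" "1 - z \<notin> \<int>\<^sub>\<le>\<^sub>0"
  proof -
    have "1 - z \<notin> \<int>" using z Ints_diff[OF Ints_1, of "1 - z"] by auto
    then show "z \<noteq> 0" "z \<notin> \<int>\<^sub>\<le>\<^sub>0" "1 - z \<notin> \<int>\<^sub>\<le>\<^sub>0"
      using z nonpos_Ints_subset_Ints by auto
  qed
  have s: "sin (of_real pi * z) \<noteq> 0"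
  proof
    assume "sin (of_real pi * z) = 0"
    then obtain n :: int where "of_real pi * z = of_real n * of_real pi" by (auto simp: sin_eq_0)
    then have "z = of_int n" by simp
    then show False using z by simp
  qed
  have "((\<lambda>z. Gamma z * Gamma (1 - z)) has_field_derivative (Gamma z * Digamma z * Gamma (1 - z) - Gamma z * (Gamma (1 - z) * Digamma (1 - z)))) (at z)"
    using nz by (auto intro!: derivative_eq_intros simp: algebra_simps)
  moreover have "((\<lambda>z. Gamma z * Gamma (1 - z)) has_field_derivative (- (of_real pi * (of_real pi * cos (of_real pi * z))) / (sin (of_real pi * z))\<^sup>2)) (at z)"
    unfolding Gamma_reflection_complex using s by (auto intro!: derivative_eq_intros simp: power2_eq_square field_simps)
  ultimately have "Gamma z * Digamma z * Gamma (1 - z) - Gamma z * (Gamma (1 - z) * Digamma (1 - z)) = - (of_real pi * (of_real pi * cos (of_real pi * z))) / (sin (of_real pi * z))\<^sup>2"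
    by (rule DERIV_unique)
  then have "(Gamma z * Gamma (1 - z)) * (Digamma z - Digamma (1 - z)) = - (of_real pi * (of_real pi * cos (of_real pi * z))) / (sin (of_real pi * z))\<^sup>2"
    by (simp add: algebra_simps)
  then have "of_real pi / sin (of_real pi * z) * (Digamma z - Digamma (1 - z)) = - (of_real pi * (of_real pi * cos (of_real pi * z))) / (sin (of_real pi * z))\<^sup>2"
    by (simp only: Gamma_reflection_complex)
  moreover have "Digamma z - Digamma (1 - z) = (of_real pi / sin (of_real pi * z) * (Digamma z - Digamma (1 - z))) * (sin (of_real pi * z) / of_real pi)"
    using s by simp
  ultimately have "Digamma z - Digamma (1 - z) = - (of_real pi * (of_real pi * cos (of_real pi * z))) / (sin (of_real pi * z))\<^sup>2 * (sin (of_real pi * z) / of_real pi)"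
    by (simp only:)
  also have "\<dots> = - (of_real pi * cos (of_real pi * z) / sin (of_real pi * z))"
    using s by (simp add: field_simps power2_eq_square)
  finally have "Digamma z - Digamma (1 - z) = - (of_real pi * cos (of_real pi * z) / sin (of_real pi * z))" .
  moreover have "Digamma (1 + z) = Digamma z + 1 / z" using Digamma_plus1[OF nz(1)] by (simp add: add.commute)
  ultimately show ?thesis by (simp add: algebra_simps)
qed

lemma cot_eexp:
  assumes "eexp z \<noteq> 1"
  shows "of_real pi * cos (of_real pi * z) / sin (of_real pi * z) = of_real pi * \<i> * (eexp z + 1) / (eexp z - 1)"
proof -
  define w where "w = exp (\<i> * (of_real pi * z))"
  have w: "eexp z = w * w"
    unfolding w_def eexp_def exp_add[symmetric] by (rule arg_cong[of _ _ exp]) simp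
  have [simp]: "w \<noteq> 0" by (simp add: w_def)
  have c: "cos (of_real pi * z) = (w + 1 / w) / 2" "sin (of_real pi * z) = (w - 1 / w) / (2 * \<i>)"
    by (simp_all add: cos_exp_eq sin_exp_eq w_def exp_minus inverse_eq_divide)
  have "w * w - 1 \<noteq> 0" using assms w by simp
  moreover have "(w + 1 / w) / 2 = (w * w + 1) / (2 * w)" "(w - 1 / w) / (2 * \<i>) = (w * w - 1) / (2 * \<i> * w)"
    by (simp_all add: field_simps)
  ultimately show ?thesis unfolding c w by (simp add: field_simps)
qed

lemma not_Ints_upper: "Im z > 0 \<Longrightarrow> z \<notin> \<int>"
  by (auto elim!: Ints_cases)

lemma Digamma_qexp:
  assumes z: "Im z > 0"
  shows "1 / z + Digamma (1 - z) - Digamma (1 + z) = - of_real pi * \<i> - 2 * of_real pi * \<i> * eval_fps (npow_fps 0) (eexp z)"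
proof -
  define q where "q = eexp z"
  have q: "norm q < 1" using norm_eexp_less_1[OF z] by (simp add: q_def)
  then have q1: "q \<noteq> 1" by auto
  have "(\<lambda>n. q ^ Suc n) sums (q * (1 / (1 - q)))"
    using sums_mult[OF geometric_sums[OF q], of q] by simp
  then have "(\<lambda>n. fps_nth (npow_fps 0) (Suc n) * q ^ Suc n) sums (q / (1 - q))"
    by (simp add: npow_fps_def)
  then have "(\<lambda>n. fps_nth (npow_fps 0) n * q ^ n) sums (q / (1 - q))"
    by (subst (asm) sums_Suc_iff) (simp add: npow_fps_def)
  then have e: "eval_fps (npow_fps 0) q = q / (1 - q)" by (simp add: eval_fps_def sums_iff)
  have "1 / z + Digamma (1 - z) - Digamma (1 + z) = of_real pi * \<i> * (q + 1) / (q - 1)"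
    unfolding Digamma_reflection[OF not_Ints_upper[OF z]] using cot_eexp[of z] q1 by (simp add: q_def)
  also have "\<dots> = - of_real pi * \<i> - 2 * of_real pi * \<i> * (q / (1 - q))"
    using q1 by (simp add: field_simps)
  finally show ?thesis unfolding e[symmetric] by (simp only: q_def)
qed

text \<open>Both sides of the case m are equal on the open half-plane and may be differentiated: on
  the right this multiplies the n-th coefficient by 2 pi i n, on the left it raises the order of
  Polygamma. The constant - pi i disappears after the first step.\<close>

lemma Polygamma_qexp:
  assumes z: "Im z > 0"
  shows "(-1) ^ m * fact m / z ^ Suc m + (-1) ^ m * Polygamma m (1 - z) - Polygamma m (1 + z) =
    (if m = 0 then - of_real pi * \<i> else 0) - (2 * of_real pi * \<i>) ^ Suc m * eval_fps (npow_fps m) (eexp z)"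
  using z
proof (induction m arbitrary: z)
  case 0
  then show ?case using Digamma_qexp[of z] by simp
next
  case (Suc m)
  let ?L = "\<lambda>m z. (-1) ^ m * fact m / z ^ Suc m + (-1) ^ m * Polygamma m (1 - z) - Polygamma m (1 + (z::complex))"
  let ?R = "\<lambda>m z. (if m = 0 then - of_real pi * \<i> else 0) - (2 * of_real pi * \<i>) ^ Suc m * eval_fps (npow_fps m) (eexp z)"
  have nz: "z \<noteq> 0" "1 - z \<notin> \<int>\<^sub>\<le>\<^sub>0" "1 + z \<notin> \<int>\<^sub>\<le>\<^sub>0"
    using Suc.prems by (auto elim!: nonpos_Ints_cases simp: complex_eq_iff)
  have d: "((\<lambda>z. 1 / z ^ Suc m) has_field_derivative (- of_nat (Suc m) / z ^ Suc (Suc m))) (at z)"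
  proof -
    have "((\<lambda>z. inverse z ^ Suc m) has_field_derivative (of_nat (Suc m) * (- (inverse z ^ Suc (Suc 0)) * inverse z ^ (Suc m - Suc 0)))) (at z)"
      by (rule DERIV_power[OF DERIV_inverse[OF nz(1)]])
    moreover have "of_nat (Suc m) * (- (inverse z ^ Suc (Suc 0)) * inverse z ^ (Suc m - Suc 0)) = - of_nat (Suc m) / z ^ Suc (Suc m)"
      by (simp add: power_inverse divide_inverse algebra_simps)
    moreover have "inverse x ^ Suc m = 1 / x ^ Suc m" for x :: complex
      by (simp only: power_one_over inverse_eq_divide)
    ultimately show ?thesis by (simp only:)
  qed
  have "((\<lambda>z. (-1) ^ m * fact m * (1 / z ^ Suc m) + (-1) ^ m * Polygamma m (1 - z) - Polygamma m (1 + z)) has_field_derivative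
     ((-1) ^ m * fact m * (- of_nat (Suc m) / z ^ Suc (Suc m)) + (-1) ^ m * (Polygamma (Suc m) (1 - z) * (0 - 1)) - Polygamma (Suc m) (1 + z) * (0 + 1))) (at z)"
    by (intro DERIV_add DERIV_diff DERIV_cmult d DERIV_chain2[OF has_field_derivative_Polygamma] nz DERIV_const DERIV_ident)
  then have L: "(?L m has_field_derivative ?L (Suc m) z) (at z)"
    by (simp add: algebra_simps)
  have "(?R m has_field_derivative (0 - (2 * of_real pi * \<i>) ^ Suc m * (2 * of_real pi * \<i> * eval_fps (npow_fps (Suc m)) (eexp z)))) (at z)"
    by (intro DERIV_diff DERIV_const DERIV_cmult eval_npow_deriv Suc.prems)
  then have R: "(?R m has_field_derivative ?R (Suc m) z) (at z)" by (simp add: algebra_simps)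
  have "(?L m has_field_derivative ?R (Suc m) z) (at z)"
  proof (rule has_field_derivative_transform_within_open[OF R])
    show "open {z. Im z > 0}" by (rule open_halfspace_Im_gt)
    show "\<And>x. x \<in> {z. Im z > 0} \<Longrightarrow> ?R m x = ?L m x" using Suc.IH by simp
  qed (use Suc.prems in simp)
  from DERIV_unique[OF L this] show ?case .
qed

text \<open>For odd k - 1 the Polygamma series at 1 + z and 1 - z together with 1 / z^k make up the
  sum of (z + n)^(-k) over all integers n. The pairing is the one of
  \<open>has_sum_int_nat_pairs\<close>.\<close>

lemma lipschitz_formula:
  assumes z: "Im z > 0" and k: "even k" "k \<ge> 2"
  shows "(\<Sum>n. 1 / (z + of_nat n) ^ k + 1 / (z - of_nat n - 1) ^ k) =
    (2 * of_real pi * \<i>) ^ k / fact (k - 1) * eval_fps (npow_fps (k - 1)) (eexp z)"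
    and "summable (\<lambda>n. 1 / (z + of_nat n) ^ k + 1 / (z - of_nat n - 1) ^ k)"
proof -
  obtain m where m: "k = Suc m" "odd m" using k by (cases k) auto
  have m0: "m > 0" using m by (cases m) auto
  have nz: "z \<noteq> 0" "1 - z \<noteq> 0" "1 + z \<noteq> 0" using z by (auto simp: complex_eq_iff)
  have 1: "(\<lambda>n. inverse ((1 + z + of_nat n) ^ k)) sums (Polygamma m (1 + z) / fact m)"
    using Polygamma_LIMSEQ[OF nz(3) m0] m by simp
  have 2: "(\<lambda>n. inverse ((1 - z + of_nat n) ^ k)) sums (Polygamma m (1 - z) / fact m)"
    using Polygamma_LIMSEQ[OF nz(2) m0] m by simp
  have "(\<lambda>n. inverse ((z + of_nat (Suc n)) ^ k)) sums (Polygamma m (1 + z) / fact m)"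
    using 1 by (simp add: add_ac)
  then have 3: "(\<lambda>n. inverse ((z + of_nat n) ^ k)) sums (Polygamma m (1 + z) / fact m + inverse ((z + of_nat 0) ^ k))"
    by (subst (asm) sums_Suc_iff) simp
  have 4: "(1 - z + of_nat n) ^ k = (z - of_nat n - 1) ^ k" for n
  proof -
    have "1 - z + of_nat n = - (z - of_nat n - 1)" by simp
    then show ?thesis using k(1) by (simp only: power_minus_even)
  qed
  have "(\<lambda>n. 1 / (z + of_nat n) ^ k + 1 / (z - of_nat n - 1) ^ k) sums (Polygamma m (1 + z) / fact m + inverse (z ^ k) + Polygamma m (1 - z) / fact m)"
    using sums_add[OF 3 2] unfolding 4 by (simp add: inverse_eq_divide)
  also have "Polygamma m (1 + z) / fact m + inverse (z ^ k) + Polygamma m (1 - z) / fact m =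
     - ((-1) ^ m * fact m / z ^ Suc m + (-1) ^ m * Polygamma m (1 - z) - Polygamma m (1 + z)) / fact m"
    using nz m by (simp add: field_simps)
  also have "\<dots> = (2 * of_real pi * \<i>) ^ k / fact (k - 1) * eval_fps (npow_fps (k - 1)) (eexp z)"
    unfolding Polygamma_qexp[OF z] using m m0 by (simp add: field_simps)
  finally show "(\<Sum>n. 1 / (z + of_nat n) ^ k + 1 / (z - of_nat n - 1) ^ k) =
    (2 * of_real pi * \<i>) ^ k / fact (k - 1) * eval_fps (npow_fps (k - 1)) (eexp z)"
    and "summable (\<lambda>n. 1 / (z + of_nat n) ^ k + 1 / (z - of_nat n - 1) ^ k)"
    by (simp_all add: sums_iff)
qed

text \<open>For k > 0 the value at (0, 0) is 1 / 0 = 0, so summing over all pairs omits the origin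
  as intended.\<close>

definition eis_term :: "nat \<Rightarrow> complex \<Rightarrow> int \<times> int \<Rightarrow> complex" where
  "eis_term k z = (\<lambda>(m, n). 1 / (of_int m * z + of_int n) ^ k)"

lemma lattice_bound:
  assumes z: "Im z > 0"
  obtains d where "d > 0" "\<And>m n :: int. d * (of_int m ^ 2 + of_int n ^ 2) \<le> (norm (of_int m * z + of_int n)) ^ 2"
proof -
  define x y where "x = Re z" and "y = Im z"
  \<comment> \<open>From n^2 <= 2 (m x + n)^2 + 2 (m x)^2 one gets m^2 + n^2 <= 2 (m x + n)^2 + (2
    x^2 + 1) m^2, and m^2 = (m y)^2 / y^2.\<close>
  define C where "C = 2 + (2 * x\<^sup>2 + 1) / y\<^sup>2"
  have y: "y > 0" using z by (simp add: y_def)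
  have C: "C > 0" unfolding C_def using y by (intro add_pos_nonneg divide_nonneg_pos) auto
  have "(1 / C) * (of_int m ^ 2 + of_int n ^ 2) \<le> (norm (of_int m * z + of_int n)) ^ 2" for m n :: int
  proof -
    let ?m = "real_of_int m" and ?n = "real_of_int n"
    have "?n\<^sup>2 \<le> 2 * (?m * x + ?n)\<^sup>2 + 2 * (?m * x)\<^sup>2"
      using sum_squares_ge_zero[of "?n + 2 * ?m * x" 0] zero_le_power2[of "?n + 2 * ?m * x"] by (simp add: power2_eq_square algebra_simps)
    then have "?m\<^sup>2 + ?n\<^sup>2 \<le> 2 * (?m * x + ?n)\<^sup>2 + ?m\<^sup>2 * (2 * x\<^sup>2 + 1)"
      by (simp add: power_mult_distrib algebra_simps)
    also have "?m\<^sup>2 * (2 * x\<^sup>2 + 1) = (2 * x\<^sup>2 + 1) / y\<^sup>2 * (?m * y)\<^sup>2" using y by (simp add: power_mult_distrib)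
    also have "2 * (?m * x + ?n)\<^sup>2 + \<dots> \<le> C * (?m * x + ?n)\<^sup>2 + C * (?m * y)\<^sup>2"
      unfolding C_def using y by (intro add_mono mult_right_mono) auto
    also have "\<dots> = C * ((?m * x + ?n)\<^sup>2 + (?m * y)\<^sup>2)" by (simp add: algebra_simps)
    also have "(?m * x + ?n)\<^sup>2 + (?m * y)\<^sup>2 = (norm (of_int m * z + of_int n)) ^ 2"
      by (simp add: cmod_power2 x_def y_def)
    finally show ?thesis using C by (simp add: field_simps)
  qed
  then show ?thesis using C that[of "1 / C"] by simp
qed

lemma summable_int_inverse_squares: "(\<lambda>n::int. 1 / (1 + (real_of_int n)\<^sup>2)) summable_on UNIV"
proof -
  have s: "summable (\<lambda>n. 1 / (real (Suc n))\<^sup>2)"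
    using inverse_squares_sums by (simp add: sums_iff)
  have s1: "summable (\<lambda>n. norm (1 / (1 + (real_of_int (int n))\<^sup>2)))"
  proof (rule summable_comparison_test'[of "\<lambda>n. 2 / (real (Suc n))\<^sup>2"])
    show "summable (\<lambda>n. 2 / (real (Suc n))\<^sup>2)" using summable_mult[OF s, of 2] by simp
    fix n :: nat
    have "(real (Suc n))\<^sup>2 \<le> 2 * (1 + (real n)\<^sup>2)"
      using zero_le_power2[of "real n - 1"] by (simp add: power2_eq_square algebra_simps)
    moreover have "1 + (real n)\<^sup>2 > 0" by (simp add: add_pos_nonneg)
    ultimately have "1 / (1 + (real n)\<^sup>2) \<le> 2 / (real (Suc n))\<^sup>2" by (simp add: field_simps)
    then show "norm (norm (1 / (1 + (real_of_int (int n))\<^sup>2))) \<le> 2 / (real (Suc n))\<^sup>2" by simp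
  qed
  have s2: "summable (\<lambda>n. norm (1 / (1 + (real_of_int (- int n - 1))\<^sup>2)))"
  proof (rule summable_comparison_test'[OF s])
    fix n :: nat
    have "(of_int (- int n - 1) :: real) = - real (Suc n)" by simp
    then have e: "(of_int (- int n - 1) :: real)\<^sup>2 = (real (Suc n))\<^sup>2" by (simp only: power2_minus)
    show "norm (norm (1 / (1 + (real_of_int (- int n - 1))\<^sup>2))) \<le> 1 / (real (Suc n))\<^sup>2"
      unfolding e by (auto intro!: divide_left_mono simp: add_pos_nonneg)
  qed
  from has_sum_int_nat_pairs[OF s1 s2] show ?thesis by (rule has_sum_imp_summable)
qed

text \<open>Off the origin S = m^2 + n^2 is at least 1, so |m z + n|^k >= d^r S^r >= d^r S^2, while
  (1 + m^2) (1 + n^2) <= 4 S^2. The majorant is thus a product of two convergent series; the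
  exponent 2 of S is where k >= 4 enters.\<close>

lemma eis_term_abs_summable:
  assumes z: "Im z > 0" and k: "k \<ge> 4" "even k"
  shows "(\<lambda>p. norm (eis_term k z p)) summable_on UNIV"
proof -
  obtain r where r: "k = 2 * r" "r \<ge> 2" using k by auto
  obtain d where d: "d > 0" "\<And>m n :: int. d * (of_int m ^ 2 + of_int n ^ 2) \<le> (norm (of_int m * z + of_int n)) ^ 2"
    using lattice_bound[OF z] by blast
  let ?h = "\<lambda>n::int. 1 / (1 + (real_of_int n)\<^sup>2)"
  have habs: "(\<lambda>n. norm (?h n)) summable_on UNIV" using summable_int_inverse_squares by simp
  have "(\<lambda>p. norm ((\<lambda>(m, n). ?h m * ?h n) p)) summable_on (UNIV \<times> UNIV)"
    unfolding Infinite_Sum.abs_summable_on_Sigma_iff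
  proof (intro conjI ballI)
    fix m :: int
    show "(\<lambda>n. norm (case (m, n) of (m, n) \<Rightarrow> ?h m * ?h n)) summable_on UNIV"
      unfolding prod.case norm_mult by (rule summable_on_cmult_right[OF habs])
  next
    have eq: "infsum (\<lambda>n. norm (?h m * ?h n)) UNIV = norm (?h m) * infsum (\<lambda>n. norm (?h n)) UNIV" for m
      by (simp only: norm_mult infsum_cmult_right')
    show "(\<lambda>m. norm (infsum (\<lambda>n. norm (case (m, n) of (m, n) \<Rightarrow> ?h m * ?h n)) UNIV)) summable_on UNIV"
      unfolding prod.case eq
      unfolding real_norm_def abs_mult abs_abs
      by (rule summable_on_cmult_left[OF habs[unfolded real_norm_def]])
  qed
  then have "(\<lambda>p. norm (4 / d ^ r) * norm (case p of (m, n) \<Rightarrow> ?h m * ?h n)) summable_on UNIV"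
    by (intro summable_on_cmult_right) simp
  then have "(\<lambda>p. norm ((4 / d ^ r) * (case p of (m, n) \<Rightarrow> ?h m * ?h n))) summable_on UNIV"
    by (simp only: norm_mult)
  then show ?thesis
  proof (rule Infinite_Sum.abs_summable_on_comparison_test)
    fix p :: "int \<times> int"
    obtain m n where p: "p = (m, n)" by (cases p) auto
    define S where "S = (of_int m ^ 2 + of_int n ^ 2 :: real)"
    show "norm (eis_term k z p) \<le> norm ((4 / d ^ r) * (case p of (m, n) \<Rightarrow> ?h m * ?h n))"
    proof (cases "m = 0 \<and> n = 0")
      case True
      then show ?thesis using k d by (simp add: p eis_term_def power_0_left)
    next
      case False
      then have "m\<^sup>2 + n\<^sup>2 \<ge> 1" by (simp add: int_one_le_iff_zero_less sum_power2_gt_zero_iff)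
      then have S: "S \<ge> 1" unfolding S_def by (metis of_int_1_le_iff of_int_add of_int_power)
      have "(d * S) ^ r \<le> ((norm (of_int m * z + of_int n)) ^ 2) ^ r"
        using d S by (intro power_mono) (auto simp: S_def)
      then have 1: "d ^ r * S ^ r \<le> norm (of_int m * z + of_int n) ^ k"
        by (simp add: r power_mult power_mult_distrib)
      have 2: "S ^ 2 \<le> S ^ r" using S r by (intro power_increasing) auto
      have gen: "1 + a \<le> 2 * (a + b)" if "1 \<le> a + b" "0 \<le> a" "0 \<le> b" for a b :: real using that by simp
      have m1: "1 + (of_int m)\<^sup>2 \<le> 2 * S" unfolding S_def by (rule gen) (use S in \<open>simp_all add: S_def\<close>)
      have n1: "1 + (of_int n)\<^sup>2 \<le> 2 * S" unfolding S_def add.commute[of "(of_int m)\<^sup>2"]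
        by (rule gen) (use S in \<open>simp_all add: S_def add.commute\<close>)
      have 3: "(1 + (of_int m)\<^sup>2) * (1 + (of_int n)\<^sup>2) \<le> 4 * S ^ 2"
        using mult_mono[OF m1 n1] S by (simp add: power2_eq_square)
      have pos: "(1 + (of_int m)\<^sup>2) * (1 + (of_int n)\<^sup>2) > (0::real)" by (simp add: add_pos_nonneg)
      have "d ^ r * ((1 + (of_int m)\<^sup>2) * (1 + (of_int n)\<^sup>2)) \<le> d ^ r * (4 * S ^ r)"
        using 2 3 d by (intro mult_left_mono) auto
      also have "\<dots> \<le> 4 * norm (of_int m * z + of_int n) ^ k" using 1 by simp
      finally have 4: "d ^ r * ((1 + (of_int m)\<^sup>2) * (1 + (of_int n)\<^sup>2)) \<le> 4 * norm (of_int m * z + of_int n) ^ k" .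
      have "norm (eis_term k z p) = 1 / norm (of_int m * z + of_int n) ^ k"
        by (simp add: p eis_term_def norm_divide norm_power)
      also have "\<dots> \<le> 4 / (d ^ r * ((1 + (of_int m)\<^sup>2) * (1 + (of_int n)\<^sup>2)))"
      proof -
        have "d ^ r * ((1 + (of_int m)\<^sup>2) * (1 + (of_int n)\<^sup>2)) > 0" using pos d by simp
        moreover from this 4 have "norm (of_int m * z + of_int n) ^ k > 0" by linarith
        ultimately show ?thesis using 4 by (simp add: field_simps)
      qed
      also have "\<dots> = norm ((4 / d ^ r) * (case p of (m, n) \<Rightarrow> ?h m * ?h n))"
        using d pos by (simp add: p abs_mult add_nonneg_nonneg)
      finally show ?thesis .
    qed
  qed
qed

definition eis_sum :: "nat \<Rightarrow> complex \<Rightarrow> complex" where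
  "eis_sum k z = infsum (eis_term k z) UNIV"

text \<open>As m (-1 / z) + n = (n z - m) / z, the inversion permutes the lattice up to the scalar
  z.\<close>

lemma eis_sum_inversion:
  assumes z: "Im z > 0" and k: "even k"
  shows "eis_sum k (- 1 / z) = z ^ k * eis_sum k z"
proof -
  have z0: "z \<noteq> 0" using z by auto
  have "bij (\<lambda>(m, n). (n, - m :: int))"
    by (rule bij_betw_byWitness[of _ "\<lambda>(m, n). (- n, m)"]) auto
  then have "eis_sum k z = infsum (\<lambda>p. eis_term k z (case p of (m, n) \<Rightarrow> (n, - m))) UNIV"
    unfolding eis_sum_def by (rule infsum_reindex_bij_betw[symmetric])
  then have "z ^ k * eis_sum k z = infsum (\<lambda>p. z ^ k * eis_term k z (case p of (m, n) \<Rightarrow> (n, - m))) UNIV"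
    by (simp only: infsum_cmult_right')
  also have "(\<lambda>p. z ^ k * eis_term k z (case p of (m, n) \<Rightarrow> (n, - m))) = eis_term k (- 1 / z)"
  proof (rule ext, clarify)
    fix m n :: int
    have "of_int m * (- 1 / z) + of_int n = (of_int n * z - of_int m) / z" using z0 by (simp add: field_simps)
    then show "z ^ k * eis_term k z (n, - m) = eis_term k (- 1 / z) (m, n)"
      using z0 by (simp add: eis_term_def power_divide)
  qed
  finally show ?thesis by (simp add: eis_sum_def)
qed

text \<open>For even k >= 2 this is twice the zeta value at k; the index 0 contributes 1 / 0 =
  0.\<close>

definition zeta_int :: "nat \<Rightarrow> complex" where
  "zeta_int k = infsum (\<lambda>n::int. 1 / of_int n ^ k) UNIV"

lemma infsum_int_split:
  fixes f :: "int \<Rightarrow> complex"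
  assumes "f summable_on UNIV" and even: "\<And>n. f (- n) = f n"
  shows "infsum f UNIV = f 0 + 2 * infsum (\<lambda>n. f (int n)) {1..}"
proof -
  have s: "f summable_on A" for A using assms(1) by (rule summable_on_subset_banach) simp
  have U: "UNIV = {0} \<union> ({1..} \<union> {..-1::int})" by auto
  have "infsum f UNIV = f 0 + (infsum f {1..} + infsum f {..-1})"
  proof -
    have "infsum f ({1..} \<union> {..-1}) = infsum f {1..} + infsum f {..-1}"
      by (rule infsum_Un_disjoint[OF s s]) auto
    moreover have "infsum f ({0} \<union> ({1..} \<union> {..-1})) = infsum f {0} + infsum f ({1..} \<union> {..-1})"
      by (rule infsum_Un_disjoint[OF s s]) auto
    ultimately show ?thesis unfolding U by simp
  qed
  also have "infsum f {..-1} = infsum f {1..}"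
    by (rule infsum_reindex_bij_witness[of _ uminus uminus]) (auto simp: even)
  also have "infsum f {1..} = infsum (\<lambda>n. f (int n)) {1..}"
    by (rule infsum_reindex_bij_witness[of _ int nat]) auto
  finally show ?thesis by simp
qed

section \<open>The q-expansion of the lattice sums\<close>

definition sigma_fps :: "nat \<Rightarrow> complex fps" where
  "sigma_fps k = Abs_fps (\<lambda>n. if n \<ge> 1 then of_nat (sigma k n) else 0)"

lemma sigma_le: "n \<ge> 1 \<Longrightarrow> sigma k n \<le> n ^ Suc k"
proof -
  assume n: "n \<ge> 1"
  have "sigma k n \<le> (\<Sum>d | d dvd n. n ^ k)"
    unfolding sigma_def using n by (intro sum_mono power_mono) (auto dest: dvd_imp_le)
  also have "\<dots> = card {d. d dvd n} * n ^ k" by simp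
  also have "card {d. d dvd n} \<le> card {1..n}"
    using n by (intro card_mono) (auto dest: dvd_imp_le intro: Nat.gr0I)
  finally show ?thesis by simp
qed

lemma sigma_fps_conv_radius: "fps_conv_radius (sigma_fps k) \<ge> 1"
proof (rule fps_conv_radius_ge_1I)
  fix x :: real assume x: "0 < x" "x < 1"
  show "summable (\<lambda>n. norm (fps_nth (sigma_fps k) n) * x ^ n)"
  proof (rule summable_comparison_test'[OF summable_pow_times_geom[of x "Suc k"]])
    fix n
    have "n \<ge> 1 \<Longrightarrow> real (sigma k n) \<le> real n ^ Suc k"
      using sigma_le[of n k] by (metis of_nat_le_iff of_nat_power)
    then show "norm (norm (fps_nth (sigma_fps k) n) * x ^ n) \<le> real n ^ Suc k * x ^ n"
      using x by (cases "n \<ge> 1") (auto simp: sigma_fps_def norm_mult norm_power intro!: mult_right_mono)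
  qed (use x in auto)
qed

lemma eval_fps_has_sum:
  assumes "fps_conv_radius A \<ge> 1" "norm (q::complex) < 1"
  shows "((\<lambda>n. fps_nth A n * q ^ n) has_sum eval_fps A q) UNIV"
  using less_conv_radius[OF assms] by (intro norm_summable_imp_has_sum norm_summable_fps sums_eval_fps)

text \<open>Both sides are the absolutely convergent sum of d^k q^(m d) over pairs of positive
  integers; the bijection from (m, d) to (m d, d) regroups it by n = m d.\<close>

lemma lambert_series:
  fixes q :: complex
  assumes q: "norm q < 1"
  shows "infsum (\<lambda>m. eval_fps (npow_fps k) (q ^ m)) {1..} = eval_fps (sigma_fps k) q"
proof -
  let ?g = "\<lambda>(m, d). of_nat d ^ k * q ^ (m * d)"
  let ?h = "\<lambda>(n, d). of_nat d ^ k * q ^ n"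
  have bij: "bij_betw (\<lambda>(m, d). (m * d, d)) ({1..} \<times> {1::nat..}) (SIGMA n:{1..}. {d::nat. d dvd n})"
  proof (rule bij_betw_byWitness[of _ "\<lambda>(n, d). (n div d, d)"])
    show "(\<lambda>(n, d). (n div d, d)) ` (SIGMA n:{1..}. {d::nat. d dvd n}) \<subseteq> {1..} \<times> {1..}"
    proof
      fix p :: "nat \<times> nat" assume "p \<in> (\<lambda>(n, d). (n div d, d)) ` (SIGMA n:{1..}. {d. d dvd n})"
      then obtain n d :: nat where p: "p = (n div d, d)" "n \<ge> 1" "d dvd n" by auto
      then obtain k where "n = d * k" "d \<noteq> 0" "k \<noteq> 0" by auto
      then show "p \<in> {1..} \<times> {1..}" using p by simp
    qed
  qed (auto simp: Suc_le_eq)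
  have fin: "finite {d. d dvd n}" if "n \<ge> 1" for n :: nat using that by simp
  have "(\<lambda>p. norm (?h p)) summable_on (SIGMA n:{1..}. {d::nat. d dvd n})"
    unfolding Infinite_Sum.abs_summable_on_Sigma_iff
  proof (intro conjI ballI)
    fix n :: nat assume "n \<in> {1..}"
    then show "(\<lambda>d. norm (?h (n, d))) summable_on {d. d dvd n}" using fin by (intro summable_on_finite) auto
  next
    have inner: "infsum (\<lambda>d. norm (?h (n, d))) {d. d dvd n} = norm (fps_nth (sigma_fps k) n * q ^ n)" if "n \<in> {1..}" for n
    proof -
      have "norm (fps_nth (sigma_fps k) n * q ^ n) = real (sigma k n) * norm q ^ n"
        using that by (simp add: sigma_fps_def norm_mult norm_power)
      also have "\<dots> = (\<Sum>d | d dvd n. real d ^ k * norm q ^ n)" by (simp add: sigma_def sum_distrib_right)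
      also have "\<dots> = infsum (\<lambda>d. norm (?h (n, d))) {d. d dvd n}"
        using that fin[of n] by (simp add: norm_mult norm_power)
      finally show ?thesis by (rule sym)
    qed
    have "(\<lambda>n. norm (fps_nth (sigma_fps k) n * q ^ n)) summable_on UNIV"
      using less_conv_radius[OF sigma_fps_conv_radius q] by (intro norm_summable_imp_summable_on) (simp add: norm_summable_fps)
    then have "(\<lambda>n. norm (fps_nth (sigma_fps k) n * q ^ n)) summable_on {1..}"
      by (rule summable_on_subset_banach) simp
    then show "(\<lambda>n. norm (infsum (\<lambda>d. norm (?h (n, d))) {d. d dvd n})) summable_on {1..}"
      by (rule summable_on_cong[THEN iffD2, rotated]) (simp only: inner real_norm_def abs_norm_cancel)
  qed
  then have hs: "?h summable_on (SIGMA n:{1..}. {d::nat. d dvd n})" by (rule abs_summable_summable)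
  have gh: "?g p = ?h (case p of (m, d) \<Rightarrow> (m * d, d))" for p by (cases p) simp
  have gs: "?g summable_on ({1..} \<times> {1..})"
    unfolding gh using summable_on_reindex_bij_betw[OF bij, of ?h] hs by simp
  have "infsum (\<lambda>m. eval_fps (npow_fps k) (q ^ m)) {1..} = infsum (\<lambda>m. infsum (\<lambda>d. ?g (m, d)) {1..}) {1..}"
  proof (rule infsum_cong)
    fix m :: nat assume m: "m \<in> {1..}"
    then have "norm (q ^ m) < 1" using q power_strict_decreasing[of 0 m "norm q"] by (cases "q = 0") (auto simp: norm_power power_0_left)
    from eval_fps_has_sum[OF npow_fps_conv_radius this]
    have "((\<lambda>d. fps_nth (npow_fps k) d * (q ^ m) ^ d) has_sum eval_fps (npow_fps k) (q ^ m)) UNIV" .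
    then have "((\<lambda>d. ?g (m, d)) has_sum eval_fps (npow_fps k) (q ^ m)) {1..}"
      by (rule has_sum_cong_neutral[THEN iffD1, rotated -1]) (auto simp: npow_fps_def power_mult)
    then show "eval_fps (npow_fps k) (q ^ m) = infsum (\<lambda>d. ?g (m, d)) {1..}" by (simp add: infsumI)
  qed
  also have "\<dots> = infsum ?g ({1..} \<times> {1..})" by (rule infsum_Sigma_banach[OF gs])
  also have "\<dots> = infsum ?h (SIGMA n:{1..}. {d::nat. d dvd n})"
    unfolding gh by (rule infsum_reindex_bij_betw[OF bij])
  also have "\<dots> = infsum (\<lambda>n. infsum (\<lambda>d. ?h (n, d)) {d. d dvd n}) {1..}" by (rule infsum_Sigma_banach[OF hs, symmetric])
  also have "\<dots> = infsum (\<lambda>n. fps_nth (sigma_fps k) n * q ^ n) {1..}"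
    by (rule infsum_cong) (use fin in \<open>simp add: sigma_fps_def sigma_def sum_distrib_right\<close>)
  also have "\<dots> = infsum (\<lambda>n. fps_nth (sigma_fps k) n * q ^ n) UNIV"
    by (rule infsum_cong_neutral) (auto simp: sigma_fps_def)
  also have "\<dots> = eval_fps (sigma_fps k) q"
    using eval_fps_has_sum[OF sigma_fps_conv_radius q] by (rule infsumI)
  finally show ?thesis .
qed

text \<open>The row m = 0 is \<open>zeta_int k\<close>. The rows m and -m agree because k is even,
  and for m > 0 the Lipschitz formula at m z yields a series in q^m; the Lambert series collects
  these.\<close>

lemma eis_sum_qexp:
  assumes z: "Im z > 0" and k: "k \<ge> 4" "even k"
  shows "eis_sum k z = zeta_int k + 2 * ((2 * of_real pi * \<i>) ^ k / fact (k - 1)) * eval_fps (sigma_fps (k - 1)) (eexp z)"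
proof -
  let ?K = "(2 * of_real pi * \<i>) ^ k / fact (k - 1)"
  have s: "eis_term k z summable_on (UNIV \<times> UNIV)"
    using abs_summable_summable[OF eis_term_abs_summable[OF z k]] by simp
  define F where "F = (\<lambda>m. infsum (\<lambda>n. eis_term k z (m, n)) UNIV)"
  have sF: "F summable_on UNIV"
    unfolding F_def using summable_on_Sigma_banach[of "\<lambda>m n. eis_term k z (m, n)" UNIV "\<lambda>_. UNIV"] s by simp
  have "eis_sum k z = infsum F UNIV"
    unfolding eis_sum_def F_def using infsum_Sigma_banach[OF s] by simp
  also have "\<dots> = F 0 + 2 * infsum (\<lambda>m. F (int m)) {1..}"
  proof (rule infsum_int_split[OF sF])
    fix m
    show "F (- m) = F m"
      unfolding F_def
    proof (rule infsum_reindex_bij_witness[of _ uminus uminus])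
      fix n
      have "of_int m * z + of_int (- n) = - (of_int (- m) * z + of_int n)" by simp
      then have "(of_int m * z + of_int (- n)) ^ k = (of_int (- m) * z + of_int n) ^ k" using k(2) by (simp only: power_minus_even)
      then show "eis_term k z (m, - n) = eis_term k z (- m, n)" by (simp only: eis_term_def prod.case)
    qed auto
  qed
  also have "F 0 = zeta_int k" by (simp add: F_def eis_term_def zeta_int_def)
  also have "infsum (\<lambda>m. F (int m)) {1..} = infsum (\<lambda>m. ?K * eval_fps (npow_fps (k - 1)) (eexp z ^ m)) {1..}"
  proof (rule infsum_cong)
    fix m :: nat assume m: "m \<in> {1..}"
    have imz: "Im (of_nat m * z) > 0" using m z by simp
    have sm: "(\<lambda>n. norm (eis_term k z (int m, n))) summable_on UNIV"
      using eis_term_abs_summable[OF z k] unfolding UNIV_Times_UNIV[symmetric] Infinite_Sum.abs_summable_on_Sigma_iff by simp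
    have p: "summable (\<lambda>n. norm (eis_term k z (int m, int n)))"
    proof -
      have "(\<lambda>n. norm (eis_term k z (int m, n))) summable_on range int" using sm by (rule summable_on_subset_banach) simp
      then have "((\<lambda>n. norm (eis_term k z (int m, n))) \<circ> int) summable_on UNIV" by (subst (asm) summable_on_reindex) auto
      then show ?thesis by (intro summable_on_imp_summable) (simp add: o_def)
    qed
    have n: "summable (\<lambda>n. norm (eis_term k z (int m, - int n - 1)))"
    proof -
      have "(\<lambda>n. norm (eis_term k z (int m, n))) summable_on range (\<lambda>n. - int n - 1)" using sm by (rule summable_on_subset_banach) simp
      then have "((\<lambda>n. norm (eis_term k z (int m, n))) \<circ> (\<lambda>n. - int n - 1)) summable_on UNIV" by (subst (asm) summable_on_reindex) (auto simp: inj_def)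
      then show ?thesis by (intro summable_on_imp_summable) (simp add: o_def)
    qed
    have "F (int m) = (\<Sum>n. eis_term k z (int m, int n) + eis_term k z (int m, - int n - 1))"
      unfolding F_def by (rule infsumI) (rule has_sum_int_nat_pairs[OF p n])
    also have "\<dots> = (\<Sum>n. 1 / (of_nat m * z + of_nat n) ^ k + 1 / (of_nat m * z - of_nat n - 1) ^ k)"
      by (simp add: eis_term_def algebra_simps)
    also have "\<dots> = ?K * eval_fps (npow_fps (k - 1)) (eexp (of_nat m * z))"
      by (rule lipschitz_formula) (use imz k in auto)
    finally show "F (int m) = ?K * eval_fps (npow_fps (k - 1)) (eexp z ^ m)" by (simp only: eexp_power)
  qed
  also have "\<dots> = ?K * eval_fps (sigma_fps (k - 1)) (eexp z)"
    using lambert_series[OF norm_eexp_less_1[OF z], of "k - 1"] by (simp only: infsum_cmult_right')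
  finally show ?thesis by simp
qed

lemma zeta_int_Polygamma:
  assumes k: "k \<ge> 4" "even k"
  shows "zeta_int k = 2 * Polygamma (k - 1) 1 / fact (k - 1)"
proof -
  have "(\<lambda>n. norm (eis_term k \<i> (0, n))) summable_on UNIV"
    using eis_term_abs_summable[of \<i>, OF _ k] unfolding UNIV_Times_UNIV[symmetric] Infinite_Sum.abs_summable_on_Sigma_iff by simp
  moreover have "eis_term k \<i> (0, n) = 1 / of_int n ^ k" for n by (simp add: eis_term_def)
  ultimately have "(\<lambda>n::int. norm (1 / of_int n ^ k :: complex)) summable_on UNIV" by (simp only:)
  then have s: "(\<lambda>n::int. 1 / of_int n ^ k :: complex) summable_on UNIV"
    by (rule abs_summable_summable)
  have "zeta_int k = 1 / of_int 0 ^ k + 2 * infsum (\<lambda>n. 1 / of_int (int n) ^ k) {1..}"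
    unfolding zeta_int_def by (rule infsum_int_split[OF s]) (use k in simp)
  also have "(1 / of_int 0 ^ k :: complex) = 0" using k by simp
  also have "infsum (\<lambda>n. 1 / of_int (int n) ^ k) {1..} = infsum (\<lambda>n. 1 / (1 + of_nat n) ^ k :: complex) UNIV"
    by (rule infsum_reindex_bij_witness[of _ Suc "\<lambda>n. n - 1"]) auto
  also have "\<dots> = Polygamma (k - 1) 1 / fact (k - 1)"
  proof -
    have "(\<lambda>n. 1 / (1 + of_nat n) ^ k :: complex) sums (Polygamma (k - 1) 1 / fact (k - 1))"
      using Polygamma_LIMSEQ[of "1 :: complex" "k - 1"] k by (simp add: inverse_eq_divide)
    moreover have "(\<lambda>n. 1 / (1 + of_nat n) ^ k :: complex) summable_on UNIV"
    proof -
      have "(\<lambda>n::int. 1 / of_int n ^ k :: complex) summable_on range (\<lambda>n. 1 + int n)"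
        using s by (rule summable_on_subset_banach) simp
      then have "((\<lambda>n::int. 1 / of_int n ^ k :: complex) \<circ> (\<lambda>n. 1 + int n)) summable_on UNIV"
        by (subst (asm) summable_on_reindex) (auto simp: inj_def)
      then show ?thesis by (simp add: o_def)
    qed
    ultimately show ?thesis by (metis has_sum_imp_sums has_sum_infsum sums_unique2)
  qed
  finally show ?thesis by simp
qed

section \<open>Zeta values and Bernoulli numbers\<close>

lemma bernoulli_fps_complex:
  "Abs_fps (\<lambda>n. of_rat (bernoulli_num n) / fact n * c ^ n) * (fps_exp c - 1) = fps_const c * (fps_X :: complex fps)"
proof (rule fps_ext)
  fix n
  have "(\<Sum>i=0..n. of_rat (bernoulli_num i) / fact i * c ^ i * fps_nth (fps_exp c - 1) (n - i)) =
     c ^ n * of_rat (\<Sum>i=0..n. bernoulli_num i / fact i * fps_nth (fps_exp 1 - 1) (n - i))"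
    unfolding of_rat_sum sum_distrib_left
  proof (rule sum.cong)
    fix i assume "i \<in> {0..n}"
    then have "c ^ n = c ^ i * c ^ (n - i)" by (simp add: power_add[symmetric])
    moreover have "(of_rat (fact m) :: complex) = fact m" for m by (metis of_rat_of_nat_eq of_nat_fact)
    ultimately show "of_rat (bernoulli_num i) / fact i * c ^ i * fps_nth (fps_exp c - 1) (n - i) =
       c ^ n * of_rat (bernoulli_num i / fact i * fps_nth (fps_exp 1 - 1) (n - i))"
      by (cases "n - i = 0") (simp_all add: of_rat_mult of_rat_divide)
  qed simp
  also have "(\<Sum>i=0..n. bernoulli_num i / fact i * fps_nth (fps_exp 1 - 1) (n - i)) = fps_nth fps_X n"
    unfolding bernoulli_num_egf[symmetric] fps_mult_nth by simp
  also have "c ^ n * of_rat (fps_nth fps_X n) = fps_nth (fps_const c * fps_X) n"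
    by (simp only: fps_mult_left_const_nth fps_X_nth) simp
  finally show "fps_nth (Abs_fps (\<lambda>n. of_rat (bernoulli_num n) / fact n * c ^ n) * (fps_exp c - 1)) n = fps_nth (fps_const c * fps_X) n"
    by (simp only: fps_mult_nth[of "Abs_fps _"] fps_nth_Abs_fps)
qed

text \<open>Euler's formula, from two Taylor expansions of pi z cot (pi z) = 1 + z D(z) at 0. The
  coefficients of D are Polygamma values at 1, hence zeta values; on the other hand, with c = 2 pi
  i, the function is pi i z + c z / (exp (c z) - 1), which generates the Bernoulli numbers. This
  identifies the constant of \<open>eisenstein_fps\<close> with the one of the lattice sum.\<close>

lemma zeta_int_bernoulli:
  assumes k: "k \<ge> 4" "even k"
  shows "zeta_int k = - ((2 * of_real pi * \<i>) ^ k * of_rat (bernoulli_num k) / fact k)"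
proof -
  define D :: "complex \<Rightarrow> complex" where "D = (\<lambda>z. Digamma (1 - z) - Digamma (1 + z))"
  define c :: complex where "c = 2 * of_real pi * \<i>"
  define F where "F = fps_expansion D 0"
  have c0: "c \<noteq> 0" by (simp add: c_def)
  have np: "1 + z \<notin> \<int>\<^sub>\<le>\<^sub>0" if "norm z < 1" for z :: complex
  proof
    assume "1 + z \<in> \<int>\<^sub>\<le>\<^sub>0"
    then obtain n :: int where "1 + z = of_int n" "n \<le> 0" by (auto elim!: nonpos_Ints_cases)
    then have "z = of_int (n - 1)" by (simp add: algebra_simps)
    then have "norm z = \<bar>of_int (n - 1)\<bar>" by (simp only: norm_of_int)
    with \<open>n \<le> 0\<close> that show False by simp
  qed
  have np': "1 - z \<notin> \<int>\<^sub>\<le>\<^sub>0" if "norm z < 1" for z :: complex using np[of "-z"] that by simp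
  have nI: "z \<notin> \<int>" if "norm z < 1" "z \<noteq> 0" for z :: complex
    using that by (auto elim!: Ints_cases)
  let ?T = "- \<int>\<^sub>\<le>\<^sub>0 :: complex set"
  have T: "open ?T" by (rule open_Compl) auto
  have hol: "Digamma holomorphic_on ?T" by (rule holomorphic_on_Polygamma) auto
  have h1: "(\<lambda>z. Digamma ((-1) * z + 1)) holomorphic_on ball 0 1"
    by (rule holomorphic_on_compose_gen[OF _ hol, unfolded o_def]) (use np' in \<open>auto intro!: holomorphic_intros\<close>)
  have h2: "(\<lambda>z. Digamma (1 * z + 1)) holomorphic_on ball 0 1"
    by (rule holomorphic_on_compose_gen[OF _ hol, unfolded o_def]) (use np in \<open>auto intro!: holomorphic_intros simp: add.commute\<close>)
  have Deq: "D = (\<lambda>z. Digamma ((-1) * z + 1) - Digamma (1 * z + 1))"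
    by (simp add: D_def add.commute)
  have "D holomorphic_on ball 0 1" unfolding Deq by (intro holomorphic_on_diff h1 h2)
  then have DF: "D has_fps_expansion F"
    unfolding F_def by (intro has_fps_expansion_fps_expansion[of "ball 0 1"]) auto
  have Fn: "fps_nth F n = ((-1) ^ n - 1) * Polygamma n 1 / fact n" for n
  proof -
    have "(deriv ^^ n) (\<lambda>z. Digamma ((-1) * z + 1)) 0 = (-1) ^ n * (deriv ^^ n) Digamma ((-1) * 0 + 1 :: complex)"
      by (rule higher_deriv_compose_linear'[OF hol, of "ball 0 1"]) (use T np' in \<open>auto\<close>)
    moreover have "(deriv ^^ n) (\<lambda>z. Digamma (1 * z + 1)) 0 = 1 ^ n * (deriv ^^ n) Digamma (1 * 0 + 1 :: complex)"
      by (rule higher_deriv_compose_linear'[OF hol, of "ball 0 1"]) (use T np in \<open>auto simp: add.commute\<close>)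
    moreover have "(deriv ^^ n) D 0 = (deriv ^^ n) (\<lambda>z. Digamma ((-1) * z + 1)) 0 - (deriv ^^ n) (\<lambda>z. Digamma (1 * z + 1)) 0"
      unfolding Deq by (rule higher_deriv_diff[OF h1 h2]) auto
    moreover have "(deriv ^^ n) Digamma (1 :: complex) = Polygamma n 1"
      by (subst higher_deriv_Polygamma) auto
    ultimately show ?thesis by (simp add: F_def fps_expansion_def left_diff_distrib)
  qed
  \<comment> \<open>Cleared of denominators, the identity also holds at z = 0 and can be compared as
    power series.\<close>
  have id: "(1 + z * D z) * (exp (c * z) - 1) = of_real pi * \<i> * z * (exp (c * z) + 1)" if "norm z < 1" for z
  proof (cases "z = 0")
    case False
    have e: "exp (c * z) = eexp z" by (simp add: c_def eexp_def)
    have e1: "eexp z \<noteq> 1"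
    proof
      assume "eexp z = 1"
      then have "Re (2 * of_real pi * \<i> * z) = 0 \<and> (\<exists>n::int. Im (2 * of_real pi * \<i> * z) = of_int (2 * n) * pi)"
        unfolding eexp_def exp_eq_1 .
      then obtain n :: int where "z = of_int n" by (auto simp: complex_eq_iff)
      then show False using nI[OF that False] by simp
    qed
    have "1 / z + D z = of_real pi * \<i> * (eexp z + 1) / (eexp z - 1)"
      using Digamma_reflection[OF nI[OF that False]] cot_eexp[OF e1] unfolding D_def add_diff_eq by (rule trans)
    then have "(1 / z + D z) * (eexp z - 1) = of_real pi * \<i> * (eexp z + 1)" using e1 by simp
    then have "z * ((1 / z + D z) * (eexp z - 1)) = z * (of_real pi * \<i> * (eexp z + 1))" by (simp only:)
    moreover have "z * ((1 / z + D z) * (eexp z - 1)) = (1 + z * D z) * (eexp z - 1)"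
      using False by (simp add: field_simps)
    ultimately show ?thesis unfolding e by (simp only: mult_ac)
  qed simp
  have ex: "(\<lambda>z. exp (c * z)) has_fps_expansion fps_exp c" by (rule has_fps_expansion_exp)
  have L: "(\<lambda>z. (1 + z * D z) * (exp (c * z) - 1)) has_fps_expansion ((1 + fps_X * F) * (fps_exp c - 1))"
    by (intro fps_expansion_intros DF ex)
  have R: "(\<lambda>z. of_real pi * \<i> * z * (exp (c * z) + 1)) has_fps_expansion (fps_const (of_real pi * \<i>) * fps_X * (fps_exp c + 1))"
    by (intro fps_expansion_intros ex)
  have "eventually (\<lambda>z::complex. z \<in> ball 0 1) (nhds 0)" by (rule eventually_nhds_in_open) auto
  then have ev: "eventually (\<lambda>z. (1 + z * D z) * (exp (c * z) - 1) = of_real pi * \<i> * z * (exp (c * z) + 1)) (nhds 0)"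
    by eventually_elim (use id in auto)
  have "(\<lambda>z. of_real pi * \<i> * z * (exp (c * z) + 1)) has_fps_expansion ((1 + fps_X * F) * (fps_exp c - 1))"
    using has_fps_expansion_cong[OF ev refl] L by blast
  then have eq: "(1 + fps_X * F) * (fps_exp c - 1) = fps_const (of_real pi * \<i>) * fps_X * (fps_exp c + 1)"
    using R by (rule fps_expansion_unique_complex)
  define B where "B = Abs_fps (\<lambda>n. of_rat (bernoulli_num n) / fact n * c ^ n)"
  have "B * (fps_exp c - 1) = fps_const c * fps_X"
    unfolding B_def by (rule bernoulli_fps_complex)
  moreover have "(1 + fps_X * F - fps_const (of_real pi * \<i>) * fps_X) * (fps_exp c - 1) = fps_const c * fps_X"
  proof -
    have "(1 + fps_X * F - fps_const (of_real pi * \<i>) * fps_X) * (fps_exp c - 1) =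
      fps_const (of_real pi * \<i>) * fps_X * (fps_exp c + 1) - fps_const (of_real pi * \<i>) * fps_X * (fps_exp c - 1)"
      unfolding eq[symmetric] by (simp only: left_diff_distrib)
    also have "\<dots> = (fps_const (of_real pi * \<i>) + fps_const (of_real pi * \<i>)) * fps_X"
      by (simp add: algebra_simps del: fps_const_add)
    also have "fps_const (of_real pi * \<i>) + fps_const (of_real pi * \<i>) = fps_const c" by (simp add: c_def)
    finally show ?thesis .
  qed
  moreover have "fps_exp c - 1 \<noteq> 0"
  proof
    assume "fps_exp c - 1 = 0"
    then have "fps_nth (fps_exp c - 1) 1 = 0" by simp
    then show False using c0 by simp
  qed
  ultimately have "1 + fps_X * F - fps_const (of_real pi * \<i>) * fps_X = B" by (metis mult_right_cancel)
  then have "fps_nth (1 + fps_X * F - fps_const (of_real pi * \<i>) * fps_X) k = fps_nth B k" by simp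
  then have "fps_nth F (k - 1) = of_rat (bernoulli_num k) / fact k * c ^ k"
    using k by (cases k) (auto simp: B_def)
  moreover have "fps_nth F (k - 1) = - zeta_int k"
    using k by (simp add: Fn zeta_int_Polygamma)
  ultimately show ?thesis unfolding c_def by (simp add: mult_ac)
qed

section \<open>The normalised Eisenstein series\<close>

definition eis :: "nat \<Rightarrow> complex fps" where
  "eis r = Abs_fps (\<lambda>n. of_rat (fps_nth (eisenstein_fps r) n))"

lemma eis_eq: "eis r = 1 - fps_const (4 * of_nat r / of_rat (bernoulli_num (2 * r))) * sigma_fps (2 * r - 1)"
  by (rule fps_ext) (auto simp: eis_def eisenstein_fps_def sigma_fps_def of_rat_diff of_rat_mult of_rat_divide)

lemma eis_conv_radius: "fps_conv_radius (eis r) \<ge> 1"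
  unfolding eis_eq
proof (rule order.trans[OF _ fps_conv_radius_diff])
  have "fps_conv_radius (fps_const (4 * of_nat r / of_rat (bernoulli_num (2 * r))) * sigma_fps (2 * r - 1)) \<ge> 1"
    by (rule order.trans[OF _ fps_conv_radius_mult]) (simp add: sigma_fps_conv_radius)
  then show "1 \<le> min (fps_conv_radius (1 :: complex fps)) (fps_conv_radius (fps_const (4 * of_nat r / of_rat (bernoulli_num (2 * r))) * sigma_fps (2 * r - 1)))"
    by simp
qed

lemma eval_eis:
  assumes z: "Im z > 0" and r: "r \<ge> 2" and B: "bernoulli_num (2 * r) \<noteq> 0"
  shows "eis_sum (2 * r) z = zeta_int (2 * r) * eval_fps (eis r) (eexp z)" "zeta_int (2 * r) \<noteq> 0"
proof -
  let ?c = "2 * of_real pi * \<i>" and ?B = "of_rat (bernoulli_num (2 * r)) :: complex"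
  have Z: "zeta_int (2 * r) = - (?c ^ (2 * r) * ?B / fact (2 * r))"
    by (rule zeta_int_bernoulli) (use r in auto)
  show nz: "zeta_int (2 * r) \<noteq> 0" unfolding Z using B by simp
  have n: "norm (eexp z) < 1" by (rule norm_eexp_less_1[OF z])
  have cr: "ereal (norm (eexp z)) < fps_conv_radius (sigma_fps k)" for k by (rule less_conv_radius[OF sigma_fps_conv_radius n])
  have e: "eval_fps (eis r) (eexp z) = 1 - 4 * of_nat r / ?B * eval_fps (sigma_fps (2 * r - 1)) (eexp z)"
  proof -
    have "eval_fps (fps_const (4 * of_nat r / ?B) * sigma_fps (2 * r - 1)) (eexp z) = 4 * of_nat r / ?B * eval_fps (sigma_fps (2 * r - 1)) (eexp z)"
      by (subst eval_fps_mult) (use cr in auto)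
    moreover have "ereal (norm (eexp z)) < fps_conv_radius (fps_const (4 * of_nat r / ?B) * sigma_fps (2 * r - 1))"
      by (rule less_le_trans[OF _ fps_conv_radius_mult]) (use cr in auto)
    ultimately show ?thesis unfolding eis_eq by (subst eval_fps_diff) auto
  qed
  have f: "fact (2 * r) = of_nat (2 * r) * (fact (2 * r - 1) :: complex)"
    using r by (simp add: fact_reduce)
  have f0: "fact (2 * r - 1) \<noteq> (0 :: complex)" by simp
  show "eis_sum (2 * r) z = zeta_int (2 * r) * eval_fps (eis r) (eexp z)"
  proof -
    have alg: "- (K * b / (2 * x * f)) + 2 * (K / f) * S = - (K * b / (2 * x * f)) * (1 - 4 * x / b * S)"
      if "b \<noteq> 0" "f \<noteq> 0" "x \<noteq> 0" for K b x f S :: complex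
      using that by (simp add: field_simps)
    have nz: "?B \<noteq> 0" "of_nat r \<noteq> (0 :: complex)" using B r by auto
    have E: "eis_sum (2 * r) z = zeta_int (2 * r) + 2 * (?c ^ (2 * r) / fact (2 * r - 1)) * eval_fps (sigma_fps (2 * r - 1)) (eexp z)"
      by (rule eis_sum_qexp[OF z]) (use r in auto)
    show ?thesis
      unfolding E Z e f of_nat_mult of_nat_numeral by (intro alg f0 nz)
  qed
qed

lemma eis_inversion:
  assumes z: "Im z > 0" and r: "r \<ge> 2" and B: "bernoulli_num (2 * r) \<noteq> 0"
  shows "eval_fps (eis r) (eexp (- 1 / z)) = z ^ (2 * r) * eval_fps (eis r) (eexp z)"
proof -
  have im: "Im (- 1 / z) > 0" using z by (simp add: Im_divide zero_less_divide_iff sum_power2_gt_zero_iff)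
  have "zeta_int (2 * r) * eval_fps (eis r) (eexp (- 1 / z)) = zeta_int (2 * r) * (z ^ (2 * r) * eval_fps (eis r) (eexp z))"
    using eval_eis(1)[OF z r B] eval_eis(1)[OF im r B] eis_sum_inversion[OF z, of "2 * r"] by (simp add: mult_ac)
  then show ?thesis using eval_eis(2)[OF z r B] by simp
qed

text \<open>Coefficient n + 1 of \<open>bernoulli_num_egf\<close>, solved for the last Bernoulli
  number, so that the values can be computed one after another.\<close>

lemma bernoulli_num_rec:
  "bernoulli_num n = fact n * ((if n = 0 then 1 else 0) - (\<Sum>i<n. bernoulli_num i / fact i / fact (Suc n - i)))"
proof -
  have "(\<Sum>i=0..Suc n. bernoulli_num i / fact i * fps_nth (fps_exp 1 - 1) (Suc n - i)) = fps_nth fps_X (Suc n)"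
    unfolding bernoulli_num_egf[symmetric] fps_mult_nth by simp
  moreover have "(\<Sum>i=0..Suc n. bernoulli_num i / fact i * fps_nth (fps_exp 1 - 1) (Suc n - i)) =
     (\<Sum>i<n. bernoulli_num i / fact i / fact (Suc n - i)) + bernoulli_num n / fact n"
  proof -
    define f where "f = (\<lambda>i. bernoulli_num i / fact i * fps_nth (fps_exp 1 - 1) (Suc n - i))"
    have "{0..Suc n} = insert (Suc n) (insert n {..<n})" by auto
    then have "sum f {0..Suc n} = f (Suc n) + (f n + sum f {..<n})" by simp
    moreover have "f (Suc n) = 0" "f n = bernoulli_num n / fact n" by (simp_all add: f_def)
    moreover have "(\<Sum>i<n. bernoulli_num i / fact i * fps_nth (fps_exp 1 - 1) (Suc n - i)) = (\<Sum>i<n. bernoulli_num i / fact i / fact (Suc n - i))"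
    proof (rule sum.cong)
      fix i assume "i \<in> {..<n}"
      then obtain m where m: "Suc n - i = Suc m" by (metis Suc_diff_le lessThan_iff less_imp_le_nat)
      show "bernoulli_num i / fact i * fps_nth (fps_exp 1 - 1) (Suc n - i) = bernoulli_num i / fact i / fact (Suc n - i)"
        unfolding m by (simp del: fact_Suc of_nat_Suc)
    qed simp
    ultimately show ?thesis unfolding f_def by (simp only: add_0_left add.commute)
  qed
  moreover have "fps_nth (fps_X :: rat fps) (Suc n) = (if n = 0 then 1 else 0)" by simp
  ultimately have "bernoulli_num n / fact n = (if n = 0 then 1 else 0) - (\<Sum>i<n. bernoulli_num i / fact i / fact (Suc n - i))"
    by (simp add: algebra_simps)
  then show ?thesis by (metis fact_nonzero nonzero_mult_div_cancel_left times_divide_eq_right)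
qed

lemma bernoulli_values:
  "bernoulli_num 4 = -1/30" "bernoulli_num 6 = 1/42" "bernoulli_num 8 = -1/30" "bernoulli_num 10 = 5/66" "bernoulli_num 14 = 7/6"
proof -
  have b0: "bernoulli_num 0 = 1" by (subst bernoulli_num_rec) simp
  have b1: "bernoulli_num (Suc 0) = -1/2" by (subst bernoulli_num_rec) (simp add: b0)
  have b2: "bernoulli_num 2 = 1/6" by (subst bernoulli_num_rec) (simp add: lessThan_nat_numeral lessThan_Suc fact_numeral b0 b1)
  note b = b0 b1 b2 lessThan_nat_numeral lessThan_Suc fact_numeral
  have b3: "bernoulli_num 3 = 0" by (subst bernoulli_num_rec) (simp add: b)
  show b4: "bernoulli_num 4 = -1/30" by (subst bernoulli_num_rec) (simp add: b b3)
  have b5: "bernoulli_num 5 = 0" by (subst bernoulli_num_rec) (simp add: b b3 b4)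
  show b6: "bernoulli_num 6 = 1/42" by (subst bernoulli_num_rec) (simp add: b b3 b4 b5)
  have b7: "bernoulli_num 7 = 0" by (subst bernoulli_num_rec) (simp add: b b3 b4 b5 b6)
  show b8: "bernoulli_num 8 = -1/30" by (subst bernoulli_num_rec) (simp add: b b3 b4 b5 b6 b7)
  have b9: "bernoulli_num 9 = 0" by (subst bernoulli_num_rec) (simp add: b b3 b4 b5 b6 b7 b8)
  show b10: "bernoulli_num 10 = 5/66" by (subst bernoulli_num_rec) (simp add: b b3 b4 b5 b6 b7 b8 b9)
  have b11: "bernoulli_num 11 = 0" by (subst bernoulli_num_rec) (simp add: b b3 b4 b5 b6 b7 b8 b9 b10)
  have b12: "bernoulli_num 12 = -691/2730" by (subst bernoulli_num_rec) (simp add: b b3 b4 b5 b6 b7 b8 b9 b10 b11)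
  have b13: "bernoulli_num 13 = 0" by (subst bernoulli_num_rec) (simp add: b b3 b4 b5 b6 b7 b8 b9 b10 b11 b12)
  show "bernoulli_num 14 = 7/6" by (subst bernoulli_num_rec) (simp add: b b3 b4 b5 b6 b7 b8 b9 b10 b11 b12 b13)
qed

text \<open>In these weights the constant 4 r / B_2r is an integer, unlike in weight 12, where it
  has denominator 691. The integrality of the series rests on this.\<close>

lemma eis_explicit:
  "eis 2 = 1 + fps_const 240 * sigma_fps 3"
  "eis 3 = 1 - fps_const 504 * sigma_fps 5"
  "eis 4 = 1 + fps_const 480 * sigma_fps 7"
  "eis 5 = 1 - fps_const 264 * sigma_fps 9"
  "eis 7 = 1 - fps_const 24 * sigma_fps 13"
proof -
  show "eis 2 = 1 + fps_const 240 * sigma_fps 3" "eis 4 = 1 + fps_const 480 * sigma_fps 7"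
    unfolding eis_eq by (rule fps_ext, simp add: bernoulli_values of_rat_divide of_rat_minus)+
  show "eis 3 = 1 - fps_const 504 * sigma_fps 5" "eis 5 = 1 - fps_const 264 * sigma_fps 9" "eis 7 = 1 - fps_const 24 * sigma_fps 13"
    unfolding eis_eq by (rule fps_ext, simp add: bernoulli_values of_rat_divide of_rat_minus)+
qed

section \<open>Modular forms of level one\<close>

abbreviation upper :: "complex set" where
  "upper \<equiv> {z. Im z > 0}"

lemma open_upper: "open upper" and connected_upper: "connected upper"
  by (simp_all add: open_halfspace_Im_gt convex_halfspace_Im_gt convex_connected)

lemma Im_neg_inverse: "Im z > 0 \<Longrightarrow> Im (- 1 / z) > 0"
  by (simp add: Im_divide zero_less_divide_iff sum_power2_gt_zero_iff)

lemma holomorphic_eqI_imag_axis: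
  assumes f: "f holomorphic_on upper" and g: "g holomorphic_on upper"
    and eq: "\<And>v. v > 0 \<Longrightarrow> f (\<i> * of_real v) = g (\<i> * of_real v)" and z: "Im z > 0"
  shows "f z = g z"
proof -
  have "(\<lambda>z. f z - g z) z = 0"
  proof (rule analytic_continuation[of "\<lambda>z. f z - g z" upper "(\<lambda>v. \<i> * of_real v) ` {0<..}" \<i>])
    show "\<i> islimpt (\<lambda>v. \<i> * of_real v) ` {0<..}"
      unfolding islimpt_approachable
    proof (intro allI impI)
      fix e :: real assume e: "e > 0"
      have "dist (\<i> * of_real (1 + e / 2)) \<i> = e / 2" using e by (simp add: dist_norm algebra_simps norm_mult)
      moreover have "\<i> * of_real (1 + e / 2) \<noteq> \<i>" using e by (simp add: complex_eq_iff)
      moreover have "\<i> * of_real (1 + e / 2) \<in> (\<lambda>v. \<i> * of_real v) ` {0<..}" using e by (intro imageI) simp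
      ultimately show "\<exists>x'\<in>(\<lambda>v. \<i> * of_real v) ` {0<..}. x' \<noteq> \<i> \<and> dist x' \<i> < e"
        using e by (intro bexI[of _ "\<i> * of_real (1 + e / 2)"]) simp_all
    qed
  qed (use f g eq z open_upper connected_upper in \<open>auto intro!: holomorphic_intros\<close>)
  then show ?thesis by simp
qed

lemma eexp_holomorphic [holomorphic_intros]:
  assumes "f holomorphic_on A"
  shows "(\<lambda>z. eexp (f z)) holomorphic_on A"
  unfolding eexp_def using assms by (intro holomorphic_intros)

lemma eval_eexp_holomorphic:
  assumes "fps_conv_radius A \<ge> 1"
  shows "(\<lambda>z. eval_fps A (eexp z)) holomorphic_on upper"
proof -
  have "eval_fps A holomorphic_on eball 0 (fps_conv_radius A)" by (intro holomorphic_intros) auto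
  moreover have "eexp ` upper \<subseteq> eball 0 (fps_conv_radius A)"
    using less_conv_radius[OF assms norm_eexp_less_1] by (auto simp: in_eball_iff)
  moreover have "eexp holomorphic_on upper" using eexp_holomorphic[of "\<lambda>z. z"] by (simp add: holomorphic_on_ident)
  ultimately show ?thesis using holomorphic_on_compose_gen[unfolded o_def] by blast
qed

lemma eta_holomorphic: "eta holomorphic_on upper"
  unfolding eta_def by (intro holomorphic_intros eval_eexp_holomorphic euler_fps_conv_radius) auto

lemma compose_neg_inverse_holomorphic:
  assumes "f holomorphic_on upper"
  shows "(\<lambda>z. f (- 1 / z)) holomorphic_on upper"
  by (rule holomorphic_on_compose_gen[OF _ assms, unfolded o_def])
     (use Im_neg_inverse in \<open>auto intro!: holomorphic_intros\<close>)

lemma eta_imag_inversion: "v > 0 \<Longrightarrow> eta (\<i> * of_real (1 / v)) = of_real (sqrt v) * eta (\<i> * of_real v)"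
  using eta_inversion[of 1 0 0 v] by (simp add: gauss_sum_def chi12_def)

text \<open>Invariance under \<open>z \<mapsto> z + 1\<close> is implicit in the representation by a series in \<open>q\<close>.\<close>

definition modform :: "nat \<Rightarrow> complex fps \<Rightarrow> bool" where
  "modform w A \<longleftrightarrow> fps_conv_radius A \<ge> 1 \<and>
     (\<forall>z. Im z > 0 \<longrightarrow> eval_fps A (eexp (- 1 / z)) = z ^ w * eval_fps A (eexp z))"

lemma eval_upper_mult:
  assumes "fps_conv_radius A \<ge> 1" "fps_conv_radius B \<ge> 1" "Im z > 0"
  shows "eval_fps (A * B) (eexp z) = eval_fps A (eexp z) * eval_fps B (eexp z)"
  using assms by (intro eval_fps_mult less_conv_radius norm_eexp_less_1)

lemma eval_upper_diff:
  assumes "fps_conv_radius A \<ge> 1" "fps_conv_radius B \<ge> 1" "Im z > 0"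
  shows "eval_fps (A - B) (eexp z) = eval_fps A (eexp z) - eval_fps B (eexp z)"
  using assms by (intro eval_fps_diff less_conv_radius norm_eexp_less_1)

lemma eval_upper_power:
  assumes "fps_conv_radius A \<ge> 1" "Im z > 0"
  shows "eval_fps (A ^ n) (eexp z) = eval_fps A (eexp z) ^ n"
  using assms by (intro eval_fps_power less_conv_radius norm_eexp_less_1)

lemma conv_radius_mult_ge_1:
  fixes A B :: "complex fps"
  assumes "fps_conv_radius A \<ge> 1" "fps_conv_radius B \<ge> 1"
  shows "fps_conv_radius (A * B) \<ge> 1"
  using assms by (intro order.trans[OF _ fps_conv_radius_mult]) simp

lemma conv_radius_power_ge_1:
  fixes A :: "complex fps"
  assumes "fps_conv_radius A \<ge> 1"
  shows "fps_conv_radius (A ^ n) \<ge> 1"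
  using assms by (rule order.trans[OF _ fps_conv_radius_power])

lemma modform_mult: "modform v A \<Longrightarrow> modform w B \<Longrightarrow> modform (v + w) (A * B)"
  unfolding modform_def
  by (auto intro: conv_radius_mult_ge_1 simp: eval_upper_mult Im_neg_inverse[simplified] power_add mult_ac
       eval_upper_mult[OF _ _ Im_neg_inverse, simplified])

lemma modform_one: "modform 0 1"
  by (simp add: modform_def)

lemma modform_power: "modform w A \<Longrightarrow> modform (n * w) (A ^ n)"
  by (induction n) (auto intro: modform_mult modform_one)

lemma modform_const: "modform 0 (fps_const c)"
  by (simp add: modform_def)

lemma modform_cmult: "modform w A \<Longrightarrow> modform w (fps_const c * A)"
  using modform_mult[OF modform_const] by simp

lemma modform_diff: "modform w A \<Longrightarrow> modform w B \<Longrightarrow> modform w (A - B)"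
  unfolding modform_def
  by (auto intro!: order.trans[OF _ fps_conv_radius_diff] simp: eval_upper_diff right_diff_distrib
       eval_upper_diff[OF _ _ Im_neg_inverse, simplified])

lemma modform_eis: "r \<in> {2,3,4,5,7} \<Longrightarrow> modform (2 * r) (eis r)"
  unfolding modform_def using eis_conv_radius eis_inversion[of _ r] bernoulli_values by auto

definition delta_fps :: "complex fps" where
  "delta_fps = fps_X * euler_fps ^ 24"

lemma delta_conv_radius: "fps_conv_radius delta_fps \<ge> 1"
  unfolding delta_fps_def by (intro conv_radius_mult_ge_1 conv_radius_power_ge_1 euler_fps_conv_radius) simp

lemma eval_delta: "Im z > 0 \<Longrightarrow> eval_fps delta_fps (eexp z) = eta z ^ 24"
  unfolding delta_fps_def eta_def power_mult_distrib eexp_power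
  by (simp add: eval_upper_mult eval_upper_power euler_fps_conv_radius conv_radius_power_ge_1)

text \<open>On the imaginary axis this is the 24th power of \<open>eta_imag_inversion\<close>,
  because sqrt v ^ 24 = v^12 = (i v)^12.\<close>

lemma modform_delta: "modform 12 delta_fps"
  unfolding modform_def
proof (intro conjI allI impI)
  fix z assume z: "Im z > 0"
  have "eta (- 1 / z) ^ 24 = z ^ 12 * eta z ^ 24"
  proof (rule holomorphic_eqI_imag_axis[where f = "\<lambda>z. eta (- 1 / z) ^ 24" and g = "\<lambda>z. z ^ 12 * eta z ^ 24", OF _ _ _ z])
    show "(\<lambda>z. eta (- 1 / z) ^ 24) holomorphic_on upper"
      by (intro holomorphic_on_power compose_neg_inverse_holomorphic eta_holomorphic)
    show "(\<lambda>z. z ^ 12 * eta z ^ 24) holomorphic_on upper"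
      by (intro holomorphic_intros eta_holomorphic)
    fix v :: real assume v: "v > 0"
    have "- 1 / (\<i> * of_real v) = \<i> * of_real (1 / v)" using v by (simp add: complex_eq_iff Re_divide Im_divide power2_eq_square)
    then have "eta (- 1 / (\<i> * of_real v)) ^ 24 = of_real (sqrt v ^ 24) * eta (\<i> * of_real v) ^ 24"
      by (simp only: eta_imag_inversion[OF v] power_mult_distrib of_real_power)
    also have "sqrt v ^ 24 = v ^ 12" using v power_mult[of "sqrt v" 2 12] by simp
    also have "of_real (v ^ 12) = (\<i> * of_real v) ^ 12" using power_mult[of \<i> 4 3] by (simp add: power_mult_distrib)
    finally show "eta (- 1 / (\<i> * of_real v)) ^ 24 = (\<i> * of_real v) ^ 12 * eta (\<i> * of_real v) ^ 24" .
  qed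
  then show "eval_fps delta_fps (eexp (- 1 / z)) = z ^ 12 * eval_fps delta_fps (eexp z)"
    using eval_delta[OF z] eval_delta[OF Im_neg_inverse[OF z]] by simp
qed (rule delta_conv_radius)

text \<open>The generating function of partitions. Multiplying by its powers stands for division by
  powers of eta or of the discriminant.\<close>

definition part_fps :: "complex fps" where
  "part_fps = inverse euler_fps"

lemma euler_fps_nth_0 [simp]: "fps_nth euler_fps 0 = 1"
  by (simp add: euler_fps_def)

lemma part_mult_euler: "part_fps * euler_fps = 1" "euler_fps * part_fps = 1"
  unfolding part_fps_def by (simp_all only: inverse_mult_eq_1 inverse_mult_eq_1' euler_fps_nth_0 zero_neq_one[symmetric] not_False_eq_True)

lemma part_conv_radius: "fps_conv_radius part_fps \<ge> 1"
proof -
  have "fps_conv_radius (inverse euler_fps) \<ge> min 1 (fps_conv_radius euler_fps)"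
  proof (rule fps_conv_radius_inverse)
    fix z :: complex assume "ereal (norm z) < 1"
    then show "eval_fps euler_fps z \<noteq> 0" by (intro eval_euler_fps_nonzero) (simp add: one_ereal_def)
  qed
  then show ?thesis using euler_fps_conv_radius by (simp add: part_fps_def)
qed

lemma fps_X_power_factor:
  assumes "\<And>i. i < j \<Longrightarrow> fps_nth A i = 0"
  obtains A1 where "A = fps_X ^ j * A1" "fps_conv_radius A1 = fps_conv_radius A"
proof -
  have "A = fps_X ^ j * fps_shift j A"
    by (rule fps_ext) (use assms in \<open>auto simp: fps_X_power_mult_nth\<close>)
  then show ?thesis using that[of "fps_shift j A"] by simp
qed

text \<open>A point with \<open>Im z = 1/2\<close> and \<open>\<bar>Re z\<bar> \<le> 1/2\<close> is mapped to one of height at least \<open>1\<close>, so the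
  maximum over the disc of radius \<open>exp (- pi)\<close> is attained in the interior. No fundamental domain is
  needed.\<close>

lemma invariant_disc_function_zero:
  fixes K :: "complex fps"
  assumes rad: "fps_conv_radius K \<ge> 1" and K0: "fps_nth K 0 = 0"
    and inv: "\<And>z. Im z > 0 \<Longrightarrow> eval_fps K (eexp (- 1 / z)) = eval_fps K (eexp z)"
  shows "K = 0"
proof -
  define r where "r = exp (- pi)"
  have r: "0 < r" "r < 1" by (simp_all add: r_def)
  have sub: "norm q < 1 \<Longrightarrow> q \<in> eball 0 (fps_conv_radius K)" for q :: complex
    using less_conv_radius[OF rad, of q] by (simp add: in_eball_iff)
  have hol: "eval_fps K holomorphic_on ball 0 1"
    by (rule holomorphic_on_subset[OF holomorphic_on_eval_fps[OF order_refl]]) (use sub in auto)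
  have cont: "continuous_on (cball 0 r) (\<lambda>q. norm (eval_fps K q))"
    by (intro continuous_intros continuous_on_subset[OF holomorphic_on_imp_continuous_on[OF hol]]) (use r in auto)
  obtain q0 where q0: "q0 \<in> cball 0 r" "\<And>q. q \<in> cball 0 r \<Longrightarrow> norm (eval_fps K q) \<le> norm (eval_fps K q0)"
    using continuous_attains_sup[OF compact_cball _ cont] r by fastforce
  have "\<exists>q1\<in>ball 0 r. norm (eval_fps K q1) = norm (eval_fps K q0)"
  proof (cases "norm q0 < r")
    case True then show ?thesis by auto
  next
    case False
    then have nq: "norm q0 = r" using q0 by auto
    then have q00: "q0 \<noteq> 0" using r by auto
    \<comment> \<open>The principal logarithm puts Re z into [-1/2, 1/2]. With Im z = 1/2 this gives
      |z|^2 <= 1/2, so Im (-1 / z) = Im z / |z|^2 is at least 1.\<close>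
    define z where "z = Ln q0 / (2 * of_real pi * \<i>)"
    have ez: "eexp z = q0" using q00 by (simp add: eexp_def z_def)
    have "Re (Ln q0) = - pi" using q00 nq by (simp add: r_def)
    then have Im: "Im z = 1 / 2" by (simp add: z_def Im_divide power2_eq_square)
    have Re: "Re z = Im (Ln q0) / (2 * pi)" by (simp add: z_def Re_divide power2_eq_square)
    have "\<bar>Im (Ln q0)\<bar> \<le> pi" using Im_Ln_le_pi[OF q00] mpi_less_Im_Ln[OF q00] by auto
    then have "\<bar>Re z\<bar> \<le> 1 / 2" unfolding Re by (simp add: abs_divide field_simps)
    then have "(Re z)\<^sup>2 \<le> (1 / 2)\<^sup>2" by (simp add: abs_le_square_iff[symmetric])
    then have "(Re z)\<^sup>2 + (Im z)\<^sup>2 \<le> 1 / 2" unfolding Im by (simp add: power2_eq_square)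
    moreover have "(Re z)\<^sup>2 + (Im z)\<^sup>2 > 0" unfolding Im by (simp add: add_nonneg_pos)
    moreover have "Im (- 1 / z) = (1 / 2) / ((Re z)\<^sup>2 + (Im z)\<^sup>2)" unfolding Im[symmetric] by (simp add: Im_divide)
    ultimately have im1: "Im (- 1 / z) \<ge> 1" by simp
    have "norm (eexp (- 1 / z)) \<le> exp (- 2 * pi)"
      unfolding norm_eexp exp_le_cancel_iff using mult_left_mono_neg[OF im1, of "- 2 * pi"] by (simp only: mult_1_right) simp
    also have "\<dots> < r" by (simp add: r_def)
    finally have "eexp (- 1 / z) \<in> ball 0 r" by simp
    moreover have "eval_fps K (eexp (- 1 / z)) = eval_fps K q0" using inv[of z] Im ez by simp
    ultimately show ?thesis by (intro bexI[of _ "eexp (- 1 / z)"]) auto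
  qed
  then obtain q1 where q1: "q1 \<in> ball 0 r" "norm (eval_fps K q1) = norm (eval_fps K q0)" by blast
  have "eval_fps K constant_on ball 0 r"
  proof (rule maximum_modulus_principle[where U = "ball 0 r" and \<xi> = q1])
    show "eval_fps K holomorphic_on ball 0 r" by (rule holomorphic_on_subset[OF hol]) (use r in auto)
  qed (use q0 q1 in auto)
  then obtain c where c: "\<And>q. q \<in> ball 0 r \<Longrightarrow> eval_fps K q = c" by (auto simp: constant_on_def)
  have "c = 0" using c[of 0] r by (simp add: eval_fps_at_0 K0)
  have "eventually (\<lambda>q::complex. q \<in> ball 0 r) (nhds 0)" using r by (intro eventually_nhds_in_open) auto
  then have "eventually (\<lambda>q. eval_fps K q = eval_fps 0 q) (nhds 0)"
    by eventually_elim (use c \<open>c = 0\<close> in simp)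
  then show ?thesis
    by (rule eval_fps_eqD[rotated 2]) (use rad in \<open>auto intro: less_le_trans[of _ 1]\<close>)
qed

text \<open>A substitute for the valence formula. \<open>A ^ 12\<close> and
  \<open>delta_fps ^ w\<close> both have weight 12 w, so their quotient \<open>K\<close> is
  invariant; it is holomorphic since eta has no zeros, and it vanishes at the cusp to order at least
  12 j - w > 0.\<close>

lemma modform_vanish:
  assumes A: "modform w A" and j: "\<And>i. i < j \<Longrightarrow> fps_nth A i = 0" and w: "w < 12 * j"
  shows "A = 0"
proof -
  have radA: "fps_conv_radius A \<ge> 1" using A by (simp add: modform_def)
  obtain A1 where A1: "A = fps_X ^ j * A1" "fps_conv_radius A1 = fps_conv_radius A"
    using fps_X_power_factor[of j A] j by blast
  \<comment> \<open>\<open>A\<^sup>1\<^sup>2\<close> divided by the \<open>w\<close>-th power of the discriminant\<close>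
  define K where "K = fps_X ^ (12 * j - w) * A1 ^ 12 * part_fps ^ (24 * w)"
  have "fps_X ^ (12 * j - w) * fps_X ^ w = (fps_X :: complex fps) ^ (12 * j)"
    using w by (simp flip: power_add)
  then have "K * delta_fps ^ w = fps_X ^ (12 * j) * A1 ^ 12 * (part_fps * euler_fps) ^ (24 * w)"
    unfolding K_def delta_fps_def by (simp add: power_mult_distrib power_mult[symmetric] mult_ac)
  then have Kd: "K * delta_fps ^ w = A ^ 12"
    unfolding part_mult_euler A1(1) by (simp add: power_mult_distrib power_mult[symmetric] mult.commute)
  have radK: "fps_conv_radius K \<ge> 1"
    unfolding K_def using radA A1(2) by (intro conv_radius_mult_ge_1 conv_radius_power_ge_1 part_conv_radius) auto
  have "K = 0"
  proof (rule invariant_disc_function_zero[OF radK])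
    show "fps_nth K 0 = 0" using w by (simp add: K_def)
    fix z assume z: "Im z > 0"
    have K: "eval_fps K (eexp z) = eval_fps A (eexp z) ^ 12 / eval_fps delta_fps (eexp z) ^ w" if "Im z > 0" for z
    proof -
      have "eval_fps K (eexp z) * eval_fps delta_fps (eexp z) ^ w = eval_fps A (eexp z) ^ 12"
        using arg_cong[OF Kd, of "\<lambda>A. eval_fps A (eexp z)"] that radK delta_conv_radius radA
        by (simp add: eval_upper_mult eval_upper_power conv_radius_power_ge_1)
      then show ?thesis using eval_delta[OF that] eta_neq_0[OF that] by (simp add: field_simps)
    qed
    have z0: "z \<noteq> 0" using z by auto
    have "eval_fps K (eexp (- 1 / z)) = (z ^ w * eval_fps A (eexp z)) ^ 12 / (z ^ 12 * eval_fps delta_fps (eexp z)) ^ w"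
      unfolding K[OF Im_neg_inverse[OF z]] using A modform_delta z unfolding modform_def by simp
    also have "\<dots> = eval_fps K (eexp z)"
      unfolding K[OF z] using z0 by (simp add: power_mult_distrib power_mult[symmetric] mult.commute)
    finally show "eval_fps K (eexp (- 1 / z)) = eval_fps K (eexp z)" .
  qed
  moreover have "part_fps \<noteq> 0" using part_mult_euler by auto
  ultimately have "A1 = 0" by (simp add: K_def)
  then show ?thesis using A1 by simp
qed

lemma eis_nth_0 [simp]: "fps_nth (eis r) 0 = 1"
  by (simp add: eis_def eisenstein_fps_def)

lemma fps_nth_times_delta_power:
  "fps_nth (A * delta_fps ^ j) i = (if i < j then 0 else fps_nth (A * euler_fps ^ (24 * j)) (i - j))"
proof -
  have "A * delta_fps ^ j = fps_X ^ j * (A * euler_fps ^ (24 * j))"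
    by (simp add: delta_fps_def power_mult_distrib power_mult[symmetric] mult_ac)
  then show ?thesis by (simp only: fps_X_power_mult_nth)
qed

text \<open>For \<open>r = 7\<close> one vanishing coefficient is missing. If \<open>c\<close> is that coefficient, comparing with
  \<open>E\<^sub>6\<close> and \<open>E\<^sub>8\<close> gives \<open>A E\<^sub>4 = c E\<^sub>6 \<Delta>\<close> and \<open>A E\<^sub>6 = c E\<^sub>8 \<Delta>\<close> up to powers of \<open>\<Delta>\<close>, whereas
  \<open>E\<^sub>6\<^sup>2 \<noteq> E\<^sub>4 E\<^sub>8\<close>.\<close>

lemma modform_vanish_special:
  assumes r: "r \<in> {2,3,4,5,7}" and A: "modform (2 * r + 12 * N) A" and z: "\<And>i. i \<le> N \<Longrightarrow> fps_nth A i = 0"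
  shows "A = 0"
proof (cases "r = 7")
  case False
  \<comment> \<open>Here 2 r <= 10, so the weight is below 12 (N + 1), and the N + 1 vanishing
    coefficients are enough.\<close>
  show ?thesis by (rule modform_vanish[OF A, of "Suc N"]) (use r False z in auto)
next
  case True
  define c where "c = fps_nth A (Suc N)"
  obtain A1 where A1: "A = fps_X ^ Suc N * A1"
    using fps_X_power_factor[of "Suc N" A] z by (metis less_Suc_eq_le)
  have c: "c = fps_nth A1 0" unfolding c_def A1 fps_X_power_mult_nth by simp
  have coeff: "fps_nth (A * E - fps_const c * (E' * delta_fps ^ Suc N)) i = 0"
    if "i < Suc (Suc N)" "fps_nth E 0 = 1" "fps_nth E' 0 = 1" for E E' i
  proof -
    have "fps_nth (A * E) i = (if i < Suc N then 0 else fps_nth (A1 * E) (i - Suc N))"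
      unfolding A1 mult.assoc by (rule fps_X_power_mult_nth)
    moreover have "i < Suc N \<or> i = Suc N" using that by auto
    ultimately show ?thesis using that c by (auto simp: fps_nth_times_delta_power fps_power_zeroth simp del: power_Suc)
  qed
  have 1: "A * eis 2 - fps_const c * (eis 3 * delta_fps ^ Suc N) = 0"
  proof (rule modform_vanish[of "18 + 12 * N" _ "Suc (Suc N)"])
    have "modform ((2 * r + 12 * N) + 2 * 2) (A * eis 2)" by (intro modform_mult A modform_eis) simp
    moreover have "modform (2 * 3 + Suc N * 12) (eis 3 * delta_fps ^ Suc N)"
      by (intro modform_mult modform_power modform_delta modform_eis) simp
    moreover have "2 * r + 12 * N + 2 * 2 = 18 + 12 * N" "2 * 3 + Suc N * 12 = 18 + 12 * N" using True by simp_all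
    ultimately show "modform (18 + 12 * N) (A * eis 2 - fps_const c * (eis 3 * delta_fps ^ Suc N))"
      by (metis modform_diff modform_cmult)
  qed (use coeff in auto)
  have 2: "A * eis 3 - fps_const c * (eis 4 * delta_fps ^ Suc N) = 0"
  proof (rule modform_vanish[of "20 + 12 * N" _ "Suc (Suc N)"])
    have "modform ((2 * r + 12 * N) + 2 * 3) (A * eis 3)" by (intro modform_mult A modform_eis) simp
    moreover have "modform (2 * 4 + Suc N * 12) (eis 4 * delta_fps ^ Suc N)"
      by (intro modform_mult modform_power modform_delta modform_eis) simp
    moreover have "2 * r + 12 * N + 2 * 3 = 20 + 12 * N" "2 * 4 + Suc N * 12 = 20 + 12 * N" using True by simp_all
    ultimately show "modform (20 + 12 * N) (A * eis 3 - fps_const c * (eis 4 * delta_fps ^ Suc N))"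
      by (metis modform_diff modform_cmult)
  qed (use coeff in auto)
  have nzd: "delta_fps ^ Suc N \<noteq> 0"
  proof
    assume "delta_fps ^ Suc N = 0"
    then have "delta_fps = 0" by (auto simp del: power_Suc)
    moreover have "euler_fps \<noteq> 0" using part_mult_euler by auto
    ultimately show False by (simp add: delta_fps_def)
  qed
  have "fps_const c * (eis 3 * eis 3 - eis 4 * eis 2) * delta_fps ^ Suc N =
     eis 3 * (fps_const c * (eis 3 * delta_fps ^ Suc N)) - eis 2 * (fps_const c * (eis 4 * delta_fps ^ Suc N))"
    by (simp add: algebra_simps)
  also have "\<dots> = eis 3 * (A * eis 2) - eis 2 * (A * eis 3)" using 1 2 by simp
  also have "\<dots> = 0" by (simp add: mult_ac)
  finally have "fps_const c * (eis 3 * eis 3 - eis 4 * eis 2) = 0" using nzd by (metis mult_eq_0_iff)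
  \<comment> \<open>The coefficient is 2 (-504) - (480 + 240) = -1728.\<close>
  moreover have "fps_nth (eis 3 * eis 3 - eis 4 * eis 2) 1 \<noteq> 0"
  proof -
    have "sigma k 1 = 1" for k by (simp add: sigma_def)
    then have "fps_nth (eis 3) 1 = -504" "fps_nth (eis 4) 1 = 480" "fps_nth (eis 2) 1 = 240"
      by (simp_all add: eis_explicit sigma_fps_def)
    then show ?thesis by (simp add: fps_mult_nth_1)
  qed
  then have "eis 3 * eis 3 - eis 4 * eis 2 \<noteq> 0" by (metis fps_zero_nth)
  ultimately have "c = 0" by simp
  then have "A * eis 2 = 0" using 1 by simp
  moreover have "eis 2 \<noteq> 0" by (metis eis_nth_0 fps_zero_nth zero_neq_one)
  ultimately show ?thesis by simp
qed

section \<open>Integral coefficients\<close>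

definition fps_ints :: "complex fps \<Rightarrow> bool" where
  "fps_ints A \<longleftrightarrow> (\<forall>n. fps_nth A n \<in> \<int>)"

lemma fps_ints_mult: "fps_ints A \<Longrightarrow> fps_ints B \<Longrightarrow> fps_ints (A * B)"
  by (auto simp: fps_ints_def fps_mult_nth intro!: Ints_sum Ints_mult)

lemma fps_ints_add: "fps_ints A \<Longrightarrow> fps_ints B \<Longrightarrow> fps_ints (A + B)"
  by (auto simp: fps_ints_def)

lemma fps_ints_diff: "fps_ints A \<Longrightarrow> fps_ints B \<Longrightarrow> fps_ints (A - B)"
  by (auto simp: fps_ints_def)

lemma fps_ints_const: "c \<in> \<int> \<Longrightarrow> fps_ints (fps_const c)"
  by (auto simp: fps_ints_def)

lemma fps_ints_power: "fps_ints A \<Longrightarrow> fps_ints (A ^ n)"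
  by (induction n) (simp_all add: fps_ints_mult, simp add: fps_ints_def)

lemma fps_ints_euler: "fps_ints euler_fps"
  by (auto simp: fps_ints_def euler_fps_nth)

lemma fps_ints_delta: "fps_ints delta_fps"
  unfolding delta_fps_def by (intro fps_ints_mult fps_ints_power fps_ints_euler) (simp add: fps_ints_def fps_X_nth)

lemma fps_ints_inverse:
  assumes A: "fps_ints A" "fps_nth A 0 = 1"
  shows "fps_ints (inverse A)"
  unfolding fps_ints_def
proof
  fix n show "fps_nth (inverse A) n \<in> \<int>"
  proof (induction n rule: less_induct)
    case (less n)
    show ?case
    proof (cases "n = 0")
      case False
      have "(\<Sum>i=0..n. fps_nth A i * fps_nth (inverse A) (n - i)) = 0"
        using False inverse_mult_eq_1'[of A] A by (metis fps_mult_nth fps_one_nth zero_neq_one)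
      then have "fps_nth (inverse A) n = - (\<Sum>i=1..n. fps_nth A i * fps_nth (inverse A) (n - i))"
        using A by (simp add: sum.atLeast_Suc_atMost add_eq_0_iff)
      also have "\<dots> \<in> \<int>" using A less by (auto simp: fps_ints_def intro!: Ints_minus Ints_sum Ints_mult)
      finally show ?thesis .
    qed (use A in simp)
  qed
qed

lemma fps_ints_part: "fps_ints part_fps"
  unfolding part_fps_def by (intro fps_ints_inverse fps_ints_euler) simp

lemma fps_ints_eis: "r \<in> {2,3,4,5,7} \<Longrightarrow> fps_ints (eis r)"
proof -
  have s: "fps_ints (sigma_fps k)" for k by (auto simp: fps_ints_def sigma_fps_def)
  have 1: "fps_ints 1" by (simp add: fps_ints_def)
  show "r \<in> {2,3,4,5,7} \<Longrightarrow> fps_ints (eis r)"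
    by (auto simp: eis_explicit intro!: fps_ints_add fps_ints_diff fps_ints_mult fps_ints_const s 1)
qed

text \<open>A triangular integral basis: the form \<open>E * delta_fps ^ j\<close> starts with q^j
  and has integral coefficients, so subtracting integral multiples clears one coefficient after
  another. When the first N + 1 are gone, the remainder is zero by
  \<open>modform_vanish_special\<close>.\<close>

lemma modform_integral:
  assumes r: "r \<in> {2,3,4,5,7}" and A: "modform (2 * r + 12 * N) A" and i: "\<And>i. i \<le> N \<Longrightarrow> fps_nth A i \<in> \<int>"
  shows "fps_ints A"
proof -
  have "fps_ints A" if "j \<le> Suc N" "modform (2 * r + 12 * N) A" "\<And>i. i \<le> N \<Longrightarrow> fps_nth A i \<in> \<int>" "\<And>i. i < j \<Longrightarrow> fps_nth A i = 0" for j A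
    using that
  proof (induction "Suc N - j" arbitrary: j A)
    case 0
    then have "A = 0" by (intro modform_vanish_special[OF r]) auto
    then show ?case by (simp add: fps_ints_def)
  next
    case (Suc m)
    \<comment> \<open>The cube of E_4 has weight 12 like the discriminant, so
      \<open>E * delta_fps ^ j\<close> has weight 2 r + 12 N for every j <= N.\<close>
    define E where "E = eis r * eis 2 ^ (3 * (N - j))"
    define B where "B = fps_const (fps_nth A j) * (E * delta_fps ^ j)"
    have j: "j \<le> N" using Suc by simp
    have E0: "fps_nth E 0 = 1" by (simp add: E_def fps_power_zeroth)
    have "modform ((2 * r + 3 * (N - j) * (2 * 2)) + j * 12) (E * delta_fps ^ j)"
      unfolding E_def by (intro modform_mult modform_power modform_delta modform_eis r) simp
    moreover have "(2 * r + 3 * (N - j) * (2 * 2)) + j * 12 = 2 * r + 12 * N" using j by simp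
    ultimately have mB: "modform (2 * r + 12 * N) B" unfolding B_def by (intro modform_cmult) metis
    have iB: "fps_ints B"
      unfolding B_def E_def using j Suc.prems(3) by (intro fps_ints_mult fps_ints_const fps_ints_power fps_ints_delta fps_ints_eis r) auto
    have "fps_ints (A - B)"
    proof (rule Suc.hyps(1)[of "Suc j"])
      show "modform (2 * r + 12 * N) (A - B)" by (intro modform_diff Suc.prems mB)
      show "fps_nth (A - B) i \<in> \<int>" if "i \<le> N" for i using Suc.prems(3)[OF that] iB by (auto simp: fps_ints_def)
      fix i assume "i < Suc j"
      then have "i < j \<or> i = j" by auto
      then show "fps_nth (A - B) i = 0"
        unfolding B_def using Suc.prems(4) E0 by (auto simp: fps_nth_times_delta_power fps_power_zeroth)
    qed (use Suc j in auto)
    then have "fps_ints ((A - B) + B)" by (intro fps_ints_add iB)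
    then show ?case by simp
  qed
  from this[of 0 A] show ?thesis using A i by simp
qed

section \<open>From the two generators to the full modular group\<close>

lemma shift_by_int:
  assumes "\<And>z. Im z > 0 \<Longrightarrow> f (z + 1) = (f z :: 'a)" and z: "Im z > 0"
  shows "f (z + of_int n) = f z"
proof -
  have *: "f (z + of_nat k) = f z" if "Im z > 0" for z k
  proof (induction k)
    case (Suc k)
    have "f (z + of_nat (Suc k)) = f ((z + of_nat k) + 1)" by (simp add: add_ac)
    also have "\<dots> = f (z + of_nat k)" by (rule assms(1)) (use that in simp)
    finally show ?case using Suc by simp
  qed simp
  show ?thesis
  proof (cases "n \<ge> 0")
    case True then show ?thesis using *[OF z, of "nat n"] by simp
  next
    case False
    have "f ((z + of_int n) + of_nat (nat (-n))) = f (z + of_int n)" by (rule *) (use z in simp)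
    then show ?thesis using False by simp
  qed
qed

text \<open>Euclid's algorithm on the lower row (c, d). With d = c q + d', the translation z' = z +
  q replaces d by d', and the inversion then makes the lower row (d', -c), whose first entry is
  smaller than c in absolute value. Since k is even, the sign of the matrix has no effect.\<close>

lemma modular_generation:
  fixes f :: "complex \<Rightarrow> complex" and a b c d :: int
  assumes T: "\<And>z. Im z > 0 \<Longrightarrow> f (z + 1) = f z" and S: "\<And>z. Im z > 0 \<Longrightarrow> f (- 1 / z) = z ^ k * f z"
    and k: "even k" and det: "a * d - b * c = 1" and z: "Im z > 0"
  shows "f ((of_int a * z + of_int b) / (of_int c * z + of_int d)) = (of_int c * z + of_int d) ^ k * f z"
  using det z
proof (induction "nat \<bar>c\<bar>" arbitrary: a b c d z rule: less_induct)
  case less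
  show ?case
  proof (cases "c = 0")
    case True
    then have "a * d = 1" using less.prems by simp
    then have ad: "(a = 1 \<and> d = 1) \<or> (a = -1 \<and> d = -1)" by (simp add: zmult_eq_1_iff)
    then have "(of_int a * z + of_int b) / (of_int c * z + of_int d) = z + of_int (d * b)" using True by auto
    moreover have "(of_int d :: complex) ^ k = 1" using ad k by auto
    ultimately show ?thesis using True shift_by_int[of f, OF T less.prems(2), of "d * b"] by simp
  next
    case False
    define q where "q = d div c"
    define d' where "d' = d mod c"
    define b' where "b' = b - a * q"
    define z' where "z' = z + of_int q"
    have d: "d = c * q + d'" by (simp add: q_def d'_def)
    have small: "nat \<bar>d'\<bar> < nat \<bar>c\<bar>" using False abs_mod_less[of c d] by (simp add: d'_def)
    have z': "Im z' > 0" using less.prems by (simp add: z'_def)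
    have z'0: "z' \<noteq> 0" using z' by auto
    have det': "b' * (- c) - (- a) * d' = 1" using less.prems(1) by (simp add: b'_def d algebra_simps)
    have den: "of_int c * z' + of_int d' = of_int c * z + of_int d" by (simp add: z'_def d algebra_simps)
    have num: "of_int a * z' + of_int b' = of_int a * z + of_int b" by (simp add: z'_def b'_def algebra_simps)
    have e1: "of_int b' * (- 1 / z') + of_int (- a) = - ((of_int a * z' + of_int b') / z')" using z'0 by (simp add: field_simps)
    have e2: "of_int d' * (- 1 / z') + of_int (- c) = - ((of_int c * z' + of_int d') / z')" using z'0 by (simp add: field_simps)
    have e: "(of_int b' * (- 1 / z') + of_int (- a)) / (of_int d' * (- 1 / z') + of_int (- c)) = (of_int a * z' + of_int b') / (of_int c * z' + of_int d')"
      unfolding e1 e2 minus_divide_divide using z'0 by simp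
    have "f ((of_int b' * (- 1 / z') + of_int (- a)) / (of_int d' * (- 1 / z') + of_int (- c))) = (of_int d' * (- 1 / z') + of_int (- c)) ^ k * f (- 1 / z')"
      by (rule less.hyps[OF small det' Im_neg_inverse[OF z']])
    then have "f ((of_int a * z' + of_int b') / (of_int c * z' + of_int d')) = ((of_int c * z' + of_int d') / z') ^ k * (z' ^ k * f z')"
      unfolding e S[OF z'] unfolding e2 power_minus_even[OF k] .
    also have "\<dots> = (of_int c * z' + of_int d') ^ k * f z'" using z'0 by (simp add: power_divide)
    also have "f z' = f z" unfolding z'_def by (rule shift_by_int[of f, OF T less.prems(2)])
    finally show ?thesis unfolding num den .
  qed
qed

section \<open>Weakly holomorphic quotients by eta\<close>

definition qser :: "(int \<Rightarrow> complex) \<Rightarrow> complex \<Rightarrow> complex" where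
  "qser a z = infsum (\<lambda>n. a n * eexp (of_int n * z / 24)) UNIV"

text \<open>The series \<open>qser a\<close> times \<open>\<eta>\<close> is weakly holomorphic of weight \<open>k\<close>: the congruence makes the product
  a series in integral powers of \<open>q\<close>.\<close>

definition whol :: "nat \<Rightarrow> (int \<Rightarrow> complex) \<Rightarrow> bool" where
  "whol k a \<longleftrightarrow> (\<forall>n. a n \<noteq> 0 \<longrightarrow> 24 dvd n + 1) \<and> (\<exists>M::nat. \<forall>n < - int M. a n = 0) \<and>
     (\<forall>z. Im z > 0 \<longrightarrow> (\<lambda>n. a n * eexp (of_int n * z / 24)) summable_on UNIV) \<and>
     (\<forall>z. Im z > 0 \<longrightarrow> qser a (- 1 / z) * eta (- 1 / z) = z ^ k * (qser a z * eta z))"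

lemma qser_index_image:
  assumes supp: "\<And>n. a n \<noteq> 0 \<Longrightarrow> 24 dvd n + 1" and bound: "\<And>n. n < - (24 * int N + 1) \<Longrightarrow> a n = (0::complex)"
    and n: "n \<notin> range (\<lambda>i. 24 * int i - (24 * int N + 1))"
  shows "a n = 0"
proof (rule ccontr)
  assume "a n \<noteq> 0"
  then obtain t where t: "n + 1 = 24 * t" using supp by blast
  have "n \<ge> - (24 * int N + 1)" using bound \<open>a n \<noteq> 0\<close> by (meson not_le)
  then have "t + int N \<ge> 0" using t by simp
  then have "n = 24 * int (nat (t + int N)) - (24 * int N + 1)" using t by simp
  then show False using n by blast
qed

lemma qser_term_index:
  "eexp (of_int (24 * int i - (24 * int N + 1)) * z / 24) = eexp (- of_nat (24 * N + 1) * z / 24) * eexp z ^ i"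
  unfolding eexp_power eexp_add[symmetric] by (rule arg_cong[of _ _ eexp]) (simp add: field_simps)

lemma qser_has_sum_iff:
  assumes supp: "\<And>n. a n \<noteq> 0 \<Longrightarrow> 24 dvd n + 1" and bound: "\<And>n. n < - (24 * int N + 1) \<Longrightarrow> a n = (0::complex)"
  shows "((\<lambda>n. a n * eexp (of_int n * z / 24)) has_sum S) UNIV \<longleftrightarrow>
     ((\<lambda>i. eexp (- of_nat (24 * N + 1) * z / 24) * (a (24 * int i - (24 * int N + 1)) * eexp z ^ i)) has_sum S) UNIV"
proof -
  let ?f = "\<lambda>n. a n * eexp (of_int n * z / 24)" and ?h = "\<lambda>i. 24 * int i - (24 * int N + 1)"
  have "(?f has_sum S) UNIV \<longleftrightarrow> (?f has_sum S) (range ?h)"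
    by (rule has_sum_cong_neutral) (use qser_index_image[of a N, OF supp bound] in auto)
  also have "\<dots> \<longleftrightarrow> (?f \<circ> ?h has_sum S) UNIV"
    by (rule has_sum_reindex) (auto simp: inj_def)
  also have "?f \<circ> ?h = (\<lambda>i. eexp (- of_nat (24 * N + 1) * z / 24) * (a (24 * int i - (24 * int N + 1)) * eexp z ^ i))"
    unfolding o_def qser_term_index by (simp only: mult_ac)
  finally show ?thesis .
qed

lemma qser_fps:
  assumes supp: "\<And>n. a n \<noteq> 0 \<Longrightarrow> 24 dvd n + 1" and bound: "\<And>n. n < - (24 * int N + 1) \<Longrightarrow> a n = (0::complex)"
    and summ: "\<And>z. Im z > 0 \<Longrightarrow> (\<lambda>n. a n * eexp (of_int n * z / 24)) summable_on UNIV"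
  defines "C \<equiv> Abs_fps (\<lambda>i. a (24 * int i - (24 * int N + 1)))"
  shows "fps_conv_radius C \<ge> 1"
    and "Im z > 0 \<Longrightarrow> qser a z = eexp (- of_nat (24 * N + 1) * z / 24) * eval_fps C (eexp z)"
proof -
  show rad: "fps_conv_radius C \<ge> 1"
  proof (rule fps_conv_radius_ge_1I)
    fix x :: real assume x: "0 < x" "x < 1"
    \<comment> \<open>The point of the imaginary axis with \<open>eexp z = of_real x\<close>;
      summability there gives convergence at radius x.\<close>
    define z where "z = \<i> * of_real (- ln x / (2 * pi))"
    have z: "Im z > 0" using x by (simp add: z_def ln_less_zero divide_neg_pos)
    have "2 * of_real pi * \<i> * z = of_real (ln x)" by (simp add: z_def)
    then have ez: "eexp z = of_real x" unfolding eexp_def using x by (simp add: exp_of_real)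
    from summ[OF z] obtain S where "((\<lambda>n. a n * eexp (of_int n * z / 24)) has_sum S) UNIV" by (auto simp: summable_on_def)
    then have "((\<lambda>i. eexp (- of_nat (24 * N + 1) * z / 24) * (a (24 * int i - (24 * int N + 1)) * eexp z ^ i)) has_sum S) UNIV"
      using qser_has_sum_iff[of a N z S] supp bound by blast
    then have "(\<lambda>i. inverse (eexp (- of_nat (24 * N + 1) * z / 24)) * (eexp (- of_nat (24 * N + 1) * z / 24) * (a (24 * int i - (24 * int N + 1)) * eexp z ^ i))) summable_on UNIV"
      by (intro summable_on_cmult_right has_sum_imp_summable)
    then have "(\<lambda>i. fps_nth C i * eexp z ^ i) summable_on UNIV" by (simp add: C_def mult.assoc[symmetric])
    then have "(\<lambda>i. norm (fps_nth C i * eexp z ^ i)) summable_on UNIV"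
      by (simp only: summable_on_iff_abs_summable_on_complex)
    then have "summable (\<lambda>i. norm (fps_nth C i * eexp z ^ i))" by (rule summable_on_imp_summable)
    then show "summable (\<lambda>n. norm (fps_nth C n) * x ^ n)" using x by (simp add: ez norm_mult norm_power)
  qed
  assume z: "Im z > 0"
  have "((\<lambda>i. fps_nth C i * eexp z ^ i) has_sum eval_fps C (eexp z)) UNIV"
    by (rule eval_fps_has_sum[OF rad norm_eexp_less_1[OF z]])
  then have "((\<lambda>i. eexp (- of_nat (24 * N + 1) * z / 24) * (a (24 * int i - (24 * int N + 1)) * eexp z ^ i)) has_sum
     (eexp (- of_nat (24 * N + 1) * z / 24) * eval_fps C (eexp z))) UNIV"
    by (intro has_sum_cmult_right) (simp add: C_def)
  then have "((\<lambda>n. a n * eexp (of_int n * z / 24)) has_sum (eexp (- of_nat (24 * N + 1) * z / 24) * eval_fps C (eexp z))) UNIV"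
    using qser_has_sum_iff[of a N z] supp bound by blast
  then show "qser a z = eexp (- of_nat (24 * N + 1) * z / 24) * eval_fps C (eexp z)"
    unfolding qser_def by (rule infsumI)
qed

lemma qser_holomorphic:
  assumes supp: "\<And>n. a n \<noteq> 0 \<Longrightarrow> 24 dvd n + 1" and bound: "\<And>n. n < - int M \<Longrightarrow> a n = (0::complex)"
    and summ: "\<And>z. Im z > 0 \<Longrightarrow> (\<lambda>n. a n * eexp (of_int n * z / 24)) summable_on UNIV"
  shows "qser a holomorphic_on upper"
proof -
  have bound': "a n = 0" if "n < - (24 * int M + 1)" for n using that by (intro bound) simp
  note C = qser_fps[of a M, OF supp bound' summ]
  have "(\<lambda>z. eexp (- of_nat (24 * M + 1) * z / 24) * eval_fps (Abs_fps (\<lambda>i. a (24 * int i - (24 * int M + 1)))) (eexp z)) holomorphic_on upper"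
    by (intro holomorphic_intros eval_eexp_holomorphic C(1)) auto
  then show ?thesis by (rule holomorphic_transform) (use C(2) in auto)
qed

lemma eta_power_24:
  "Im z > 0 \<Longrightarrow> eta (- 1 / z) ^ 24 = z ^ 12 * eta z ^ 24"
  using modform_delta eval_delta[of z] eval_delta[OF Im_neg_inverse, of z] unfolding modform_def by simp

text \<open>Multiplication by eta^(24 N + 1) clears the pole and gives a holomorphic form
  \<open>B\<close> of weight 2 r + 12 N. Its first N + 1 coefficients involve a only at the indices
  24 i - (24 N + 1) with i <= N, all negative, so the principal part decides integrality of
  \<open>B\<close>. Powers of the partition series lead back from \<open>B\<close> to a.\<close>

lemma whol_integral:
  assumes r: "r \<in> {2,3,4,5,7}" and a: "whol (2 * r) a" and int: "\<And>n. n < 0 \<Longrightarrow> a n \<in> \<int>"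
  shows "a n \<in> \<int>"
proof -
  from a have supp: "\<And>n. a n \<noteq> 0 \<Longrightarrow> 24 dvd n + 1" and summ: "\<And>z. Im z > 0 \<Longrightarrow> (\<lambda>n. a n * eexp (of_int n * z / 24)) summable_on UNIV"
    and S: "\<And>z. Im z > 0 \<Longrightarrow> qser a (- 1 / z) * eta (- 1 / z) = z ^ (2 * r) * (qser a z * eta z)"
    unfolding whol_def by blast+
  obtain N :: nat where N: "\<And>n. n < - int N \<Longrightarrow> a n = 0" using a unfolding whol_def by blast
  have bound: "a n = 0" if "n < - (24 * int N + 1)" for n using that by (intro N) simp
  define C where "C = Abs_fps (\<lambda>i. a (24 * int i - (24 * int N + 1)))"
  have rad: "fps_conv_radius C \<ge> 1" and qs: "\<And>z. Im z > 0 \<Longrightarrow> qser a z = eexp (- of_nat (24 * N + 1) * z / 24) * eval_fps C (eexp z)"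
    unfolding C_def using qser_fps[of a N, OF supp bound summ] by blast+
  define B where "B = C * euler_fps ^ (24 * N + 1)"
  have radB: "fps_conv_radius B \<ge> 1"
    unfolding B_def by (intro conv_radius_mult_ge_1 conv_radius_power_ge_1 rad euler_fps_conv_radius)
  have evB: "eval_fps B (eexp z) = qser a z * eta z * (eta z ^ 24) ^ N" if z: "Im z > 0" for z
  proof -
    have "eexp (- of_nat (24 * N + 1) * z / 24) * eexp (z / 24) ^ (24 * N + 1) = 1"
      unfolding eexp_power eexp_add[symmetric] by (simp add: field_simps)
    then have "qser a z * eta z ^ (24 * N + 1) = eval_fps C (eexp z) * eval_fps euler_fps (eexp z) ^ (24 * N + 1)"
      unfolding qs[OF z] eta_def power_mult_distrib by (simp add: mult_ac)
    also have "\<dots> = eval_fps B (eexp z)"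
      unfolding B_def using z rad euler_fps_conv_radius by (simp add: eval_upper_mult eval_upper_power conv_radius_power_ge_1 del: power_Suc)
    finally show ?thesis unfolding power_add power_mult power_one_right by (simp only: mult_ac)
  qed
  have modB: "modform (2 * r + 12 * N) B"
    unfolding modform_def
  proof (intro conjI allI impI radB)
    fix z assume z: "Im z > 0"
    have pz: "z ^ (2 * r + 12 * N) = z ^ (2 * r) * (z ^ 12) ^ N" unfolding power_add power_mult[of z 12 N] ..
    show "eval_fps B (eexp (- 1 / z)) = z ^ (2 * r + 12 * N) * eval_fps B (eexp z)"
      unfolding evB[OF z] evB[OF Im_neg_inverse[OF z]] S[OF z] eta_power_24[OF z] pz
      by (simp only: power_mult_distrib mult_ac)
  qed
  have "fps_nth B i \<in> \<int>" if "i \<le> N" for i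
    unfolding B_def fps_mult_nth
  proof (intro Ints_sum Ints_mult)
    fix j assume "j \<in> {0..i}"
    then show "fps_nth C j \<in> \<int>" unfolding C_def using that by (simp, intro int) simp
    show "fps_nth (euler_fps ^ (24 * N + 1)) (i - j) \<in> \<int>"
      using fps_ints_power[OF fps_ints_euler] unfolding fps_ints_def by blast
  qed
  then have "fps_ints B" by (rule modform_integral[OF r modB])
  moreover have "C = B * part_fps ^ (24 * N + 1)"
    unfolding B_def mult.assoc power_mult_distrib[symmetric] part_mult_euler by simp
  ultimately have C: "fps_ints C" using fps_ints_mult fps_ints_power[OF fps_ints_part] by metis
  show ?thesis
  proof (cases "n \<in> range (\<lambda>i. 24 * int i - (24 * int N + 1))")
    case True
    then obtain i where "n = 24 * int i - (24 * int N + 1)" by blast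
    then have "a n = fps_nth C i" by (simp add: C_def)
    then show ?thesis using C by (simp add: fps_ints_def)
  next
    case False
    then have "a n = 0" using qser_index_image[of a N n] supp bound by blast
    then show ?thesis by simp
  qed
qed

lemma whol_linear:
  assumes a: "whol k a" and b: "whol k b"
  shows "whol k (\<lambda>n. c * a n + d * b n)"
  unfolding whol_def
proof (intro conjI allI impI)
  fix n assume "c * a n + d * b n \<noteq> 0"
  then show "24 dvd n + 1" using a b unfolding whol_def by (metis add.right_neutral mult_zero_right)
next
  obtain M M' :: nat where "\<And>n. n < - int M \<Longrightarrow> a n = 0" "\<And>n. n < - int M' \<Longrightarrow> b n = 0"
    using a b unfolding whol_def by blast
  then show "\<exists>M::nat. \<forall>n < - int M. c * a n + d * b n = 0" by (intro exI[of _ "max M M'"]) auto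
next
  have sa: "(\<lambda>n. a n * eexp (of_int n * z / 24)) summable_on UNIV" and sb: "(\<lambda>n. b n * eexp (of_int n * z / 24)) summable_on UNIV"
    if "Im z > 0" for z using a b that unfolding whol_def by blast+
  have hs: "((\<lambda>n. (c * a n + d * b n) * eexp (of_int n * z / 24)) has_sum (c * qser a z + d * qser b z)) UNIV" if z: "Im z > 0" for z
  proof -
    have "((\<lambda>n. c * (a n * eexp (of_int n * z / 24)) + d * (b n * eexp (of_int n * z / 24))) has_sum (c * qser a z + d * qser b z)) UNIV"
      unfolding qser_def by (intro has_sum_add has_sum_cmult_right has_sum_infsum sa sb z)
    then show ?thesis by (simp add: algebra_simps)
  qed
  fix z assume z: "Im z > 0"
  show "(\<lambda>n. (c * a n + d * b n) * eexp (of_int n * z / 24)) summable_on UNIV" using hs[OF z] by (rule has_sum_imp_summable)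
  have q: "qser (\<lambda>n. c * a n + d * b n) z = c * qser a z + d * qser b z" if "Im z > 0" for z
    unfolding qser_def[of "\<lambda>n. c * a n + d * b n"] using hs[OF that] by (rule infsumI)
  have "qser a (- 1 / z) * eta (- 1 / z) = z ^ k * (qser a z * eta z)" "qser b (- 1 / z) * eta (- 1 / z) = z ^ k * (qser b z * eta z)"
    using a b z unfolding whol_def by blast+
  then show "qser (\<lambda>n. c * a n + d * b n) (- 1 / z) * eta (- 1 / z) = z ^ k * (qser (\<lambda>n. c * a n + d * b n) z * eta z)"
    unfolding q[OF z] q[OF Im_neg_inverse[OF z]] by (simp add: ring_distribs mult.assoc mult.left_commute)
qed

section \<open>The form E_2r / eta, and transformations along vertical lines through rational
  points\<close>

definition e_series :: "nat \<Rightarrow> int \<Rightarrow> complex" where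
  "e_series r n = of_rat (e_coeff r ((of_int n + 1) / 24))"

lemma e_series_supp: "e_series r n \<noteq> 0 \<Longrightarrow> 24 dvd n + 1 \<and> n \<ge> -1"
proof -
  assume "e_series r n \<noteq> 0"
  then have "(of_int n + 1) / 24 \<in> (\<nat> :: rat set)" by (auto simp: e_series_def e_coeff_def split: if_splits)
  then obtain i where "(of_int n + 1) / 24 = (of_nat i :: rat)" by (auto elim: Nats_cases)
  then have "(of_int (n + 1) :: rat) = of_int (24 * int i)" by (simp add: field_simps)
  then have "n + 1 = 24 * int i" by (simp only: of_int_eq_iff)
  then show ?thesis by auto
qed

lemma e_series_fps: "Abs_fps (\<lambda>i. e_series r (24 * int i - 1)) * euler_fps = eis r"
proof -
  have e: "e_series r (24 * int i - 1) = of_rat (e_coeff r (of_nat i))" for i by (simp add: e_series_def)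
  show ?thesis
  proof (rule fps_ext)
    fix n
    have "fps_nth (Abs_fps (\<lambda>n. e_coeff r (of_nat n)) * qpoch_inf) n = fps_nth (eisenstein_fps r) n"
      by (simp only: e_coeff_gf)
    then have "of_rat (\<Sum>i=0..n. e_coeff r (of_nat i) * fps_nth qpoch_inf (n - i)) = (of_rat (fps_nth (eisenstein_fps r) n) :: complex)"
      by (simp add: fps_mult_nth)
    then show "fps_nth (Abs_fps (\<lambda>i. e_series r (24 * int i - 1)) * euler_fps) n = fps_nth (eis r) n"
      by (simp add: fps_mult_nth euler_fps_def eis_def e of_rat_sum of_rat_mult)
  qed
qed

lemma e_series_whol:
  assumes r: "r \<in> {2,3,4,5,7}"
  shows "whol (2 * r) (e_series r)"
proof -
  define C where "C = Abs_fps (\<lambda>i. e_series r (24 * int i - 1))"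
  have "C = C * euler_fps * part_fps" by (simp only: mult.assoc part_mult_euler mult_1_right)
  also have "C * euler_fps = eis r" unfolding C_def by (rule e_series_fps)
  finally have "C = eis r * part_fps" .
  then have rad: "fps_conv_radius C \<ge> 1" by (simp add: conv_radius_mult_ge_1 eis_conv_radius part_conv_radius)
  have hs: "((\<lambda>n. e_series r n * eexp (of_int n * z / 24)) has_sum (eexp (- z / 24) * eval_fps C (eexp z))) UNIV" if z: "Im z > 0" for z
  proof -
    have "((\<lambda>i. fps_nth C i * eexp z ^ i) has_sum eval_fps C (eexp z)) UNIV"
      by (rule eval_fps_has_sum[OF rad norm_eexp_less_1[OF z]])
    then have "((\<lambda>i. eexp (- of_nat (24 * 0 + 1) * z / 24) * (e_series r (24 * int i - (24 * int 0 + 1)) * eexp z ^ i)) has_sum (eexp (- z / 24) * eval_fps C (eexp z))) UNIV"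
      unfolding C_def by (simp add: has_sum_cmult_right)
    moreover have "e_series r n = 0" if "n < - (24 * int 0 + 1)" for n using e_series_supp[of r n] that by fastforce
    ultimately show ?thesis
      using qser_has_sum_iff[of "e_series r" 0 z] e_series_supp[of r] by blast
  qed
  have qs: "qser (e_series r) z * eta z = eval_fps (eis r) (eexp z)" if z: "Im z > 0" for z
  proof -
    have "qser (e_series r) z = eexp (- z / 24) * eval_fps C (eexp z)" unfolding qser_def using hs[OF z] by (rule infsumI)
    moreover have "eval_fps (eis r) (eexp z) = eval_fps C (eexp z) * eval_fps euler_fps (eexp z)"
      unfolding e_series_fps[symmetric] C_def[symmetric] by (rule eval_upper_mult[OF rad euler_fps_conv_radius z])
    moreover have "eexp (- z / 24) * eexp (z / 24) = 1" unfolding eexp_add[symmetric] by simp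
    ultimately show ?thesis by (simp add: eta_def mult_ac)
  qed
  show ?thesis unfolding whol_def
  proof (intro conjI allI impI)
    show "\<exists>M::nat. \<forall>n < - int M. e_series r n = 0" by (rule exI[of _ 1]) (use e_series_supp[of r] in force)
    fix z assume z: "Im z > 0"
    show "(\<lambda>n. e_series r n * eexp (of_int n * z / 24)) summable_on UNIV" using hs[OF z] by (rule has_sum_imp_summable)
    show "qser (e_series r) (- 1 / z) * eta (- 1 / z) = z ^ (2 * r) * (qser (e_series r) z * eta z)"
      unfolding qs[OF z] qs[OF Im_neg_inverse[OF z]] using modform_eis[OF r] z unfolding modform_def by blast
  qed (use e_series_supp in blast)
qed

lemma eta_plus_1: "Im z > 0 \<Longrightarrow> eta (z + 1) = eexp (1 / 24) * eta z"
proof -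
  have "eexp (z + 1) = eexp z" using eexp_int[of 1] by (simp add: eexp_add)
  then show ?thesis by (simp add: eta_def add_divide_distrib eexp_add mult_ac)
qed

text \<open>All indices are -1 modulo 24. The factor is inverse to the one in
  \<open>eta_plus_1\<close>, so the product with eta is invariant under translation.\<close>

lemma qser_plus_1:
  assumes supp: "\<And>n. a n \<noteq> 0 \<Longrightarrow> 24 dvd n + 1"
  shows "qser a (z + 1) = eexp (- 1 / 24) * qser a z"
proof -
  have "a n * eexp (of_int n * (z + 1) / 24) = eexp (- 1 / 24) * (a n * eexp (of_int n * z / 24))" for n
  proof (cases "a n = 0")
    case False
    then obtain t where "n + 1 = 24 * t" using supp by blast
    then have "n = 24 * t - 1" by simp
    then have "of_int n = 24 * of_int t - (1 :: complex)" by simp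
    then have "of_int n * (z + 1) / 24 = of_int n * z / 24 + (- 1 / 24) + of_int t" by (simp only:) (simp add: field_simps)
    then show ?thesis by (simp only: eexp_add eexp_int mult_1_right mult_1_left mult_ac)
  qed simp
  then show ?thesis unfolding qser_def by (simp only: infsum_cmult_right')
qed

text \<open>With c b = 576 \<alpha> \<alpha>' + 1, the matrix with rows (24 \<alpha>, -b) and (c,
  -24 \<alpha>') has determinant 1 and takes the right-hand argument \<tau> to the left-hand one,
  with c \<tau> - 24 \<alpha>' = i c v. \<open>modular_generation\<close> handles the product with
  eta, and \<open>eta_inversion\<close> then removes eta from both sides.\<close>

lemma whol_cusp_transform:
  assumes a: "whol (2 * r) a" and c: "c > 0" "coprime c 12" and \<alpha>: "int c dvd 576 * \<alpha> * \<alpha>' + 1" and v: "v > 0"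
  shows "qser a (of_int (24 * \<alpha>) / of_nat c + \<i> * of_real (1 / (real c ^ 2 * v))) * (of_real (sqrt v) * of_int (chi12 (int c)) * gauss_sum c \<alpha>) =
     (- 1) ^ r * (of_nat c * of_real v) ^ (2 * r) * qser a (of_int (24 * \<alpha>') / of_nat c + \<i> * of_real v)"
proof -
  define f where "f = (\<lambda>z. qser a z * eta z)"
  define \<tau> where "\<tau> = of_int (24 * \<alpha>') / of_nat c + \<i> * of_real v"
  define \<sigma> where "\<sigma> = of_int (24 * \<alpha>) / of_nat c + \<i> * of_real (1 / (real c ^ 2 * v))"
  have Re_frac: "Im (of_int k / of_nat c) = 0" for k by (metis Im_complex_of_real of_real_divide of_real_of_int_eq of_real_of_nat_eq)
  have im: "Im \<tau> > 0" unfolding \<tau>_def using v Re_frac[of "24 * \<alpha>'"] by auto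
  from \<alpha> obtain b where b: "576 * \<alpha> * \<alpha>' + 1 = int c * b" by blast
  from a have supp: "\<And>n. a n \<noteq> 0 \<Longrightarrow> 24 dvd n + 1" unfolding whol_def by blast
  have "f ((of_int (24 * \<alpha>) * \<tau> + of_int (- b)) / (of_int (int c) * \<tau> + of_int (- 24 * \<alpha>'))) = (of_int (int c) * \<tau> + of_int (- 24 * \<alpha>')) ^ (2 * r) * f \<tau>"
  proof (rule modular_generation[OF _ _ _ _ im])
    fix z assume z: "Im z > 0"
    have "eexp (- 1 / 24) * eexp (1 / 24) = 1" unfolding eexp_add[symmetric] by simp
    moreover have "qser a (z + 1) = eexp (- 1 / 24) * qser a z" using qser_plus_1[of a z] supp by blast
    then have "f (z + 1) = (eexp (- 1 / 24) * eexp (1 / 24)) * f z" unfolding f_def eta_plus_1[OF z] by (simp only: mult_ac)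
    ultimately show "f (z + 1) = f z" by simp
    show "f (- 1 / z) = z ^ (2 * r) * f z" using a z unfolding f_def whol_def by blast
  next
    show "24 * \<alpha> * (- 24 * \<alpha>') - (- b) * int c = 1" using b by (simp add: algebra_simps)
  qed simp
  moreover have "of_int (int c) * \<tau> + of_int (- 24 * \<alpha>') = \<i> * (of_nat c * of_real v)"
    using c by (simp add: \<tau>_def field_simps)
  moreover have "(of_int (24 * \<alpha>) * \<tau> + of_int (- b)) / (\<i> * (of_nat c * of_real v)) = \<sigma>"
  proof -
    have "(of_nat c :: complex) * of_int b = 576 * of_int \<alpha> * of_int \<alpha>' + 1"
      using arg_cong[OF b, of "of_int :: int \<Rightarrow> complex"] by simp
    then have "of_int b = (576 * of_int \<alpha> * of_int \<alpha>' + 1) / (of_nat c :: complex)" using c by (simp add: field_simps)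
    then show ?thesis unfolding \<tau>_def \<sigma>_def using c v by (simp add: field_simps power2_eq_square)
  qed
  ultimately have "f \<sigma> = (\<i> * (of_nat c * of_real v)) ^ (2 * r) * f \<tau>" by simp
  moreover have "(\<i> * (of_nat c * of_real v)) ^ (2 * r) = (- 1) ^ r * (of_nat c * of_real v) ^ (2 * r)"
    by (simp only: power_mult_distrib[of \<i>] power_mult[of \<i>] power2_i)
  moreover have "eta \<sigma> = of_real (sqrt v) * of_int (chi12 (int c)) * gauss_sum c \<alpha> * eta \<tau>"
    unfolding \<sigma>_def \<tau>_def by (rule eta_inversion[OF c \<alpha> v])
  ultimately have "(qser a \<sigma> * (of_real (sqrt v) * of_int (chi12 (int c)) * gauss_sum c \<alpha>)) * eta \<tau> = ((- 1) ^ r * (of_nat c * of_real v) ^ (2 * r) * qser a \<tau>) * eta \<tau>"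
    unfolding f_def by (simp only: mult_ac)
  then show ?thesis using eta_neq_0[OF im] unfolding \<sigma>_def \<tau>_def by simp
qed

section \<open>The Hecke operator\<close>

text \<open>\<nu> takes b to the negative inverse of 576 b modulo c. The congruence is symmetric in
  b and its image, so \<nu> is an involution of the units. Its pairs are the \<alpha>, \<alpha>' of
  \<open>whol_cusp_transform\<close>.\<close>

lemma sum_over_unit_inverses:
  fixes F :: "nat \<Rightarrow> 'a::comm_monoid_add"
  assumes c: "c > 1" and cop: "coprime c 576"
  shows "\<exists>\<nu>. (\<forall>b. b < c \<longrightarrow> coprime b c \<longrightarrow> \<nu> b < c \<and> coprime (\<nu> b) c \<and> int c dvd 576 * int b * int (\<nu> b) + 1) \<and>
    (\<Sum>b | b < c \<and> coprime b c. F (\<nu> b)) = (\<Sum>b | b < c \<and> coprime b c. F b)"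
proof -
  have ex: "\<exists>b' < c. int c dvd 576 * int b * int b' + 1" if "coprime b c" for b
  proof -
    have "coprime (576 * int b) (int c)" using that cop by (simp add: coprime_commute)
      (metis coprime_int_iff of_nat_numeral)
    then obtain x where x: "[576 * int b * x = 1] (mod int c)" using cong_solve_coprime_int by blast
    define b' where "b' = nat ((- x) mod int c)"
    have "int b' = (- x) mod int c" using c by (simp add: b'_def)
    then have "(576 * int b * int b' + 1) mod int c = (576 * int b * (- x) + 1) mod int c"
      by (metis mod_add_cong mod_mult_right_eq)
    also have "(576 * int b * (- x) + 1) mod int c = 0"
      using x by (simp add: cong_iff_dvd_diff mod_eq_0_iff_dvd) (metis dvd_minus_iff minus_diff_eq)
    finally have "int c dvd 576 * int b * int b' + 1" by (simp add: dvd_eq_mod_eq_0)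
    moreover have "b' < c" using c by (simp add: b'_def nat_less_iff)
    ultimately show ?thesis by blast
  qed
  define \<nu> where "\<nu> = (\<lambda>b. SOME b'. b' < c \<and> int c dvd 576 * int b * int b' + 1)"
  have \<nu>: "\<nu> b < c" "int c dvd 576 * int b * int (\<nu> b) + 1" if "coprime b c" for b
    using someI_ex[OF ex[OF that]] unfolding \<nu>_def by auto
  have cop_of: "coprime b' c" if "int c dvd 576 * int b * int b' + 1" for b b'
  proof -
    have "coprime (int b') (int c)"
    proof (rule coprimeI)
      fix d assume "d dvd int b'" "d dvd int c"
      then have "d dvd 576 * int b * int b'" "d dvd 576 * int b * int b' + 1" using that by (auto intro: dvd_trans)
      then show "is_unit d" using dvd_add_right_iff by blast
    qed
    then show ?thesis by simp
  qed
  have \<nu>2: "\<nu> (\<nu> b) = b" if b: "b < c" "coprime b c" for b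
  proof -
    have c1: "coprime (\<nu> b) c" using cop_of[OF \<nu>(2)[OF b(2)]] .
    have d1: "int c dvd 576 * int b * int (\<nu> b) + 1" by (rule \<nu>(2)[OF b(2)])
    have d2: "int c dvd 576 * int (\<nu> b) * int (\<nu> (\<nu> b)) + 1" by (rule \<nu>(2)[OF c1])
    have "int c dvd (576 * int (\<nu> b) * int (\<nu> (\<nu> b)) + 1) - (576 * int b * int (\<nu> b) + 1)" using d2 d1 by (rule dvd_diff)
    also have "(576 * int (\<nu> b) * int (\<nu> (\<nu> b)) + 1) - (576 * int b * int (\<nu> b) + 1) = (576 * int (\<nu> b)) * (int (\<nu> (\<nu> b)) - int b)"
      by (simp add: algebra_simps)
    finally have "int c dvd int (\<nu> (\<nu> b)) - int b"
    proof -
      assume h: "int c dvd 576 * int (\<nu> b) * (int (\<nu> (\<nu> b)) - int b)"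
      have "coprime (int c) (576 * int (\<nu> b))" using c1 cop
        by (simp add: coprime_commute) (metis coprime_int_iff of_nat_numeral)
      with h show ?thesis by (simp add: coprime_dvd_mult_right_iff)
    qed
    then have "int (\<nu> (\<nu> b)) mod int c = int b mod int c" by (simp add: mod_eq_dvd_iff)
    then show ?thesis using \<nu>(1)[OF c1] b by simp
  qed
  have "(\<Sum>b | b < c \<and> coprime b c. F (\<nu> b)) = (\<Sum>b | b < c \<and> coprime b c. F b)"
    by (rule sum.reindex_bij_witness[of _ \<nu> \<nu>]) (use \<nu> \<nu>2 cop_of[OF \<nu>(2)] in auto)
  then show ?thesis using \<nu> cop_of[OF \<nu>(2)] by blast
qed

section \<open>The coefficients of T(l^2) and their Gauss sums\<close>

locale hecke =
  fixes r l :: nat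
  assumes r: "r \<in> {2,3,4,5,7}" and l: "prime l" "l \<ge> 5"
begin

definition s :: nat where "s = 2 * (r - 1)"

lemma two_r_eq: "2 * r = s + 2"
  using r by (auto simp: s_def)

lemma l0: "l > 0" "l > 1"
  using l by auto

lemma prime_int_l: "prime (int l)"
  using l by simp

lemma coprime_l_iff: "coprime b l \<longleftrightarrow> \<not> l dvd b"
proof
  assume c: "coprime b l"
  show "\<not> l dvd b"
  proof
    assume "l dvd b"
    then have "is_unit l" using coprime_common_divisor[OF c, of l] by simp
    then show False using l0 by simp
  qed
next
  assume "\<not> l dvd b"
  then have "coprime l b" by (rule prime_imp_coprime[OF l(1)])
  then show "coprime b l" by (simp only: coprime_commute)
qed

lemma units_l: "{h. h < l \<and> coprime h l} = {0<..<l}"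
  by (auto simp: coprime_l_iff nat_dvd_not_less intro: Nat.gr0I)

lemma l_coprime: "coprime l 12" "coprime (l\<^sup>2) 12" "coprime l 576" "coprime (l\<^sup>2) 576" "coprime (int l) 2"
proof -
  have 2: "coprime l 2" "coprime l 3"
    using l primes_coprime[of l 2] primes_coprime[of l 3] by auto
  have "coprime l (2 ^ 6 * 3 ^ 2)" using 2 by (simp only: coprime_mult_right_iff coprime_power_right_iff) simp
  then show 576: "coprime l 576" by simp
  show 12: "coprime l 12" by (rule prime_ge_5_coprime[OF l])
  show "coprime (l\<^sup>2) 12" "coprime (l\<^sup>2) 576" using 12 576 by simp_all
  have "coprime (int l) (int 2)" using 2(1) by (simp only: coprime_int_iff)
  then show "coprime (int l) 2" by simp
qed

text \<open>Makes multiplication and division of indices by l^2 preserve the class -1 modulo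
  24.\<close>

lemma l2_mod_24: "24 dvd (int l)\<^sup>2 - 1"
proof -
  have "\<not> 2 dvd l" "\<not> 3 dvd l"
    using l primes_dvd_imp_eq[of 2 l] primes_dvd_imp_eq[of 3 l] by auto
  then have "\<not> 2 dvd int l" "\<not> 3 dvd int l" by presburger+
  then have "int l mod 24 \<in> {1, 5, 7, 11, 13, 17, 19, 23}" by (simp; presburger)
  then have "(int l mod 24)\<^sup>2 mod 24 = 1" by auto
  then have "(int l)\<^sup>2 mod 24 = 1 mod 24" by (simp add: power_mod)
  then show ?thesis by (simp only: mod_eq_dvd_iff)
qed

definition chi :: complex where "chi = of_int (chi12 (int l))"

lemma chi_sq: "chi * chi = 1"
proof -
  have "coprime l 6" using l_coprime(1) coprime_divisors[of l l 6 12] by simp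
  then have "coprime (int l) 6" by (metis coprime_int_iff of_nat_numeral)
  then have "chi12 (int l) * chi12 (int l) = 1" by (rule chi12_sq)
  then have "of_int (chi12 (int l) * chi12 (int l)) = (1 :: complex)" by simp
  then show ?thesis by (simp add: chi_def)
qed

lemma chi12_l2: "chi12 (int (l\<^sup>2)) = 1"
proof -
  have "chi * chi = of_int (chi12 (int l * int l))" by (simp add: chi_def chi12_mult)
  then have "of_int (chi12 (int l * int l)) = (of_int 1 :: complex)" by (simp add: chi_sq)
  then show ?thesis by (simp only: of_int_eq_iff power2_eq_square of_nat_mult)
qed

text \<open>\<open>root_count n - 1\<close> is the Legendre symbol of \<open>-n\<close> modulo \<open>l\<close>.\<close>

definition root_count :: "int \<Rightarrow> nat" where
  "root_count n = card {y. y < l \<and> int l dvd (int y)\<^sup>2 + n}"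

definition psi :: "int \<Rightarrow> int" where
  "psi n = chi12 (int l) * (int (root_count n) - 1)"

text \<open>Only the root y = 0 is counted when l divides n. Hence T(l^2) has no diagonal term on a
  pole at -l^(2 j) with j > 0.\<close>

lemma psi_zero: "int l dvd n \<Longrightarrow> psi n = 0"
proof -
  assume n: "int l dvd n"
  have "{y. y < l \<and> int l dvd (int y)\<^sup>2 + n} = {0}"
  proof safe
    fix y assume y: "y < l" "int l dvd (int y)\<^sup>2 + n"
    then have "int l dvd (int y)\<^sup>2" using n by (simp add: dvd_add_left_iff)
    then have "int l dvd int y" by (rule prime_dvd_power[OF prime_int_l])
    then show "y = 0" using y(1) by (simp add: nat_dvd_not_less) (metis gr_zeroI nat_dvd_not_less)
  qed (use n l0 in auto)
  then show ?thesis by (simp add: psi_def root_count_def)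
qed

text \<open>Shimura's operator in weight lambda + 1/2 with lambda = 2 r - 1: the exponents
  \<open>s\<close> and \<open>2 * s + 1\<close> are lambda - 1 and 2 lambda - 1, and
  \<open>psi\<close> is \<open>chi12\<close> at l times the Legendre symbol of (-1)^lambda n =
  -n.\<close>

definition hecke_op :: "(int \<Rightarrow> complex) \<Rightarrow> int \<Rightarrow> complex" where
  "hecke_op a n = a ((int l)\<^sup>2 * n) + of_int (psi n) * of_nat l ^ s * a n +
     of_nat l ^ (2 * s + 1) * (if (int l)\<^sup>2 dvd n then a (n div (int l)\<^sup>2) else 0)"

definition gsum :: "nat \<Rightarrow> complex" where
  "gsum h = (\<Sum>y<l. eexp (of_int (int h * (int y)\<^sup>2) / of_nat l))"

text \<open>Modulo l the substitution of 2 h' y for y turns -144 h y^2 into -576 h h' (h' y^2),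
  which is h' y^2. So \<open>gsum h'\<close> is the Gauss sum of -h, and the product is one of
  opposite arguments.\<close>

lemma gsum_inverse:
  assumes h: "int l dvd 576 * int h * int h' + 1"
  shows "gauss_sum l (int h) * gsum h' = of_nat l"
proof -
  have nl: "\<not> int l dvd 1" using l0 by simp
  have hh: "\<not> int l dvd int h" "\<not> int l dvd int h'"
    using h nl by (metis dvd_add_right_iff dvd_mult dvd_mult2)+
  let ?F = "\<lambda>y::int. eexp (of_int (144 * (- int h) * y\<^sup>2) / of_nat l)"
  have per: "?F (n + int l) = ?F n" for n
  proof -
    have "144 * (- int h) * (n + int l)\<^sup>2 - 144 * (- int h) * n\<^sup>2 = int l * (144 * (- int h) * (2 * n + int l))"
      by (simp add: power2_eq_square algebra_simps)
    then show ?thesis using l0 by (intro eexp_dvd_cong) auto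
  qed
  have "coprime (2 * int h') (int l)"
  proof -
    have "coprime (int l) (int h')" by (rule prime_imp_coprime[OF prime_int_l hh(2)])
    then show ?thesis using l_coprime(5) by (simp add: coprime_commute)
  qed
  from sum_residues_affine[where F = ?F and u = "2 * int h'" and k = 0, OF per l0(1) this]
  have "gauss_sum l (- int h) = (\<Sum>y<l. ?F (2 * int h' * int y + 0))" by (simp add: gauss_sum_def)
  also have "\<dots> = gsum h'"
    unfolding gsum_def
  proof (rule sum.cong)
    fix y
    have "144 * (- int h) * (2 * int h' * int y + 0)\<^sup>2 - int h' * (int y)\<^sup>2 = - (576 * int h * int h' + 1) * (int h' * (int y)\<^sup>2)"
      by (simp add: power2_eq_square algebra_simps)
    moreover have "int l dvd - (576 * int h * int h' + 1) * (int h' * (int y)\<^sup>2)"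
      using h by (intro dvd_mult2) (simp only: dvd_minus_iff)
    ultimately have "int l dvd 144 * (- int h) * (2 * int h' * int y + 0)\<^sup>2 - int h' * (int y)\<^sup>2" by (simp only:)
    then show "?F (2 * int h' * int y + 0) = eexp (of_int (int h' * (int y)\<^sup>2) / of_nat l)"
      by (rule eexp_dvd_cong[OF _ l0(1)])
  qed simp
  finally show ?thesis using gauss_sum_prime_mult_minus[OF l hh(1)] by simp
qed

text \<open>Additive characters count the roots of y^2 + n: the sum over all h is l times
  \<open>root_count n\<close>, and removing h = 0 subtracts l. The twist of a series by
  \<open>psi\<close> thereby becomes a combination of translates, to which
  \<open>whol_cusp_transform\<close> applies.\<close>

lemma gsum_psi:
  "chi / of_nat l * (\<Sum>h | h < l \<and> coprime h l. gsum h * eexp (of_int (n * int h) / of_nat l)) = of_int (psi n)"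
proof -
  let ?e = "\<lambda>k. eexp (of_int k / of_nat l)"
  have units: "{h. h < l \<and> coprime h l} = {..<l} - {0}"
    unfolding units_l by auto
  have "(\<Sum>h | h < l \<and> coprime h l. gsum h * ?e (n * int h)) = (\<Sum>h<l. gsum h * ?e (n * int h)) - gsum 0 * ?e (n * int 0)"
    unfolding units using l0 by (subst sum_diff1) auto
  also have "gsum 0 * ?e (n * int 0) = of_nat l" by (simp add: gsum_def)
  also have "(\<Sum>h<l. gsum h * ?e (n * int h)) = (\<Sum>h<l. \<Sum>y<l. ?e (((int y)\<^sup>2 + n) * int h))"
    unfolding gsum_def sum_distrib_right
  proof (intro sum.cong refl)
    fix h y
    have "int h * (int y)\<^sup>2 + n * int h = ((int y)\<^sup>2 + n) * int h" by (simp add: algebra_simps)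
    then show "?e (int h * (int y)\<^sup>2) * ?e (n * int h) = ?e (((int y)\<^sup>2 + n) * int h)"
      unfolding eexp_add[symmetric] add_divide_distrib[symmetric] of_int_add[symmetric] by (simp only:)
  qed
  also have "\<dots> = (\<Sum>y<l. \<Sum>h<l. ?e (((int y)\<^sup>2 + n) * int h))" by (rule sum.swap)
  also have "\<dots> = (\<Sum>y<l. if int l dvd (int y)\<^sup>2 + n then of_nat l else 0)"
    by (simp only: sum_eexp_residues[OF l0(1)])
  also have "\<dots> = of_nat (root_count n) * of_nat l"
  proof -
    have "{..<l} \<inter> {y. int l dvd (int y)\<^sup>2 + n} = {y. y < l \<and> int l dvd (int y)\<^sup>2 + n}" by auto
    then show ?thesis by (simp add: sum.If_cases root_count_def)
  qed
  finally have S: "(\<Sum>h | h < l \<and> coprime h l. gsum h * ?e (n * int h)) = of_nat (root_count n) * of_nat l - of_nat l" .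
  show ?thesis unfolding S using l0 by (simp add: psi_def chi_def field_simps)
qed

end

section \<open>Invariance of the space under T(l^2)\<close>

locale hecke_form = hecke +
  fixes a :: "int \<Rightarrow> complex"
  assumes whol: "whol (2 * r) a"
begin

lemma supp: "a n \<noteq> 0 \<Longrightarrow> 24 dvd n + 1"
  using whol unfolding whol_def by blast

lemma summ: "Im z > 0 \<Longrightarrow> (\<lambda>n. a n * eexp (of_int n * z / 24)) summable_on UNIV"
  using whol unfolding whol_def by blast

abbreviation f :: "complex \<Rightarrow> complex" where "f \<equiv> qser a"

lemma f_has_sum: "Im z > 0 \<Longrightarrow> ((\<lambda>n. a n * eexp (of_int n * z / 24)) has_sum f z) UNIV"
  unfolding qser_def by (intro has_sum_infsum summ)

text \<open>The three parts correspond to the three summands of \<^const>\<open>hecke_op\<close>. The inversion \<open>y \<mapsto> 1 / y\<close> of the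
  imaginary axis exchanges \<open>Vpart\<close> with the term \<open>b = 0\<close> of \<open>Upart\<close> and \<open>Mpart\<close> with the terms such that
  \<open>l\<close> divides \<open>b \<noteq> 0\<close>, and permutes the remaining ones.\<close>

definition Upart :: "complex \<Rightarrow> complex" where
  "Upart z = (\<Sum>b<l\<^sup>2. f ((z + 24 * of_nat b) / of_nat (l\<^sup>2))) / of_nat (l\<^sup>2)"

definition Mpart :: "complex \<Rightarrow> complex" where
  "Mpart z = of_nat l ^ s * (chi / of_nat l) * (\<Sum>h | h < l \<and> coprime h l. gsum h * f (z + 24 * of_nat h / of_nat l))"

definition Vpart :: "complex \<Rightarrow> complex" where
  "Vpart z = of_nat l ^ (2 * s + 1) * f (of_nat (l\<^sup>2) * z)"

lemma inj_mult_l2: "inj (\<lambda>m. (int l)\<^sup>2 * m)"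
  using l0 by (auto simp: inj_def)

lemma notin_range_l2: "n \<notin> range (\<lambda>m. (int l)\<^sup>2 * m) \<Longrightarrow> \<not> (int l)\<^sup>2 dvd n"
  by (auto simp: dvd_def)

text \<open>Translation by 24 b before dividing by l^2 multiplies the n-th term by e(n b / l^2), and
  the average over b retains exactly the n divisible by l^2.\<close>

lemma Upart_has_sum:
  assumes z: "Im z > 0"
  shows "((\<lambda>n. a ((int l)\<^sup>2 * n) * eexp (of_int n * z / 24)) has_sum Upart z) UNIV"
proof -
  define c where "c = l\<^sup>2"
  have c: "c > 0" using l0 by (simp add: c_def)
  have im: "Im ((z + 24 * of_nat b) / of_nat c) > 0" for b
    using z c by (simp add: Im_divide_of_nat)
  have "((\<lambda>n. \<Sum>b<c. a n * eexp (of_int n * ((z + 24 * of_nat b) / of_nat c) / 24)) has_sum (\<Sum>b<c. f ((z + 24 * of_nat b) / of_nat c))) UNIV"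
    by (intro has_sum_sum_finite f_has_sum im) auto
  then have "((\<lambda>n. (1 / of_nat c) * (\<Sum>b<c. a n * eexp (of_int n * ((z + 24 * of_nat b) / of_nat c) / 24))) has_sum (1 / of_nat c) * (\<Sum>b<c. f ((z + 24 * of_nat b) / of_nat c))) UNIV"
    by (rule has_sum_cmult_right)
  moreover have "(1 / of_nat c) * (\<Sum>b<c. a n * eexp (of_int n * ((z + 24 * of_nat b) / of_nat c) / 24)) =
    (if int c dvd n then a n * eexp (of_int n * z / (24 * of_nat c)) else 0)" for n
  proof -
    have e: "eexp (of_int n * ((z + 24 * of_nat b) / of_nat c) / 24) = eexp (of_int n * z / (24 * of_nat c)) * eexp (of_int (n * int b) / of_nat c)" for b
      unfolding eexp_add[symmetric] using c by (intro arg_cong[of _ _ eexp]) (simp add: field_simps)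
    have "(\<Sum>b<c. a n * eexp (of_int n * ((z + 24 * of_nat b) / of_nat c) / 24)) = a n * eexp (of_int n * z / (24 * of_nat c)) * (\<Sum>b<c. eexp (of_int (n * int b) / of_nat c))"
      unfolding e sum_distrib_left by (simp only: mult.assoc)
    then show ?thesis unfolding sum_eexp_residues[OF c] using c by simp
  qed
  ultimately have "((\<lambda>n. if int c dvd n then a n * eexp (of_int n * z / (24 * of_nat c)) else 0) has_sum Upart z) UNIV"
    by (simp add: Upart_def c_def)
  then have "((\<lambda>n. if int c dvd n then a n * eexp (of_int n * z / (24 * of_nat c)) else 0) has_sum Upart z) (range (\<lambda>m. (int l)\<^sup>2 * m))"
    by (rule has_sum_cong_neutral[THEN iffD1, rotated -1]) (use notin_range_l2 in \<open>auto simp: c_def\<close>)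
  then have "((\<lambda>n. if int c dvd n then a n * eexp (of_int n * z / (24 * of_nat c)) else 0) \<circ> (\<lambda>m. (int l)\<^sup>2 * m) has_sum Upart z) UNIV"
    by (subst (asm) has_sum_reindex[OF inj_mult_l2]) simp
  moreover have "((\<lambda>n. if int c dvd n then a n * eexp (of_int n * z / (24 * of_nat c)) else 0) \<circ> (\<lambda>m. (int l)\<^sup>2 * m)) =
     (\<lambda>n. a ((int l)\<^sup>2 * n) * eexp (of_int n * z / 24))"
    using l0 by (auto simp: fun_eq_iff c_def field_simps)
  ultimately show ?thesis by simp
qed

lemma Mpart_has_sum:
  assumes z: "Im z > 0"
  shows "((\<lambda>n. of_int (psi n) * of_nat l ^ s * a n * eexp (of_int n * z / 24)) has_sum Mpart z) UNIV"
proof -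
  let ?U = "{h. h < l \<and> coprime h l}"
  have im: "Im (z + 24 * of_nat h / of_nat l) > 0" for h
  proof -
    have "Im (24 * of_nat h / of_nat l) = 0" by (metis Im_complex_of_real of_real_divide of_real_mult of_real_numeral of_real_of_nat_eq)
    then show ?thesis using z by simp
  qed
  have "((\<lambda>n. of_nat l ^ s * (chi / of_nat l) * (\<Sum>h\<in>?U. gsum h * (a n * eexp (of_int n * (z + 24 * of_nat h / of_nat l) / 24)))) has_sum Mpart z) UNIV"
    unfolding Mpart_def by (intro has_sum_cmult_right has_sum_sum_finite f_has_sum im) auto
  moreover have "of_nat l ^ s * (chi / of_nat l) * (\<Sum>h\<in>?U. gsum h * (a n * eexp (of_int n * (z + 24 * of_nat h / of_nat l) / 24))) =
     of_int (psi n) * of_nat l ^ s * a n * eexp (of_int n * z / 24)" for n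
  proof -
    have e: "eexp (of_int n * (z + 24 * of_nat h / of_nat l) / 24) = eexp (of_int n * z / 24) * eexp (of_int (n * int h) / of_nat l)" for h
      unfolding eexp_add[symmetric] using l0 by (intro arg_cong[of _ _ eexp]) (simp add: field_simps)
    have "(\<Sum>h\<in>?U. gsum h * (a n * eexp (of_int n * (z + 24 * of_nat h / of_nat l) / 24))) =
       a n * eexp (of_int n * z / 24) * (\<Sum>h\<in>?U. gsum h * eexp (of_int (n * int h) / of_nat l))"
      unfolding e sum_distrib_left by (simp only: mult_ac)
    then show ?thesis unfolding gsum_psi[of n, symmetric] by (simp only: mult_ac)
  qed
  ultimately show ?thesis by simp
qed

lemma Vpart_has_sum:
  assumes z: "Im z > 0"
  shows "((\<lambda>n. of_nat l ^ (2 * s + 1) * (if (int l)\<^sup>2 dvd n then a (n div (int l)\<^sup>2) else 0) * eexp (of_int n * z / 24)) has_sum Vpart z) UNIV"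
proof -
  let ?g = "\<lambda>n. of_nat l ^ (2 * s + 1) * (if (int l)\<^sup>2 dvd n then a (n div (int l)\<^sup>2) else 0) * eexp (of_int n * z / 24)"
  have im: "Im (of_nat (l\<^sup>2) * z) > 0" using z l0 by (simp del: of_nat_power)
  have "((\<lambda>n. of_nat l ^ (2 * s + 1) * (a n * eexp (of_int n * (of_nat (l\<^sup>2) * z) / 24))) has_sum Vpart z) UNIV"
    unfolding Vpart_def by (intro has_sum_cmult_right f_has_sum im)
  moreover have "(\<lambda>n. of_nat l ^ (2 * s + 1) * (a n * eexp (of_int n * (of_nat (l\<^sup>2) * z) / 24))) = ?g \<circ> (\<lambda>m. (int l)\<^sup>2 * m)"
    using l0 by (auto simp: fun_eq_iff mult_ac)
  ultimately have "(?g has_sum Vpart z) (range (\<lambda>m. (int l)\<^sup>2 * m))"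
    by (subst has_sum_reindex[OF inj_mult_l2]) simp
  then show ?thesis
    by (rule has_sum_cong_neutral[THEN iffD1, rotated -1]) (use notin_range_l2 in auto)
qed

lemma hecke_has_sum:
  assumes z: "Im z > 0"
  shows "((\<lambda>n. hecke_op a n * eexp (of_int n * z / 24)) has_sum (Upart z + Mpart z + Vpart z)) UNIV"
  using has_sum_add[OF has_sum_add[OF Upart_has_sum[OF z] Mpart_has_sum[OF z]] Vpart_has_sum[OF z]]
  unfolding hecke_op_def ring_distribs .

lemma cusp_transform:
  assumes "c > 0" "coprime c 12" "int c dvd 576 * \<alpha> * \<alpha>' + 1" "v > 0"
  shows "f (of_int (24 * \<alpha>) / of_nat c + \<i> * of_real (1 / (real c ^ 2 * v))) * (of_real (sqrt v) * of_int (chi12 (int c)) * gauss_sum c \<alpha>) =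
     (- 1) ^ r * (of_nat c * of_real v) ^ (2 * r) * f (of_int (24 * \<alpha>') / of_nat c + \<i> * of_real v)"
  by (rule whol_cusp_transform[OF whol assms])

definition U0 :: "complex \<Rightarrow> complex" where "U0 z = f (z / of_nat (l\<^sup>2)) / of_nat (l\<^sup>2)"

definition U1 :: "complex \<Rightarrow> complex" where
  "U1 z = (\<Sum>h | h < l \<and> coprime h l. f ((z + 24 * of_nat (l * h)) / of_nat (l\<^sup>2))) / of_nat (l\<^sup>2)"

definition U2 :: "complex \<Rightarrow> complex" where
  "U2 z = (\<Sum>b | b < l\<^sup>2 \<and> coprime b (l\<^sup>2). f ((z + 24 * of_nat b) / of_nat (l\<^sup>2))) / of_nat (l\<^sup>2)"

lemma Upart_split: "Upart z = U0 z + U1 z + U2 z"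
proof -
  have cop: "coprime b (l\<^sup>2) \<longleftrightarrow> \<not> l dvd b" for b by (simp add: coprime_l_iff)
  let ?F = "\<lambda>b. f ((z + 24 * of_nat b) / of_nat (l\<^sup>2))"
  have D: "{..<l\<^sup>2} = insert 0 ((\<lambda>h. l * h) ` {0<..<l} \<union> {b. b < l\<^sup>2 \<and> coprime b (l\<^sup>2)})"
  proof (intro equalityI subsetI)
    fix b assume b: "b \<in> {..<l\<^sup>2}"
    show "b \<in> insert 0 ((\<lambda>h. l * h) ` {0<..<l} \<union> {b. b < l\<^sup>2 \<and> coprime b (l\<^sup>2)})"
    proof (cases "l dvd b \<and> b \<noteq> 0")
      case True
      then obtain h where "b = l * h" by blast
      moreover from this True b have "0 < h" "h < l" by (auto simp: power2_eq_square)
      ultimately show ?thesis by auto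
    qed (use b cop in auto)
  qed (use l0 in \<open>auto simp: power2_eq_square\<close>)
  have inj: "inj_on (\<lambda>h. l * h) {0<..<l}" using l0 by (auto simp: inj_on_def)
  have "(\<Sum>b<l\<^sup>2. ?F b) = ?F 0 + ((\<Sum>b\<in>(\<lambda>h. l * h) ` {0<..<l}. ?F b) + (\<Sum>b | b < l\<^sup>2 \<and> coprime b (l\<^sup>2). ?F b))"
    unfolding D
  proof (subst sum.insert)
    show "?F 0 + sum ?F ((\<lambda>h. l * h) ` {0<..<l} \<union> {b. b < l\<^sup>2 \<and> coprime b (l\<^sup>2)}) =
      ?F 0 + ((\<Sum>b\<in>(\<lambda>h. l * h) ` {0<..<l}. ?F b) + (\<Sum>b | b < l\<^sup>2 \<and> coprime b (l\<^sup>2). ?F b))"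
      by (subst sum.union_disjoint) (auto simp: cop)
  qed (use l0 l in \<open>auto simp: cop\<close>)
  also have "(\<Sum>b\<in>(\<lambda>h. l * h) ` {0<..<l}. ?F b) = (\<Sum>h\<in>{0<..<l}. ?F (l * h))"
    by (subst sum.reindex[OF inj]) simp
  finally show ?thesis
    unfolding Upart_def U0_def U1_def U2_def units_l by (simp add: add_divide_distrib)
qed

abbreviation J :: complex where "J \<equiv> (- 1) ^ r"

lemma J_sq: "J * J = 1"
  by (simp flip: power_add)

text \<open>The case c = 1 at height v = l^2 y. The power (l^2)^(2 r) = l^(2 s + 4), divided by the
  l from sqrt v and by the l^2 in \<open>U0\<close>, leaves the l^(2 s + 1) of
  \<open>Vpart\<close>.\<close>

lemma U0_transform:
  assumes y: "y > 0"
  shows "of_real (sqrt y) * U0 (\<i> * of_real (1 / y)) = J * of_real y ^ (2 * r) * Vpart (\<i> * of_real y)"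
proof -
  have v: "y * (real l)\<^sup>2 > 0" using y l0 by simp
  have "f (\<i> * of_real (1 / (y * (real l)\<^sup>2))) * of_real (sqrt (y * (real l)\<^sup>2)) = J * of_real (y * (real l)\<^sup>2) ^ (2 * r) * f (\<i> * of_real (y * (real l)\<^sup>2))"
    using cusp_transform[of 1 0 0, OF _ _ _ v] by (simp add: gauss_sum_def chi12_def)
  moreover have "complex_of_real (sqrt (y * (real l)\<^sup>2)) = of_real (sqrt y) * of_nat l" using l0 by (simp add: real_sqrt_mult)
  moreover have "\<i> * of_real (1 / (y * (real l)\<^sup>2)) = \<i> * of_real (1 / y) / of_nat (l\<^sup>2)" by simp
  moreover have "\<i> * of_real (y * (real l)\<^sup>2) = of_nat (l\<^sup>2) * (\<i> * of_real y)" by simp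
  moreover have "complex_of_real (y * (real l)\<^sup>2) ^ (2 * r) = of_real y ^ (2 * r) * of_nat l ^ (2 * s + 4)"
  proof -
    have "2 * (2 * r) = 2 * s + 4" using two_r_eq by simp
    then have "(complex_of_nat l ^ 2) ^ (2 * r) = of_nat l ^ (2 * s + 4)" by (simp only: power_mult[symmetric])
    then show ?thesis by (simp only: of_real_mult of_real_power of_real_of_nat_eq power_mult_distrib)
  qed
  ultimately have E: "f (\<i> * of_real (1 / y) / of_nat (l\<^sup>2)) * (of_real (sqrt y) * of_nat l) = J * (of_real y ^ (2 * r) * of_nat l ^ (2 * s + 4)) * f (of_nat (l\<^sup>2) * (\<i> * of_real y))"
    by (simp only:)
  have "of_real (sqrt y) * U0 (\<i> * of_real (1 / y)) * of_nat l ^ 3 = f (\<i> * of_real (1 / y) / of_nat (l\<^sup>2)) * (of_real (sqrt y) * of_nat l)"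
    unfolding U0_def using l0 by (simp add: power2_eq_square power3_eq_cube)
  also have "\<dots> = J * of_real y ^ (2 * r) * Vpart (\<i> * of_real y) * of_nat l ^ 3"
    unfolding E Vpart_def by (simp add: power_add eval_nat_numeral)
  finally show ?thesis using l0 by simp
qed

text \<open>For b = l h the argument is 24 h / l + i / (l^2 y), so c = l and v = y. Multiplying by
  \<open>gsum (\<nu> h)\<close> turns the factor \<open>gauss_sum l (int h)\<close> into l; after
  the permutation \<nu> these multipliers are the weights in \<open>Mpart\<close>.\<close>

lemma U1_transform:
  assumes y: "y > 0"
  shows "of_real (sqrt y) * U1 (\<i> * of_real (1 / y)) = J * of_real y ^ (2 * r) * Mpart (\<i> * of_real y)"
proof -
  obtain \<nu> where \<nu>: "\<And>b. b < l \<Longrightarrow> coprime b l \<Longrightarrow> \<nu> b < l \<and> coprime (\<nu> b) l \<and> int l dvd 576 * int b * int (\<nu> b) + 1"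
    "(\<Sum>b | b < l \<and> coprime b l. gsum (\<nu> b) * f (\<i> * of_real y + 24 * of_nat (\<nu> b) / of_nat l)) = (\<Sum>b | b < l \<and> coprime b l. gsum b * f (\<i> * of_real y + 24 * of_nat b / of_nat l))"
    using sum_over_unit_inverses[OF l0(2) l_coprime(3), of "\<lambda>b. gsum b * f (\<i> * of_real y + 24 * of_nat b / of_nat l)"] by blast
  have E: "f ((\<i> * of_real (1 / y) + 24 * of_nat (l * h)) / of_nat (l\<^sup>2)) * of_real (sqrt y) =
     J * of_real y ^ (2 * r) * of_nat l ^ (2 * r) * (chi / of_nat l) * (gsum (\<nu> h) * f (\<i> * of_real y + 24 * of_nat (\<nu> h) / of_nat l))"
    if h: "h < l" "coprime h l" for h
  proof -
    have d: "int l dvd 576 * int h * int (\<nu> h) + 1" using \<nu>(1)[OF h] by blast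
    have A: "of_int (24 * int h) / of_nat l + \<i> * of_real (1 / (real l ^ 2 * y)) = (\<i> * of_real (1 / y) + 24 * of_nat (l * h)) / of_nat (l\<^sup>2)"
      using l0 y by (simp add: field_simps power2_eq_square)
    have B: "of_int (24 * int (\<nu> h)) / of_nat l + \<i> * of_real y = \<i> * of_real y + 24 * of_nat (\<nu> h) / of_nat l" by simp
    have "f ((\<i> * of_real (1 / y) + 24 * of_nat (l * h)) / of_nat (l\<^sup>2)) * (of_real (sqrt y) * chi * gauss_sum l (int h)) =
      J * (of_nat l * of_real y) ^ (2 * r) * f (\<i> * of_real y + 24 * of_nat (\<nu> h) / of_nat l)"
      using cusp_transform[OF l0(1) l_coprime(1) d y] unfolding A B chi_def .
    then have "f ((\<i> * of_real (1 / y) + 24 * of_nat (l * h)) / of_nat (l\<^sup>2)) * (of_real (sqrt y) * chi * gauss_sum l (int h)) * (chi * gsum (\<nu> h)) =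
      J * (of_nat l * of_real y) ^ (2 * r) * f (\<i> * of_real y + 24 * of_nat (\<nu> h) / of_nat l) * (chi * gsum (\<nu> h))" (is "?L = ?R") by (simp only:)
    moreover have "f ((\<i> * of_real (1 / y) + 24 * of_nat (l * h)) / of_nat (l\<^sup>2)) * (of_real (sqrt y) * chi * gauss_sum l (int h)) * (chi * gsum (\<nu> h)) =
      f ((\<i> * of_real (1 / y) + 24 * of_nat (l * h)) / of_nat (l\<^sup>2)) * of_real (sqrt y) * (chi * chi) * (gauss_sum l (int h) * gsum (\<nu> h))"
      by (simp only: mult_ac)
    ultimately have "f ((\<i> * of_real (1 / y) + 24 * of_nat (l * h)) / of_nat (l\<^sup>2)) * of_real (sqrt y) * (chi * chi) * (gauss_sum l (int h) * gsum (\<nu> h)) = ?R"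
      by (metis (no_types))
    then have "f ((\<i> * of_real (1 / y) + 24 * of_nat (l * h)) / of_nat (l\<^sup>2)) * of_real (sqrt y) * of_nat l =
      J * (of_nat l * of_real y) ^ (2 * r) * f (\<i> * of_real y + 24 * of_nat (\<nu> h) / of_nat l) * (chi * gsum (\<nu> h))"
      unfolding chi_sq gsum_inverse[OF d] mult_1_right .
    then show ?thesis using l0 by (simp add: power_mult_distrib field_simps)
  qed
  have "of_real (sqrt y) * U1 (\<i> * of_real (1 / y)) = (\<Sum>h | h < l \<and> coprime h l. f ((\<i> * of_real (1 / y) + 24 * of_nat (l * h)) / of_nat (l\<^sup>2)) * of_real (sqrt y)) / of_nat (l\<^sup>2)"
    unfolding U1_def sum_distrib_right[symmetric] by simp
  also have "\<dots> = (\<Sum>h | h < l \<and> coprime h l. J * of_real y ^ (2 * r) * of_nat l ^ (2 * r) * (chi / of_nat l) * (gsum (\<nu> h) * f (\<i> * of_real y + 24 * of_nat (\<nu> h) / of_nat l))) / of_nat (l\<^sup>2)"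
    by (intro arg_cong[of _ _ "\<lambda>x. x / _"] sum.cong refl E) auto
  also have "\<dots> = J * of_real y ^ (2 * r) * of_nat l ^ (2 * r) * (chi / of_nat l) * (\<Sum>b | b < l \<and> coprime b l. gsum b * f (\<i> * of_real y + 24 * of_nat b / of_nat l)) / of_nat (l\<^sup>2)"
    unfolding sum_distrib_left[symmetric] \<nu>(2) ..
  also have "\<dots> = J * of_real y ^ (2 * r) * Mpart (\<i> * of_real y)"
    unfolding Mpart_def two_r_eq using l0 by (simp add: power_add power2_eq_square)
  finally show ?thesis .
qed

text \<open>Here c = l^2 and v = y / l^2. The Gauss sum is l = sqrt c, which cancels against sqrt v
  = sqrt y / l, and \<open>chi12\<close> is 1 at l^2. So the terms are permuted without
  weights.\<close>

lemma U2_transform: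
  assumes y: "y > 0"
  shows "of_real (sqrt y) * U2 (\<i> * of_real (1 / y)) = J * of_real y ^ (2 * r) * U2 (\<i> * of_real y)"
proof -
  have l2: "l\<^sup>2 > 1" using one_less_power[OF l0(2), of 2] by simp
  obtain \<nu> where \<nu>: "\<And>b. b < l\<^sup>2 \<Longrightarrow> coprime b (l\<^sup>2) \<Longrightarrow> \<nu> b < l\<^sup>2 \<and> coprime (\<nu> b) (l\<^sup>2) \<and> int (l\<^sup>2) dvd 576 * int b * int (\<nu> b) + 1"
    "(\<Sum>b | b < l\<^sup>2 \<and> coprime b (l\<^sup>2). f ((\<i> * of_real y + 24 * of_nat (\<nu> b)) / of_nat (l\<^sup>2))) = (\<Sum>b | b < l\<^sup>2 \<and> coprime b (l\<^sup>2). f ((\<i> * of_real y + 24 * of_nat b) / of_nat (l\<^sup>2)))"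
    using sum_over_unit_inverses[OF l2 l_coprime(4), of "\<lambda>b. f ((\<i> * of_real y + 24 * of_nat b) / of_nat (l\<^sup>2))"] by blast
  have E: "f ((\<i> * of_real (1 / y) + 24 * of_nat b) / of_nat (l\<^sup>2)) * of_real (sqrt y) = J * of_real y ^ (2 * r) * f ((\<i> * of_real y + 24 * of_nat (\<nu> b)) / of_nat (l\<^sup>2))"
    if b: "b < l\<^sup>2" "coprime b (l\<^sup>2)" for b
  proof -
    define c where "c = l\<^sup>2"
    have c: "c > 0" "coprime c 12" using l0 l_coprime by (simp_all add: c_def)
    have d: "int c dvd 576 * int b * int (\<nu> b) + 1" using \<nu>(1)[OF b] unfolding c_def by blast
    have v: "y / real c > 0" using y c by simp
    have nd: "\<not> int l dvd int b"
    proof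
      assume "int l dvd int b"
      then have "l dvd b" "l dvd l\<^sup>2" by auto
      with b(2) have "is_unit l" by (rule coprime_common_divisor)
      then show False using l0 by simp
    qed
    have "of_int (24 * int b) / of_nat c + \<i> * of_real (1 / (real c ^ 2 * (y / real c))) = (\<i> * of_real (1 / y) + 24 * of_nat b) / of_nat c"
      using c y by (simp add: field_simps power2_eq_square)
    moreover have "of_int (24 * int (\<nu> b)) / of_nat c + \<i> * of_real (y / real c) = (\<i> * of_real y + 24 * of_nat (\<nu> b)) / of_nat c"
      using c by (simp add: field_simps)
    moreover have "of_real (sqrt (y / real c)) * of_int (chi12 (int c)) * gauss_sum c (int b) = of_real (sqrt y)"
    proof -
      have "sqrt (real c) = real l" by (simp add: c_def)
      then show ?thesis using l0 gauss_sum_prime_square[OF l nd] chi12_l2 unfolding c_def by (simp add: real_sqrt_divide)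
    qed
    moreover have "of_nat c * complex_of_real (y / real c) = of_real y" using c by simp
    ultimately show ?thesis
      using cusp_transform[OF c d v] unfolding c_def[symmetric] by simp
  qed
  have "of_real (sqrt y) * U2 (\<i> * of_real (1 / y)) = (\<Sum>b | b < l\<^sup>2 \<and> coprime b (l\<^sup>2). f ((\<i> * of_real (1 / y) + 24 * of_nat b) / of_nat (l\<^sup>2)) * of_real (sqrt y)) / of_nat (l\<^sup>2)"
    unfolding U2_def sum_distrib_right[symmetric] by simp
  also have "\<dots> = (\<Sum>b | b < l\<^sup>2 \<and> coprime b (l\<^sup>2). J * of_real y ^ (2 * r) * f ((\<i> * of_real y + 24 * of_nat (\<nu> b)) / of_nat (l\<^sup>2))) / of_nat (l\<^sup>2)"
    by (intro arg_cong[of _ _ "\<lambda>x. x / _"] sum.cong refl E) auto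
  also have "\<dots> = J * of_real y ^ (2 * r) * U2 (\<i> * of_real y)"
    unfolding sum_distrib_left[symmetric] \<nu>(2) U2_def by simp
  finally show ?thesis .
qed

text \<open>The relation at 1 / y read backwards; this is consistent because \<open>J\<close>
  squares to 1. It supplies the images of \<open>Vpart\<close> and \<open>Mpart\<close>.\<close>

lemma swap_transform:
  assumes A: "\<And>y. y > 0 \<Longrightarrow> of_real (sqrt y) * A (\<i> * of_real (1 / y)) = J * of_real y ^ (2 * r) * B (\<i> * of_real y)" and y: "y > 0"
  shows "of_real (sqrt y) * B (\<i> * of_real (1 / y)) = J * of_real y ^ (2 * r) * (A (\<i> * of_real y) :: complex)"
proof -
  have E: "of_real (sqrt (1 / y)) * A (\<i> * of_real y) = J * of_real (1 / y) ^ (2 * r) * B (\<i> * of_real (1 / y))"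
    using A[of "1 / y"] y by simp
  have pq: "of_real (sqrt y) * complex_of_real (sqrt (1 / y)) = 1" using y by (simp add: real_sqrt_divide)
  have "of_real y * complex_of_real (1 / y) = 1" using y by simp
  then have YZ: "of_real y ^ (2 * r) * complex_of_real (1 / y) ^ (2 * r) = 1" by (simp only: power_mult_distrib[symmetric] power_one)
  have "J * of_real y ^ (2 * r) * A (\<i> * of_real y) = J * of_real y ^ (2 * r) * A (\<i> * of_real y) * (of_real (sqrt y) * of_real (sqrt (1 / y)))"
    unfolding pq by simp
  also have "\<dots> = J * of_real y ^ (2 * r) * of_real (sqrt y) * (of_real (sqrt (1 / y)) * A (\<i> * of_real y))" by (simp only: mult_ac)
  finally have "J * of_real y ^ (2 * r) * A (\<i> * of_real y) = J * of_real y ^ (2 * r) * of_real (sqrt y) * (J * of_real (1 / y) ^ (2 * r) * B (\<i> * of_real (1 / y)))"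
    unfolding E .
  also have "\<dots> = (J * J) * (of_real y ^ (2 * r) * of_real (1 / y) ^ (2 * r)) * (of_real (sqrt y) * B (\<i> * of_real (1 / y)))" by (simp only: mult_ac)
  finally show ?thesis unfolding J_sq YZ by (simp only: mult_1_left)
qed

lemma hecke_whol: "whol (2 * r) (hecke_op a)"
proof -
  have supp': "24 dvd n + 1" if "hecke_op a n \<noteq> 0" for n
  proof -
    have "a ((int l)\<^sup>2 * n) \<noteq> 0 \<or> a n \<noteq> 0 \<or> ((int l)\<^sup>2 dvd n \<and> a (n div (int l)\<^sup>2) \<noteq> 0)"
      using that by (auto simp: hecke_op_def split: if_splits)
    then show ?thesis
    proof (elim disjE conjE)
      assume "a ((int l)\<^sup>2 * n) \<noteq> 0"
      then have "24 dvd (int l)\<^sup>2 * n + 1" by (rule supp)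
      moreover have "24 dvd ((int l)\<^sup>2 - 1) * n" using l2_mod_24 by simp
      ultimately have "24 dvd ((int l)\<^sup>2 * n + 1) - ((int l)\<^sup>2 - 1) * n" by (rule dvd_diff)
      then show ?thesis by (simp add: algebra_simps)
    next
      assume "a n \<noteq> 0" then show ?thesis by (rule supp)
    next
      assume "(int l)\<^sup>2 dvd n" "a (n div (int l)\<^sup>2) \<noteq> 0"
      then obtain m where m: "n = (int l)\<^sup>2 * m" "24 dvd m + 1" using supp l0 by auto
      have "24 dvd ((int l)\<^sup>2 - 1) * m" using l2_mod_24 by simp
      with m(2) have "24 dvd (m + 1) + ((int l)\<^sup>2 - 1) * m" by (rule dvd_add)
      then show ?thesis using m by (simp add: algebra_simps)
    qed
  qed
  obtain M :: nat where M: "\<And>n. n < - int M \<Longrightarrow> a n = 0" using whol unfolding whol_def by blast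
  \<comment> \<open>The third term of \<open>hecke_op\<close> multiplies the lowest index by
    l^2.\<close>
  have bound: "hecke_op a n = 0" if n: "n < - int (l\<^sup>2 * M)" for n
  proof -
    have l1: "(int l)\<^sup>2 \<ge> 1" using l0 by (simp add: int_one_le_iff_zero_less)
    have n0: "n < 0" using n by (meson less_le_trans neg_le_0_iff_le of_nat_0_le_iff)
    have "int M \<le> (int l)\<^sup>2 * int M" using l1 mult_right_mono[of 1 "(int l)\<^sup>2" "int M"] by simp
    then have "n < - int M" using n by simp
    then have "a n = 0" by (rule M)
    moreover have "(int l)\<^sup>2 * n \<le> n" using l1 n0 mult_right_mono_neg[of 1 "(int l)\<^sup>2" n] by simp
    then have "a ((int l)\<^sup>2 * n) = 0" using \<open>n < - int M\<close> by (intro M) (rule le_less_trans)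
    moreover have "a (n div (int l)\<^sup>2) = 0" if dv: "(int l)\<^sup>2 dvd n"
    proof -
      from dv obtain m where m: "n = (int l)\<^sup>2 * m" by (rule dvdE)
      then have "(int l)\<^sup>2 * m < (int l)\<^sup>2 * (- int M)" using n by simp
      moreover have "(int l)\<^sup>2 > 0" using l0 by simp
      ultimately have "m < - int M" by (simp only: mult_less_cancel_left_pos)
      then show ?thesis using m l0 by (simp add: M)
    qed
    ultimately show ?thesis by (simp add: hecke_op_def)
  qed
  have summ': "(\<lambda>n. hecke_op a n * eexp (of_int n * z / 24)) summable_on UNIV" if "Im z > 0" for z
    using hecke_has_sum[OF that] by (rule has_sum_imp_summable)
  have qs: "qser (hecke_op a) z = Upart z + Mpart z + Vpart z" if "Im z > 0" for z
    unfolding qser_def using hecke_has_sum[OF that] by (rule infsumI)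
  have hol: "qser (hecke_op a) holomorphic_on upper"
    using qser_holomorphic[of "hecke_op a" "l\<^sup>2 * M"] supp' bound summ' by blast
  have S: "qser (hecke_op a) (- 1 / z) * eta (- 1 / z) = z ^ (2 * r) * (qser (hecke_op a) z * eta z)" if z: "Im z > 0" for z
  proof (rule holomorphic_eqI_imag_axis[where f = "\<lambda>z. qser (hecke_op a) (- 1 / z) * eta (- 1 / z)" and g = "\<lambda>z. z ^ (2 * r) * (qser (hecke_op a) z * eta z)", OF _ _ _ z])
    show "(\<lambda>z. qser (hecke_op a) (- 1 / z) * eta (- 1 / z)) holomorphic_on upper"
      by (intro holomorphic_on_mult compose_neg_inverse_holomorphic hol eta_holomorphic)
    show "(\<lambda>z. z ^ (2 * r) * (qser (hecke_op a) z * eta z)) holomorphic_on upper"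
      by (intro holomorphic_intros hol eta_holomorphic)
    fix y :: real assume y: "y > 0"
    have im: "Im (\<i> * of_real y) > 0" "Im (\<i> * of_real (1 / y)) > 0" using y by simp_all
    have S0: "of_real (sqrt y) * Vpart (\<i> * of_real (1 / y)) = J * of_real y ^ (2 * r) * U0 (\<i> * of_real y)"
      by (rule swap_transform[OF U0_transform y])
    have S1: "of_real (sqrt y) * Mpart (\<i> * of_real (1 / y)) = J * of_real y ^ (2 * r) * U1 (\<i> * of_real y)"
      by (rule swap_transform[OF U1_transform y])
    have "of_real (sqrt y) * qser (hecke_op a) (\<i> * of_real (1 / y)) =
      of_real (sqrt y) * U0 (\<i> * of_real (1 / y)) + of_real (sqrt y) * U1 (\<i> * of_real (1 / y)) + of_real (sqrt y) * U2 (\<i> * of_real (1 / y)) +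
      of_real (sqrt y) * Mpart (\<i> * of_real (1 / y)) + of_real (sqrt y) * Vpart (\<i> * of_real (1 / y))"
      unfolding qs[OF im(2)] Upart_split ring_distribs ..
    also have "\<dots> = J * of_real y ^ (2 * r) * qser (hecke_op a) (\<i> * of_real y)"
      unfolding qs[OF im(1)] Upart_split U0_transform[OF y] U1_transform[OF y] U2_transform[OF y]
        S0 S1 ring_distribs by (simp only: add_ac)
    finally have "qser (hecke_op a) (\<i> * of_real (1 / y)) * (of_real (sqrt y) * eta (\<i> * of_real y)) = J * of_real y ^ (2 * r) * (qser (hecke_op a) (\<i> * of_real y) * eta (\<i> * of_real y))"
      by (simp add: mult_ac)
    moreover have "- 1 / (\<i> * of_real y) = \<i> * of_real (1 / y)" using y by (simp add: complex_eq_iff Re_divide Im_divide power2_eq_square)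
    moreover have "(\<i> * of_real y) ^ (2 * r) = J * of_real y ^ (2 * r)" by (simp only: power_mult_distrib[of \<i>] power_mult[of \<i>] power2_i)
    ultimately show "qser (hecke_op a) (- 1 / (\<i> * of_real y)) * eta (- 1 / (\<i> * of_real y)) = (\<i> * of_real y) ^ (2 * r) * (qser (hecke_op a) (\<i> * of_real y) * eta (\<i> * of_real y))"
      using eta_imag_inversion[OF y] by simp
  qed
  show ?thesis
    unfolding whol_def using supp' bound summ' S by blast
qed

end

section \<open>Divisibility\<close>

text \<open>Divisibility is stated for complex numbers because the coefficients live there; the
  quotient is required to be an integer, so integrality is included.\<close>

definition pow_dvd :: "nat \<Rightarrow> nat \<Rightarrow> complex \<Rightarrow> bool" where
  "pow_dvd p e x \<longleftrightarrow> (\<exists>i::int. x = of_int (i * int p ^ e))"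

lemma pow_dvd_add: "pow_dvd p e x \<Longrightarrow> pow_dvd p e y \<Longrightarrow> pow_dvd p e (x + y)"
  unfolding pow_dvd_def by (metis distrib_right of_int_add)

lemma pow_dvd_diff: "pow_dvd p e x \<Longrightarrow> pow_dvd p e y \<Longrightarrow> pow_dvd p e (x - y)"
  unfolding pow_dvd_def by (metis left_diff_distrib of_int_diff)

lemma pow_dvd_mult_int: "pow_dvd p e x \<Longrightarrow> pow_dvd p e (of_int c * x)"
  unfolding pow_dvd_def by (metis mult.assoc of_int_mult)

lemma pow_dvd_mono: "pow_dvd p e x \<Longrightarrow> d \<le> e \<Longrightarrow> pow_dvd p d x"
  unfolding pow_dvd_def by (metis le_add_diff_inverse2 mult.assoc power_add)

lemma pow_dvd_mult_power: "pow_dvd p e x \<Longrightarrow> d \<le> f + e \<Longrightarrow> pow_dvd p d (of_nat p ^ f * x)"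
proof -
  assume "pow_dvd p e x" and d: "d \<le> f + e"
  then obtain i where "x = of_int (i * int p ^ e)" unfolding pow_dvd_def by blast
  then have "of_nat p ^ f * x = of_int (i * int p ^ (f + e))" by (simp add: power_add mult_ac)
  then have "pow_dvd p (f + e) (of_nat p ^ f * x)" unfolding pow_dvd_def by blast
  then show ?thesis using d by (rule pow_dvd_mono)
qed

lemma pow_dvd_0: "x \<in> \<int> \<Longrightarrow> pow_dvd p 0 x"
  unfolding pow_dvd_def by (auto elim: Ints_cases)

lemma pow_dvd_zero: "pow_dvd p e 0"
  unfolding pow_dvd_def by (intro exI[of _ 0]) simp

section \<open>Forms with a single pole and their divisibility\<close>

context hecke
begin

text \<open>The member with principal part \<open>q\<close> to the power \<open>-l\<^sup>2\<^sup>j / 24\<close>. On principal parts \<^const>\<open>hecke_op\<close>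
  shifts the index by one in both directions, up to the diagonal term at \<open>j = 0\<close>.\<close>

fun pole_basis :: "nat \<Rightarrow> int \<Rightarrow> complex" where
  "pole_basis 0 n = e_series r n"
| "pole_basis (Suc 0) n = (hecke_op (e_series r) n - of_int (psi (-1)) * of_nat l ^ s * e_series r n) / of_nat l ^ (2 * s + 1)"
| "pole_basis (Suc (Suc j)) n = (hecke_op (pole_basis (Suc j)) n - pole_basis j n) / of_nat l ^ (2 * s + 1)"

lemma hecke_op_whol: "whol (2 * r) a \<Longrightarrow> whol (2 * r) (hecke_op a)"
  using hecke_form.hecke_whol[of r l a] hecke_axioms unfolding hecke_form_def hecke_form_axioms_def by blast

lemma pole_basis_whol: "whol (2 * r) (pole_basis j)"
proof (induction j rule: induct_nat_012)
  case 0
  have "pole_basis 0 = e_series r" by (rule ext) simp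
  then show ?case using e_series_whol[OF r] by simp
next
  case 1
  have "pole_basis (Suc 0) = (\<lambda>n. (1 / of_nat l ^ (2 * s + 1)) * hecke_op (e_series r) n + (- of_int (psi (-1)) * of_nat l ^ s / of_nat l ^ (2 * s + 1)) * e_series r n)"
    by (rule ext) (simp add: diff_divide_distrib)
  then show ?case using whol_linear[OF hecke_op_whol[OF e_series_whol[OF r]] e_series_whol[OF r]] by (simp only:)
next
  case (ge2 j)
  have "pole_basis (Suc (Suc j)) = (\<lambda>n. (1 / of_nat l ^ (2 * s + 1)) * hecke_op (pole_basis (Suc j)) n + (- 1 / of_nat l ^ (2 * s + 1)) * pole_basis j n)"
    by (rule ext) (simp add: diff_divide_distrib)
  then show ?case using whol_linear[OF hecke_op_whol[OF ge2(2)] ge2(1)] by (simp only:)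
qed

lemma l2_mult_eq_iff: "(int l)\<^sup>2 * n = - (int l ^ (2 * Suc j)) \<longleftrightarrow> n = - (int l ^ (2 * j))"
proof -
  have e: "- (int l ^ (2 * Suc j)) = (int l)\<^sup>2 * (- (int l ^ (2 * j)))" by (simp add: power2_eq_square)
  show ?thesis unfolding e mult_cancel_left using l0 by simp
qed

text \<open>The first term of \<open>hecke_op\<close> moves the pole from l^(2 j) to l^(2 (j - 1)),
  where it is lost if j = 0; the last term moves it up with the factor l^(2 s + 1); and
  \<open>psi_zero\<close> kills the diagonal one unless j = 0.\<close>

lemma hecke_op_negative:
  assumes a: "\<And>n. n < 0 \<Longrightarrow> a n = (if n = - (int l ^ (2 * j)) then 1 else 0)" and n: "n < 0"
  shows "hecke_op a n = (if j > 0 \<and> n = - (int l ^ (2 * (j - 1))) then 1 else 0) +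
     (if j = 0 \<and> n = -1 then of_int (psi (-1)) * of_nat l ^ s else 0) + (if n = - (int l ^ (2 * Suc j)) then of_nat l ^ (2 * s + 1) else 0)"
proof -
  have l2: "(int l)\<^sup>2 > 1" using l0 by (simp add: one_less_power)
  have 1: "a ((int l)\<^sup>2 * n) = (if j > 0 \<and> n = - (int l ^ (2 * (j - 1))) then 1 else 0)"
  proof -
    have "(int l)\<^sup>2 * n < 0" using l2 n l0 by (intro mult_pos_neg) auto
    then have e: "a ((int l)\<^sup>2 * n) = (if (int l)\<^sup>2 * n = - (int l ^ (2 * j)) then 1 else 0)" by (rule a)
    show ?thesis
    proof (cases j)
      case 0
      have "(int l)\<^sup>2 * n \<noteq> -1"
      proof
        assume "(int l)\<^sup>2 * n = -1"
        then have "(int l)\<^sup>2 dvd -1" by (metis dvd_triv_left)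
        then show False using l2 by (simp add: zdvd1_eq)
      qed
      then show ?thesis using 0 e by simp
    next
      case (Suc i)
      then show ?thesis unfolding e Suc l2_mult_eq_iff by simp
    qed
  qed
  have 2: "of_int (psi n) * of_nat l ^ s * a n = (if j = 0 \<and> n = -1 then of_int (psi (-1)) * of_nat l ^ s else 0)"
  proof (cases "j = 0")
    case False
    then have "int l dvd int l ^ (2 * j)" by (intro dvd_power) auto
    then have "n = - (int l ^ (2 * j)) \<Longrightarrow> psi n = 0" by (intro psi_zero) simp
    then show ?thesis using a[OF n] False by auto
  qed (use a[OF n] in auto)
  have 3: "(if (int l)\<^sup>2 dvd n then a (n div (int l)\<^sup>2) else 0) = (if n = - (int l ^ (2 * Suc j)) then 1 else 0)"
  proof (cases "(int l)\<^sup>2 dvd n")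
    case True
    then obtain m where m: "n = (int l)\<^sup>2 * m" by (rule dvdE)
    then have "m < 0" using n l2 by (simp add: mult_less_0_iff)
    then have "a m = (if m = - (int l ^ (2 * j)) then 1 else 0)" by (rule a)
    moreover have "n div (int l)\<^sup>2 = m" using m l0 by simp
    ultimately show ?thesis using True unfolding m l2_mult_eq_iff by simp
  next
    case False
    moreover have "(int l)\<^sup>2 dvd - (int l ^ (2 * Suc j))" by (simp add: power2_eq_square)
    ultimately show ?thesis by auto
  qed
  show ?thesis unfolding hecke_op_def 1 2 3 by simp
qed

lemma e_series_negative: "n < 0 \<Longrightarrow> e_series r n = (if n = -1 then 1 else 0)"
proof (cases "n = -1")
  case True
  have "qpoch_inf dvd eisenstein_fps r" by (rule unit_imp_dvd) simp
  then have "fps_nth (eisenstein_fps r / qpoch_inf * qpoch_inf) 0 = 1" by (simp add: eisenstein_fps_def)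
  then have "fps_nth (eisenstein_fps r / qpoch_inf) 0 = 1" by (simp only: fps_mult_nth_0 qpoch_inf_nth_0 mult_1_right)
  then show ?thesis using True by (simp add: e_series_def e_coeff_def)
next
  case False
  assume "n < 0"
  then show ?thesis using False e_series_supp[of r n] by force
qed

lemma pole_basis_negative: "n < 0 \<Longrightarrow> pole_basis j n = (if n = - (int l ^ (2 * j)) then 1 else 0)"
proof (induction j arbitrary: n rule: induct_nat_012)
  case 0
  then show ?case by (simp add: e_series_negative)
next
  case 1
  have e: "e_series r n = (if n = - (int l ^ (2 * 0)) then 1 else 0)" if "n < 0" for n
    using e_series_negative[OF that] by simp
  show ?case
    using hecke_op_negative[of "e_series r" 0 n, OF e 1] e[OF 1] l0 by (simp split: if_splits)
next
  case (ge2 j)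
  have "hecke_op (pole_basis (Suc j)) n - pole_basis j n = (if n = - (int l ^ (2 * Suc (Suc j))) then of_nat l ^ (2 * s + 1) else 0)"
    using hecke_op_negative[of "pole_basis (Suc j)" "Suc j" n, OF ge2(2) ge2(3)] ge2(1)[OF ge2(3)] by (simp del: pole_basis.simps)
  then show ?case using l0 by simp
qed

text \<open>The recursion divides by l^(2 s + 1) at each step and shows nothing about integrality.
  It follows from the principal part, whose only nonzero coefficient is 1.\<close>

lemma pole_basis_Ints: "pole_basis j n \<in> \<int>"
  by (rule whol_integral[OF r pole_basis_whol]) (simp add: pole_basis_negative)

lemma hecke_op_pole_basis_0:
  "hecke_op (pole_basis 0) n = of_nat l ^ (2 * s + 1) * pole_basis 1 n + of_int (psi (-1)) * (of_nat l ^ s * pole_basis 0 n)"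
proof -
  have "pole_basis 0 = e_series r" by (rule ext) simp
  then show ?thesis using l0 by simp
qed

lemma hecke_op_pole_basis_Suc:
  "hecke_op (pole_basis (Suc j)) n = of_nat l ^ (2 * s + 1) * pole_basis (Suc (Suc j)) n + pole_basis j n"
  using l0 by simp

lemma pole_basis_l2_mult:
  "pole_basis j ((int l)\<^sup>2 * n) = hecke_op (pole_basis j) n - of_int (psi n) * (of_nat l ^ s * pole_basis j n) -
     of_nat l ^ (2 * s + 1) * (if (int l)\<^sup>2 dvd n then pole_basis j (n div (int l)\<^sup>2) else 0)"
  unfolding hecke_op_def by (simp only: mult.assoc) simp

text \<open>Induction on m for all j together. Put x = l^(2 (m - 1)) n; the coefficient at l^2 x is
  the value of \<open>hecke_op\<close> at x minus its diagonal and last terms. Every contribution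
  carries l^s or l^(2 s + 1) except \<open>pole_basis (j - 1)\<close> at x, and there the smaller j
  compensates: (m - 1) - (j - 1) = m - j. For j = 0 its place is taken by a multiple of l^s
  \<open>pole_basis 0\<close>. Truncated subtraction makes the claim mere integrality for m <=
  j.\<close>

lemma pole_basis_divisible: "pow_dvd l (s * (m - j)) (pole_basis j ((int l)\<^sup>2 ^ m * n))"
proof (induction m arbitrary: j n rule: less_induct)
  case (less m)
  show ?case
  proof (cases m)
    case 0
    then show ?thesis using pow_dvd_0[OF pole_basis_Ints] by simp
  next
    case (Suc k)
    define x where "x = (int l)\<^sup>2 ^ k * n"
    have IH: "pow_dvd l (s * (k - i)) (pole_basis i x)" for i
      unfolding x_def by (rule less) (use Suc in simp)
    have last: "pow_dvd l (s * (m - j)) (of_nat l ^ (2 * s + 1) * (if (int l)\<^sup>2 dvd x then pole_basis j (x div (int l)\<^sup>2) else 0))"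
    proof (cases "(int l)\<^sup>2 dvd x")
      case True
      \<comment> \<open>For k = 0 only integrality is available at x / l^2, and the truncated
        exponent is 0 accordingly. The factor l^(2 s + 1) pays for the two steps from k - 1 to
        m.\<close>
      have "pow_dvd l (s * (k - 1 - j)) (pole_basis j (x div (int l)\<^sup>2))"
      proof (cases k)
        case 0
        then show ?thesis using pow_dvd_0[OF pole_basis_Ints] by simp
      next
        case (Suc i)
        have "x div (int l)\<^sup>2 = (int l)\<^sup>2 ^ i * n" using l0 by (simp add: x_def Suc mult.assoc)
        moreover have "pow_dvd l (s * (i - j)) (pole_basis j ((int l)\<^sup>2 ^ i * n))"
          by (rule less) (use Suc \<open>m = Suc k\<close> in simp)
        ultimately show ?thesis using Suc by simp
      qed
      moreover have "s * (m - j) \<le> (2 * s + 1) + s * (k - 1 - j)"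
      proof -
        have "s * (m - j) \<le> s * (2 + (k - 1 - j))" using Suc by (intro mult_left_mono) auto
        then show ?thesis by (simp add: ring_distribs)
      qed
      ultimately show ?thesis using True by (simp only: if_True pow_dvd_mult_power)
    qed (simp add: pow_dvd_zero)
    have mid: "pow_dvd l (s * (m - j)) (of_int c * (of_nat l ^ s * pole_basis j x))" for c
    proof -
      have "s * (m - j) \<le> s * (1 + (k - j))" using Suc by (intro mult_left_mono) auto
      then have "s * (m - j) \<le> s + s * (k - j)" by simp
      then show ?thesis by (intro pow_dvd_mult_int pow_dvd_mult_power[OF IH])
    qed
    have up: "pow_dvd l (s * (m - j)) (of_nat l ^ (2 * s + 1) * pole_basis (Suc j) x)"
    proof -
      have "s * (m - j) \<le> s * (2 + (k - Suc j))" using Suc by (intro mult_left_mono) auto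
      then have "s * (m - j) \<le> (2 * s + 1) + s * (k - Suc j)" by (simp add: ring_distribs)
      then show ?thesis by (rule pow_dvd_mult_power[OF IH])
    qed
    have hecke: "pow_dvd l (s * (m - j)) (hecke_op (pole_basis j) x)"
    proof (cases j)
      case 0
      show ?thesis using up mid unfolding 0 hecke_op_pole_basis_0 One_nat_def by (blast intro: pow_dvd_add)
    next
      case (Suc i)
      have "s * (m - j) = s * (k - i)" using Suc \<open>m = Suc k\<close> by simp
      then have "pow_dvd l (s * (m - j)) (pole_basis i x)" using IH[of i] by (simp only:)
      then show ?thesis using up unfolding Suc hecke_op_pole_basis_Suc by (intro pow_dvd_add)
    qed
    have "(int l)\<^sup>2 ^ m * n = (int l)\<^sup>2 * x" by (simp add: Suc x_def mult.assoc)
    then show ?thesis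
      unfolding pole_basis_l2_mult[of j x] \<open>(int l)\<^sup>2 ^ m * n = (int l)\<^sup>2 * x\<close>
      by (simp only: pow_dvd_diff hecke mid last)
  qed
qed

text \<open>For j = 0 nothing is subtracted from m. The equality descends from complex to rational
  numbers since \<open>of_rat\<close> is injective.\<close>

lemma e_coeff_divisible:
  "\<exists>k::int. e_coeff r ((of_nat l ^ (2 * m) * of_int n + 1) / 24) = of_int (k * int l ^ (2 * (r - 1) * m))"
proof -
  have "pow_dvd l (s * (m - 0)) (pole_basis 0 ((int l)\<^sup>2 ^ m * n))" by (rule pole_basis_divisible)
  then obtain k where "e_series r ((int l)\<^sup>2 ^ m * n) = of_int (k * int l ^ (s * m))"
    unfolding pow_dvd_def by auto
  moreover have e: "(of_int ((int l)\<^sup>2 ^ m * n) :: rat) = of_nat l ^ (2 * m) * of_int n"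
    by (simp add: power_mult[symmetric])
  ultimately have "(of_rat (e_coeff r ((of_nat l ^ (2 * m) * of_int n + 1) / 24)) :: complex) = of_rat (of_int (k * int l ^ (s * m)))"
    unfolding e_series_def e of_rat_of_int_eq by (simp only:)
  then have "e_coeff r ((of_nat l ^ (2 * m) * of_int n + 1) / 24) = of_int (k * int l ^ (s * m))"
    by (simp only: of_rat_eq_iff)
  then show ?thesis unfolding s_def by blast
qed

end

theorem theorem2p4:
  fixes r m l :: nat and n :: int
  assumes "r \<in> {2, 3, 4, 5, 7}"
    and "m \<ge> 1"
    and "prime l"
    and "l \<ge> 5"
  shows "\<exists>k :: int.
    e_coeff r ((of_nat l ^ (2 * m) * of_int n + 1) / 24) =
      of_int (k * int l ^ (2 * (r - 1) * m))"
proof -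
  interpret hecke r l by unfold_locales (use assms in auto)
  show ?thesis by (rule e_coeff_divisible)
qed

end
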